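(* Assume $p\ge2$ and $m>1$, and let $\vec a\in C^\infty(\overline\Omega)$ be a smooth vector field and $f\in L^2(\Omega)$. Suppose $a_0\in L^\infty(\Omega)$ satisfies $$\tfrac12(\vec\nabla\cdot\vec a+a_0)\ge0 .$$ Consider the following convex and lower semi-continuous functional on $L^2(\Omega)$: $$\varphi(u)=\begin{cases}\frac1p\int_\Omega|\nabla u|^p\,dx+\frac14\int_\Omega(\vec\nabla\cdot\vec a+a_0)|u|^2\,dx+\frac1m\int_\Omega|u|^m\,dx+\int_\Omega uf\,dx & \text{if }u\in W_0^{1,p}(\Omega),\\ +\infty&\text{if }u\notin W_0^{1,p}(\Omega),\end{cases}$$ and define $I(u)=\varphi(u)+\varphi^*(Au)$ on $W_0^{1,p}(\Omega)$. Then: 1. There exists $\bar u\in W_0^{1,p}(\Omega)$ such that $I(\bar u)=\inf\{I(u):u\in W_0^{1,p}(\Omega)\}=0$. 2. The minimizer $\bar u$ satisfies $$-\Delta_p\bar u+\tfrac12a_0\bar u+\bar u|\bar u|^{m-2}+f=\vec a\cdot\vec\nabla\bar u\ \text{ on }\Omega,\qquad \bar u=0\ \text{ on }\partial\Omega .$$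
   Context: $\Omega\subset\mathbb{R}^n$ is a bounded open set with $C^\infty$ boundary. $Au=\vec a\cdot\vec\nabla u+\frac12(\vec\nabla\cdot\vec a)u$ with domain $D(A)=\{u\in L^2(\Omega):\vec a\cdot\vec\nabla u+\frac12(\vec\nabla\cdot\vec a)u\in L^2(\Omega)\}$. $\varphi^*$ is the Legendre–Fenchel conjugate of $\varphi$ on $L^2(\Omega)$, and $\Delta_pu=\mathrm{div}(|\nabla u|^{p-2}\nabla u)$. *)

theory Defs
  imports "HOL-Analysis.Analysis"
begin

section \<open>Classical differential calculus on \<open>\<real>\<^sup>n\<close>\<close>

definition pderiv_at :: "'n::finite \<Rightarrow> (real^'n \<Rightarrow> real) \<Rightarrow> real^'n \<Rightarrow> real" where
  "pderiv_at i u x = frechet_derivative u (at x) (axis i 1)"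

primrec iter_pderiv :: "'n::finite list \<Rightarrow> (real^'n \<Rightarrow> real) \<Rightarrow> real^'n \<Rightarrow> real" where
  "iter_pderiv [] u = u"
| "iter_pderiv (i # is) u = pderiv_at i (iter_pderiv is u)"

definition grad :: "(real^'n::finite \<Rightarrow> real) \<Rightarrow> real^'n \<Rightarrow> real^'n" where
  "grad u x = (\<chi> i. pderiv_at i u x)"

definition divergence :: "(real^'n::finite \<Rightarrow> real^'n) \<Rightarrow> real^'n \<Rightarrow> real" where
  "divergence F x = (\<Sum>i\<in>UNIV. pderiv_at i (\<lambda>y. F y $ i) x)"

text \<open>The following is \<open>C\<^sup>\<infinity>(S)\<close> for open \<open>S\<close>: every iterated partial derivative is
  Frechet differentiable (hence continuous) on \<open>S\<close>.\<close>

definition smooth_on :: "(real^'n::finite) set \<Rightarrow> (real^'n \<Rightarrow> real) \<Rightarrow> bool" where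
  "smooth_on S u \<longleftrightarrow> (\<forall>is. iter_pderiv is u differentiable_on S)"

text \<open>\<open>C\<^sup>\<infinity>\<close> of the closure: all derivatives extend continuously from \<open>\<Omega>\<close> to its closure.\<close>

definition smooth_on_closure :: "(real^'n::finite) set \<Rightarrow> (real^'n \<Rightarrow> real) \<Rightarrow> bool" where
  "smooth_on_closure \<Omega> u \<longleftrightarrow> smooth_on \<Omega> u \<and>
     (\<forall>is. \<exists>g. continuous_on (closure \<Omega>) g \<and> (\<forall>x\<in>\<Omega>. g x = iter_pderiv is u x))"

definition smooth_vector_field_on_closure ::
    "(real^'n::finite) set \<Rightarrow> (real^'n \<Rightarrow> real^'n) \<Rightarrow> bool" where
  "smooth_vector_field_on_closure \<Omega> a \<longleftrightarrow> (\<forall>j. smooth_on_closure \<Omega> (\<lambda>x. a x $ j))"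

text \<open>Near each boundary point, after relabelling (choice of \<open>i\<close>) and reorienting (sign \<open>s\<close>)
  the coordinate axes, \<open>\<Omega>\<close> is the region strictly above the graph of a smooth function of the
  \<open>n - 1\<close> coordinates other than the \<open>i\<close>-th; such a function is encoded as a function on
  \<open>\<real>\<^sup>n\<close> not depending on the \<open>i\<close>-th coordinate.\<close>

definition smooth_boundary :: "(real^'n::finite) set \<Rightarrow> bool" where
  "smooth_boundary \<Omega> \<longleftrightarrow>
     (\<forall>z\<in>frontier \<Omega>. \<exists>r>0. \<exists>i. \<exists>s\<in>{-1, 1}. \<exists>\<gamma>.
        smooth_on UNIV \<gamma> \<and>
        (\<forall>x y. (\<forall>j. j \<noteq> i \<longrightarrow> x $ j = y $ j) \<longrightarrow> \<gamma> x = \<gamma> y) \<and>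
        \<Omega> \<inter> ball z r = {x \<in> ball z r. s * x $ i > \<gamma> x})"

definition test_functions :: "(real^'n::finite) set \<Rightarrow> (real^'n \<Rightarrow> real) set" where
  "test_functions \<Omega> = {\<psi>. smooth_on UNIV \<psi> \<and>
     (\<exists>K. compact K \<and> K \<subseteq> \<Omega> \<and> (\<forall>x. x \<notin> K \<longrightarrow> \<psi> x = 0))}"


section \<open>Lebesgue and Sobolev spaces\<close>

text \<open>Elements of function spaces are represented by functions on the whole of \<open>\<real>\<^sup>n\<close>; their
  values outside \<open>\<Omega>\<close> are irrelevant, and on \<open>\<Omega>\<close> they matter only almost everywhere.\<close>

definition Lp :: "real \<Rightarrow> (real^'n::finite) set \<Rightarrow> (real^'n \<Rightarrow> 'b::euclidean_space) set" where
  "Lp p \<Omega> = {u \<in> borel_measurable (lebesgue_on \<Omega>).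
     integrable (lebesgue_on \<Omega>) (\<lambda>x. norm (u x) powr p)}"

abbreviation L2 :: "(real^'n::finite) set \<Rightarrow> (real^'n \<Rightarrow> real) set" where
  "L2 \<equiv> Lp 2"

definition Linfty :: "(real^'n::finite) set \<Rightarrow> (real^'n \<Rightarrow> real) set" where
  "Linfty \<Omega> = {u \<in> borel_measurable (lebesgue_on \<Omega>).
     \<exists>C. AE x in lebesgue_on \<Omega>. \<bar>u x\<bar> \<le> C}"

definition locally_integrable ::
    "(real^'n::finite) set \<Rightarrow> (real^'n \<Rightarrow> 'b::euclidean_space) \<Rightarrow> bool" where
  "locally_integrable \<Omega> u \<longleftrightarrow> (\<forall>K. compact K \<and> K \<subseteq> \<Omega> \<longrightarrow> u absolutely_integrable_on K)"

definition has_weak_gradient ::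
    "(real^'n::finite) set \<Rightarrow> (real^'n \<Rightarrow> real) \<Rightarrow> (real^'n \<Rightarrow> real^'n) \<Rightarrow> bool" where
  "has_weak_gradient \<Omega> u g \<longleftrightarrow> locally_integrable \<Omega> u \<and> locally_integrable \<Omega> g \<and>
     (\<forall>\<psi>\<in>test_functions \<Omega>. \<forall>i.
        (LINT x|lebesgue_on \<Omega>. u x * pderiv_at i \<psi> x) = - (LINT x|lebesgue_on \<Omega>. g x $ i * \<psi> x))"

text \<open>A weak gradient is unique up to equality almost everywhere on \<open>\<Omega>\<close>.\<close>

definition wgrad :: "(real^'n::finite) set \<Rightarrow> (real^'n \<Rightarrow> real) \<Rightarrow> real^'n \<Rightarrow> real^'n" where
  "wgrad \<Omega> u = (SOME g. has_weak_gradient \<Omega> u g)"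

definition W1p :: "real \<Rightarrow> (real^'n::finite) set \<Rightarrow> (real^'n \<Rightarrow> real) set" where
  "W1p p \<Omega> = {u \<in> Lp p \<Omega>. \<exists>g\<in>Lp p \<Omega>. has_weak_gradient \<Omega> u g}"

text \<open>\<open>W\<^sub>0\<^sup>1\<^sup>,\<^sup>p(\<Omega>)\<close> is the closure of the test functions in the norm of \<open>W\<^sup>1\<^sup>,\<^sup>p(\<Omega>)\<close>.\<close>

definition W01p :: "real \<Rightarrow> (real^'n::finite) set \<Rightarrow> (real^'n \<Rightarrow> real) set" where
  "W01p p \<Omega> = {u \<in> W1p p \<Omega>. \<exists>\<psi>. (\<forall>k::nat. \<psi> k \<in> test_functions \<Omega>) \<and>
     (\<lambda>k. LINT x|lebesgue_on \<Omega>. \<bar>\<psi> k x - u x\<bar> powr p) \<longlonglongrightarrow> 0 \<and>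
     (\<lambda>k. LINT x|lebesgue_on \<Omega>. norm (grad (\<psi> k) x - wgrad \<Omega> u x) powr p) \<longlonglongrightarrow> 0}"


section \<open>Functionals on \<open>L\<^sup>2(\<Omega>)\<close>\<close>

definition convex_functional ::
    "(real^'n::finite) set \<Rightarrow> ((real^'n \<Rightarrow> real) \<Rightarrow> ereal) \<Rightarrow> bool" where
  "convex_functional \<Omega> \<Phi> \<longleftrightarrow>
     (\<forall>u\<in>L2 \<Omega>. \<forall>v\<in>L2 \<Omega>. \<forall>t. 0 < t \<and> t < 1 \<longrightarrow>
        \<Phi> (\<lambda>x. (1 - t) * u x + t * v x) \<le> ereal (1 - t) * \<Phi> u + ereal t * \<Phi> v)"

definition lsc_functional ::
    "(real^'n::finite) set \<Rightarrow> ((real^'n \<Rightarrow> real) \<Rightarrow> ereal) \<Rightarrow> bool" where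
  "lsc_functional \<Omega> \<Phi> \<longleftrightarrow>
     (\<forall>u\<in>L2 \<Omega>. \<forall>v. (\<forall>k::nat. v k \<in> L2 \<Omega>) \<and>
        (\<lambda>k. LINT x|lebesgue_on \<Omega>. \<bar>v k x - u x\<bar> powr 2) \<longlonglongrightarrow> 0 \<longrightarrow>
        \<Phi> u \<le> liminf (\<lambda>k. \<Phi> (v k)))"

definition fenchel_conjugate ::
    "(real^'n::finite) set \<Rightarrow> ((real^'n \<Rightarrow> real) \<Rightarrow> ereal) \<Rightarrow> (real^'n \<Rightarrow> real) \<Rightarrow> ereal" where
  "fenchel_conjugate \<Omega> \<Phi> v =
     (SUP u\<in>L2 \<Omega>. ereal (LINT x|lebesgue_on \<Omega>. u x * v x) - \<Phi> u)"


section \<open>The transport operator\<close>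

text \<open>For \<open>u\<close> in \<open>L\<^sup>2\<close>, \<open>a \<bullet> \<nabla>u\<close> is the distribution mapping \<open>\<psi>\<close> to minus the integral of
  \<open>u div (\<psi> a)\<close>. The next predicate says that the distribution
  \<open>a \<bullet> \<nabla>u + 1/2 (div a) u\<close> is given by the \<open>L\<^sup>2\<close> function \<open>w\<close>.\<close>

definition transport_rel ::
    "(real^'n::finite) set \<Rightarrow> (real^'n \<Rightarrow> real^'n) \<Rightarrow> (real^'n \<Rightarrow> real) \<Rightarrow> (real^'n \<Rightarrow> real) \<Rightarrow> bool"
  where
  "transport_rel \<Omega> a u w \<longleftrightarrow> u \<in> L2 \<Omega> \<and> w \<in> L2 \<Omega> \<and>
     (\<forall>\<psi>\<in>test_functions \<Omega>.
        - (LINT x|lebesgue_on \<Omega>. u x * divergence (\<lambda>y. \<psi> y *\<^sub>R a y) x)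
        + (LINT x|lebesgue_on \<Omega>. 1/2 * divergence a x * u x * \<psi> x)
        = (LINT x|lebesgue_on \<Omega>. w x * \<psi> x))"

definition transport_domain ::
    "(real^'n::finite) set \<Rightarrow> (real^'n \<Rightarrow> real^'n) \<Rightarrow> (real^'n \<Rightarrow> real) set" where
  "transport_domain \<Omega> a = {u. \<exists>w. transport_rel \<Omega> a u w}"

text \<open>The operator \<open>A\<close>, meaningful on \<open>transport_domain \<Omega> a\<close>, which includes
  \<open>W\<^sub>0\<^sup>1\<^sup>,\<^sup>p(\<Omega>)\<close> for bounded \<open>\<Omega>\<close> and \<open>p \<ge> 2\<close>.\<close>

definition transport ::
    "(real^'n::finite) set \<Rightarrow> (real^'n \<Rightarrow> real^'n) \<Rightarrow> (real^'n \<Rightarrow> real) \<Rightarrow> real^'n \<Rightarrow> real" where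
  "transport \<Omega> a u = (SOME w. transport_rel \<Omega> a u w)"


section \<open>The energy and the associated boundary value problem\<close>

text \<open>The \<open>L\<^sup>m\<close> term is taken in \<open>[0, \<infinity>]\<close>, since for large \<open>m\<close> the space
  \<open>W\<^sub>0\<^sup>1\<^sup>,\<^sup>p(\<Omega>)\<close> need not embed into \<open>L\<^sup>m(\<Omega>)\<close>; the other integrals are finite.\<close>

definition energy ::
    "(real^'n::finite) set \<Rightarrow> real \<Rightarrow> real \<Rightarrow> (real^'n \<Rightarrow> real^'n) \<Rightarrow> (real^'n \<Rightarrow> real) \<Rightarrow>
     (real^'n \<Rightarrow> real) \<Rightarrow> (real^'n \<Rightarrow> real) \<Rightarrow> ereal" where
  "energy \<Omega> p m a a0 f u =
     (if u \<in> W01p p \<Omega> then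
        ereal (1/p * (LINT x|lebesgue_on \<Omega>. norm (wgrad \<Omega> u x) powr p))
        + ereal (1/4 * (LINT x|lebesgue_on \<Omega>. (divergence a x + a0 x) * \<bar>u x\<bar>\<^sup>2))
        + ereal (1/m) * enn2ereal (\<integral>\<^sup>+x. ennreal (\<bar>u x\<bar> powr m) \<partial>lebesgue_on \<Omega>)
        + ereal (LINT x|lebesgue_on \<Omega>. u x * f x)
      else \<infinity>)"

definition selfdual_functional ::
    "(real^'n::finite) set \<Rightarrow> real \<Rightarrow> real \<Rightarrow> (real^'n \<Rightarrow> real^'n) \<Rightarrow> (real^'n \<Rightarrow> real) \<Rightarrow>
     (real^'n \<Rightarrow> real) \<Rightarrow> (real^'n \<Rightarrow> real) \<Rightarrow> ereal" where
  "selfdual_functional \<Omega> p m a a0 f u =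
     energy \<Omega> p m a a0 f u
     + fenchel_conjugate \<Omega> (energy \<Omega> p m a a0 f) (transport \<Omega> a u)"

definition regular_distribution ::
    "(real^'n::finite) set \<Rightarrow> (real^'n \<Rightarrow> real) \<Rightarrow> (real^'n \<Rightarrow> real) \<Rightarrow> real" where
  "regular_distribution \<Omega> g \<psi> = (LINT x|lebesgue_on \<Omega>. g x * \<psi> x)"

definition distributional_div ::
    "(real^'n::finite) set \<Rightarrow> (real^'n \<Rightarrow> real^'n) \<Rightarrow> (real^'n \<Rightarrow> real) \<Rightarrow> real" where
  "distributional_div \<Omega> F \<psi> = - (LINT x|lebesgue_on \<Omega>. F x \<bullet> grad \<psi> x)"

definition p_flux ::
    "(real^'n::finite) set \<Rightarrow> real \<Rightarrow> (real^'n \<Rightarrow> real) \<Rightarrow> real^'n \<Rightarrow> real^'n" where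
  "p_flux \<Omega> p u x = norm (wgrad \<Omega> u x) powr (p - 2) *\<^sub>R wgrad \<Omega> u x"

definition p_laplacian ::
    "(real^'n::finite) set \<Rightarrow> real \<Rightarrow> (real^'n \<Rightarrow> real) \<Rightarrow> (real^'n \<Rightarrow> real) \<Rightarrow> real" where
  "p_laplacian \<Omega> p u = distributional_div \<Omega> (p_flux \<Omega> p u)"

text \<open>The equation holds in the sense of distributions on \<open>\<Omega>\<close>; local integrability ensures that
  every term is a genuine distribution.  The boundary condition is membership in
  \<open>W\<^sub>0\<^sup>1\<^sup>,\<^sup>p(\<Omega>)\<close>.\<close>

definition solves_dirichlet_problem ::
    "(real^'n::finite) set \<Rightarrow> real \<Rightarrow> real \<Rightarrow> (real^'n \<Rightarrow> real^'n) \<Rightarrow> (real^'n \<Rightarrow> real) \<Rightarrow>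
     (real^'n \<Rightarrow> real) \<Rightarrow> (real^'n \<Rightarrow> real) \<Rightarrow> bool" where
  "solves_dirichlet_problem \<Omega> p m a a0 f u \<longleftrightarrow>
     has_weak_gradient \<Omega> u (wgrad \<Omega> u) \<and>
     locally_integrable \<Omega> (p_flux \<Omega> p u) \<and>
     locally_integrable \<Omega> (\<lambda>x. 1/2 * a0 x * u x + u x * \<bar>u x\<bar> powr (m - 2) + f x) \<and>
     locally_integrable \<Omega> (\<lambda>x. a x \<bullet> wgrad \<Omega> u x) \<and>
     (\<forall>\<psi>\<in>test_functions \<Omega>.
        - p_laplacian \<Omega> p u \<psi>
        + regular_distribution \<Omega> (\<lambda>x. 1/2 * a0 x * u x + u x * \<bar>u x\<bar> powr (m - 2) + f x) \<psi>
        = regular_distribution \<Omega> (\<lambda>x. a x \<bullet> wgrad \<Omega> u x) \<psi>) \<and>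
     u \<in> W01p p \<Omega>"

end

theory Submission imports Defs begin

text \<open>
  Let \<open>M(u,v) = \<phi>(u) - \<phi>(v) + \<langle>v, Au\<rangle>\<close>, so that \<open>I(u)\<close> is the supremum of \<open>M(u,v)\<close> over \<open>v\<close>.
  The operator \<open>A\<close> is antisymmetric on \<open>W\<^sub>0\<^sup>1\<^sup>,\<^sup>p\<close>, hence so is \<open>M\<close>; in particular \<open>M(u,u) = 0\<close> and \<open>I \<ge> 0\<close>,
  and a zero of \<open>I\<close> is an optimal strategy of a symmetric zero-sum game.  For finitely many \<open>v\<close> and
  every \<open>\<epsilon> > 0\<close> such a game has a convex combination \<open>u\<close> of the given \<open>v\<close> with \<open>M(u,v) \<le> \<epsilon>\<close>.  The sets
  \<open>{u. M(u,v) \<le> \<epsilon>}\<close> are convex and closed, and coercivity of \<open>\<phi>\<close> bounds them once \<open>v = 0\<close> is included.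
  Clarkson's inequality makes near-minimisers of \<open>\<integral>|\<nabla>u|\<^sup>p\<close> over growing finite intersections a Cauchy
  sequence, and its limit lies in all of the sets, so \<open>I\<close> vanishes there.  The same intersection
  argument, applied to sublevel sets of \<open>\<phi>\<close> cut with small \<open>L\<^sup>2\<close> balls, shows that \<open>\<phi>\<close> is lower
  semicontinuous.  If \<open>I(u) = 0\<close> then \<open>u\<close> minimises \<open>\<phi>(v) - \<langle>v, Au\<rangle>\<close>, and the equation is the
  vanishing of the first variation.
\<close>

section \<open>Convexity inequalities and \<open>L\<^sup>p\<close> convergence\<close>

text \<open>The difficulty is that \<open>\<phi>\<close> can be infinite on part of
  \<open>W01p p \<Omega>\<close>, since that space need not embed into \<open>L^m\<close>.
  Strategies are therefore drawn from the effective domain, where payoffs are real numbers, and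
  every passage to the limit has to deliver membership in that domain together with the bound.
  Antisymmetry does more than balance the game: it turns \<open>\<langle>v, Au\<rangle>\<close> into
  minus \<open>\<langle>u, Av\<rangle>\<close>, a pairing of \<open>u\<close> with a fixed
  \<open>L^2\<close> function, and this is why the payoff is convex and closed in \<open>u\<close>.
  The assumption \<open>p \<ge> 2\<close> serves both Clarkson's inequality and the inclusion of
  \<open>L^p\<close> in \<open>L^2\<close> over a bounded set, which makes \<open>Au\<close> an
  \<open>L^2\<close> function. Poincare's inequality lets Cauchy gradients alone decide convergence,
  so all limits are strong. As finite games are solved only up to a tolerance, the tolerance becomes
  part of the index of the family of sets. Weak gradients are fixed by \<open>SOME\<close> and
  determined only almost everywhere; hence several notions below carry the gradient as an explicit
  argument.\<close>

lemma norm_powr_gradient_ineq: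
  fixes a b :: "'a::real_inner"
  assumes "p > 1"
  shows "norm b powr p + p * (norm b powr (p - 2) * (b \<bullet> (a - b))) \<le> norm a powr p"
proof (cases "b = 0")
  case False
  then have nb: "norm b > 0" by simp
  \<comment> \<open>The conjugate exponent of \<open>p\<close>, so that
    \<open>norm b powr (p - 1)\<close> raised to \<open>q\<close> is again
    \<open>norm b powr p\<close> in Young's inequality.\<close>
  define q where "q = p / (p - 1)"
  have q: "q > 1" "1/p + 1/q = 1" using assms by (auto simp: q_def field_simps)
  have "norm a * norm b powr (p - 1) \<le> norm a powr p / p + (norm b powr (p - 1)) powr q / q"
    by (rule Youngs_inequality) (use assms q in auto)
  also have "(norm b powr (p - 1)) powr q = norm b powr p"
    using assms by (simp add: powr_powr q_def)
  finally have Y: "norm a * norm b powr (p - 1) \<le> norm a powr p / p + norm b powr p / q" .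
  have pq: "p / q = p - 1" using assms by (simp add: q_def)
  have "p * (norm a * norm b powr (p - 1)) \<le> p * (norm a powr p / p + norm b powr p / q)"
    using Y assms by (intro mult_left_mono) auto
  also have "\<dots> = norm a powr p + (p / q) * norm b powr p"
    using assms by (simp add: field_simps)
  also have "\<dots> = norm a powr p + (p - 1) * norm b powr p"
    using pq by simp
  finally have Y2: "p * (norm a * norm b powr (p - 1)) \<le> norm a powr p + (p - 1) * norm b powr p" .
  have e1: "norm b powr (p - 2) * norm b = norm b powr (p - 1)"
    using nb powr_add[of "norm b" "p - 2" 1] by simp
  have e2: "norm b powr (p - 2) * (b \<bullet> b) = norm b powr p"
    using nb powr_add[of "norm b" "p - 2" 2] by (simp add: power2_norm_eq_inner)
  have "norm b powr (p - 2) * (b \<bullet> a) \<le> norm b powr (p - 2) * (norm b * norm a)"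
    by (intro mult_left_mono norm_cauchy_schwarz) auto
  also have "\<dots> = norm a * norm b powr (p - 1)" using e1 by (simp add: mult_ac)
  finally have "p * (norm b powr (p - 2) * (b \<bullet> a)) \<le> p * (norm a * norm b powr (p - 1))"
    using assms by (intro mult_left_mono) auto
  then show ?thesis using Y2 e2 by (simp add: inner_diff_right algebra_simps)
qed simp

text \<open>Both endpoints lie above the supporting hyperplane at the convex combination
  \<open>c\<close>; weighted with \<open>1 - t\<close> and \<open>t\<close>, the two linear terms
  cancel.\<close>

lemma norm_powr_convex:
  fixes a b :: "'a::real_inner"
  assumes "p > 1" "0 \<le> t" "t \<le> 1"
  shows "norm ((1 - t) *\<^sub>R a + t *\<^sub>R b) powr p \<le> (1 - t) * norm a powr p + t * norm b powr p"
proof -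
  define c where "c = (1 - t) *\<^sub>R a + t *\<^sub>R b"
  let ?k = "p * norm c powr (p - 2)"
  have 1: "(1 - t) * (norm c powr p + ?k * (c \<bullet> (a - c))) \<le> (1 - t) * norm a powr p"
    using norm_powr_gradient_ineq[OF assms(1), of c a] assms by (intro mult_left_mono) (auto simp: mult_ac)
  have 2: "t * (norm c powr p + ?k * (c \<bullet> (b - c))) \<le> t * norm b powr p"
    using norm_powr_gradient_ineq[OF assms(1), of c b] assms by (intro mult_left_mono) (auto simp: mult_ac)
  have "(1 - t) * (c \<bullet> (a - c)) + t * (c \<bullet> (b - c)) = c \<bullet> (((1 - t) *\<^sub>R a + t *\<^sub>R b) - c)"
    by (simp add: inner_diff_right inner_add_right algebra_simps)
  also have "\<dots> = 0" by (simp add: c_def)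
  finally have 3: "(1 - t) * (c \<bullet> (a - c)) + t * (c \<bullet> (b - c)) = 0" .
  have "norm c powr p = (1 - t) * (norm c powr p + ?k * (c \<bullet> (a - c))) + t * (norm c powr p + ?k * (c \<bullet> (b - c)))
     - ?k * ((1 - t) * (c \<bullet> (a - c)) + t * (c \<bullet> (b - c)))"
    by (simp add: algebra_simps)
  then show ?thesis using 1 2 3 unfolding c_def by simp
qed

text \<open>For the squared norms \<open>s\<close> and \<open>t\<close> the parallelogram law gives
  \<open>s + t\<close>; powers with exponent \<open>q = p / 2 \<ge> 1\<close> are superadditive on
  nonnegative numbers and convex. The second term on the left is the gain over midpoint convexity
  that later makes minimising sequences Cauchy.\<close>

lemma clarkson:
  fixes a b :: "'a::real_inner"
  assumes "p \<ge> 2"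
  shows "norm ((1/2) *\<^sub>R (a + b)) powr p + norm ((1/2) *\<^sub>R (a - b)) powr p
    \<le> (norm a powr p + norm b powr p) / 2"
proof -
  define s t q where "s = (norm ((1/2) *\<^sub>R (a + b)))\<^sup>2" and "t = (norm ((1/2) *\<^sub>R (a - b)))\<^sup>2"
    and "q = p / 2"
  have q: "q \<ge> 1" using assms by (simp add: q_def)
  have pw: "norm x powr p = ((norm x)\<^sup>2) powr q" for x :: 'a
    by (cases "x = 0") (simp_all add: q_def powr_powr flip: powr_numeral)
  have st: "s + t = ((norm a)\<^sup>2 + (norm b)\<^sup>2) / 2"
    unfolding s_def t_def power2_norm_eq_inner
    by (simp add: inner_add_left inner_add_right inner_diff_left inner_diff_right inner_commute field_simps)
  have nn: "s \<ge> 0" "t \<ge> 0" by (auto simp: s_def t_def)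
  have split: "x powr q = x * x powr (q - 1)" if "x \<ge> 0" for x :: real
    using that powr_add[of x 1 "q - 1"] by (cases "x = 0") auto
  have "s powr q + t powr q \<le> s * (s + t) powr (q - 1) + t * (s + t) powr (q - 1)"
    unfolding split[OF nn(1)] split[OF nn(2)]
    by (intro add_mono mult_left_mono powr_mono2) (use nn q in auto)
  also have "\<dots> = (s + t) powr q"
    using split[of "s + t"] nn by (simp add: algebra_simps)
  also have "\<dots> \<le> (((norm a)\<^sup>2) powr q + ((norm b)\<^sup>2) powr q) / 2"
  proof (cases "q = 1")
    \<comment> \<open>\<open>norm_powr_convex\<close> wants an exponent above 1, so
      \<open>p = 2\<close> is left to the parallelogram law.\<close>
    case False
    then have "q > 1" using q by simp
    from norm_powr_convex[OF this, of "1/2" "(norm a)\<^sup>2" "(norm b)\<^sup>2"]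
    show ?thesis unfolding st by (simp add: field_simps)
  qed (use nn st in simp)
  finally show ?thesis unfolding pw s_def t_def .
qed

lemma norm_add_powr_le:
  fixes a b :: "'a::real_normed_vector"
  assumes "p \<ge> 0"
  shows "norm (a + b) powr p \<le> 2 powr p * (norm a powr p + norm b powr p)"
proof -
  have "norm (a + b) powr p \<le> (2 * max (norm a) (norm b)) powr p"
    using assms norm_triangle_ineq[of a b] by (intro powr_mono2) auto
  also have "\<dots> = 2 powr p * max (norm a) (norm b) powr p"
    by (simp add: powr_mult)
  also have "\<dots> \<le> 2 powr p * (norm a powr p + norm b powr p)"
    by (intro mult_left_mono) (auto simp: max_def)
  finally show ?thesis .
qed

text \<open>Below \<open>\<delta>\<close> this is monotonicity; above it, the factor
  \<open>x powr (q - p)\<close> is at most its value at \<open>\<delta>\<close>. A small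
  \<open>\<delta>\<close> makes the first term small, which turns \<open>L^p\<close> convergence
  into \<open>L^q\<close> convergence when the measure is finite.\<close>

lemma powr_le_powr_add:
  fixes x :: real
  assumes "0 \<le> q" "q \<le> p" "\<delta> > 0" "x \<ge> 0"
  shows "x powr q \<le> \<delta> powr q + \<delta> powr (q - p) * x powr p"
proof (cases "x \<le> \<delta>")
  case True
  then have "x powr q \<le> \<delta> powr q" using assms by (intro powr_mono2) auto
  then show ?thesis by (simp add: add_increasing2)
next
  case False
  then have "x powr q = x powr (q - p) * x powr p" by (simp flip: powr_add)
  also have "x powr (q - p) \<le> \<delta> powr (q - p)"
    using False assms by (intro powr_mono2') auto
  finally have "x powr q \<le> \<delta> powr (q - p) * x powr p"
    by (simp add: mult_right_mono)
  then show ?thesis by (simp add: add_increasing)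
qed

lemma powr_le_one_add:
  fixes x :: real
  assumes "0 \<le> q" "q \<le> p" "x \<ge> 0"
  shows "x powr q \<le> 1 + x powr p"
  using powr_le_powr_add[of q p 1 x] assms by simp

section \<open>Integrable powers and the gap between functions\<close>

definition Lp_mem :: "'a measure \<Rightarrow> real \<Rightarrow> ('a \<Rightarrow> 'b::euclidean_space) \<Rightarrow> bool" where
  "Lp_mem M p u \<longleftrightarrow> u \<in> borel_measurable M \<and> integrable M (\<lambda>x. norm (u x) powr p)"

text \<open>This is the \<open>p\<close>-th power of the \<open>L\<^sup>p\<close> distance.  It satisfies the triangle inequality up to a
  factor, which suffices here and avoids Minkowski's inequality.\<close>

definition Lp_gap :: "'a measure \<Rightarrow> real \<Rightarrow> ('a \<Rightarrow> 'b::euclidean_space) \<Rightarrow> ('a \<Rightarrow> 'b) \<Rightarrow> real" where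
  "Lp_gap M p u v = (LINT x|M. norm (u x - v x) powr p)"

abbreviation Lp_tendsto ::
    "'a measure \<Rightarrow> real \<Rightarrow> (nat \<Rightarrow> 'a \<Rightarrow> 'b::euclidean_space) \<Rightarrow> ('a \<Rightarrow> 'b) \<Rightarrow> bool" where
  "Lp_tendsto M p u v \<equiv> (\<lambda>n. Lp_gap M p (u n) v) \<longlonglongrightarrow> 0"

lemma Lp_eq: "u \<in> Lp p \<Omega> \<longleftrightarrow> Lp_mem (lebesgue_on \<Omega>) p u"
  by (simp add: Lp_def Lp_mem_def)

lemma Lp_memD:
  assumes "Lp_mem M p u"
  shows "u \<in> borel_measurable M" "integrable M (\<lambda>x. norm (u x) powr p)"
  using assms by (auto simp: Lp_mem_def)

lemma Lp_mem_bound: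
  assumes "u \<in> borel_measurable M" "integrable M h" "AE x in M. norm (u x) powr p \<le> h x"
  shows "Lp_mem M p u"
  unfolding Lp_mem_def
proof
  show "integrable M (\<lambda>x. norm (u x) powr p)"
    using assms by (intro Bochner_Integration.integrable_bound[OF assms(2)]) auto
qed fact

lemma Lp_mem_add:
  assumes "Lp_mem M p u" "Lp_mem M p v" "p \<ge> 0"
  shows "Lp_mem M p (\<lambda>x. u x + v x)"
proof (rule Lp_mem_bound[where h = "\<lambda>x. 2 powr p * (norm (u x) powr p + norm (v x) powr p)"])
  show "AE x in M. norm (u x + v x) powr p \<le> 2 powr p * (norm (u x) powr p + norm (v x) powr p)"
    by (rule AE_I2, rule norm_add_powr_le[OF assms(3)])
qed (use assms in \<open>auto simp: Lp_mem_def\<close>)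

lemma Lp_mem_scaleR:
  assumes "Lp_mem M p u" "p \<ge> 0"
  shows "Lp_mem M p (\<lambda>x. c *\<^sub>R u x)"
  using assms
  by (intro Lp_mem_bound[where h = "\<lambda>x. \<bar>c\<bar> powr p * norm (u x) powr p"])
    (auto simp: Lp_mem_def powr_mult)

lemma Lp_mem_cmult:
  fixes u :: "_ \<Rightarrow> real"
  assumes "Lp_mem M p u" "p \<ge> 0"
  shows "Lp_mem M p (\<lambda>x. c * u x)"
  using Lp_mem_scaleR[OF assms] by simp

lemma Lp_mem_diff:
  assumes "Lp_mem M p u" "Lp_mem M p v" "p \<ge> 0"
  shows "Lp_mem M p (\<lambda>x. u x - v x)"
  using Lp_mem_add[OF assms(1) Lp_mem_scaleR[OF assms(2,3), of "-1"] assms(3)] by simp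

lemma Lp_mem_0 [simp]: "Lp_mem M p (\<lambda>x. 0)"
  by (simp add: Lp_mem_def)

lemma Lp_mem_cong_AE:
  assumes "Lp_mem M p u" "v \<in> borel_measurable M" "AE x in M. u x = v x"
  shows "Lp_mem M p v"
  using assms(3)
  by (intro Lp_mem_bound[OF assms(2) Lp_memD(2)[OF assms(1)]]) auto

lemma (in finite_measure) Lp_mem_bounded:
  assumes "u \<in> borel_measurable M" "AE x in M. norm (u x) \<le> C" "p \<ge> 0"
  shows "Lp_mem M p u"
proof (rule Lp_mem_bound[OF assms(1), where h = "\<lambda>x. C powr p"])
  show "AE x in M. norm (u x) powr p \<le> C powr p"
    using assms(2) by eventually_elim (use assms(3) in \<open>auto intro: powr_mono2\<close>)
qed auto

lemma (in finite_measure) Lp_mem_lower: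
  assumes "Lp_mem M p u" "0 \<le> q" "q \<le> p"
  shows "Lp_mem M q u"
  by (rule Lp_mem_bound[where h = "\<lambda>x. 1 + norm (u x) powr p"])
    (use assms in \<open>auto simp: Lp_mem_def intro!: AE_I2 powr_le_one_add\<close>)

lemma Lp_mem_bounded_mult:
  fixes u :: "'a \<Rightarrow> 'b::euclidean_space" and b :: "'a \<Rightarrow> real"
  assumes "Lp_mem M p u" "b \<in> borel_measurable M" "AE x in M. \<bar>b x\<bar> \<le> C" "p \<ge> 0"
  shows "Lp_mem M p (\<lambda>x. b x *\<^sub>R u x)"
proof (rule Lp_mem_bound[where h = "\<lambda>x. C powr p * norm (u x) powr p"])
  show "AE x in M. norm (b x *\<^sub>R u x) powr p \<le> C powr p * norm (u x) powr p"
    using assms(3)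
  proof eventually_elim
    case (elim x)
    have "norm (b x *\<^sub>R u x) powr p \<le> (C * norm (u x)) powr p"
      using elim assms(4) by (intro powr_mono2) (auto intro: mult_right_mono)
    then show ?case using elim by (simp add: powr_mult)
  qed
qed (use assms in \<open>auto simp: Lp_mem_def\<close>)

lemma Lp_gap_nonneg [simp]: "Lp_gap M p u v \<ge> 0"
  by (simp add: Lp_gap_def)

lemma Lp_gap_self [simp]: "Lp_gap M p u u = 0"
  by (simp add: Lp_gap_def)

lemma Lp_gap_commute: "Lp_gap M p u v = Lp_gap M p v u"
  by (simp add: Lp_gap_def norm_minus_commute)

lemma Lp_gap_triangle:
  assumes "Lp_mem M p u" "Lp_mem M p v" "Lp_mem M p w" "p \<ge> 0"
  shows "Lp_gap M p u w \<le> 2 powr p * (Lp_gap M p u v + Lp_gap M p v w)"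
proof -
  note d = Lp_memD(2)[OF Lp_mem_diff[OF _ _ assms(4)]]
  have "Lp_gap M p u w \<le> (LINT x|M. 2 powr p * (norm (u x - v x) powr p + norm (v x - w x) powr p))"
    unfolding Lp_gap_def
  proof (rule integral_mono)
    show "norm (u x - w x) powr p \<le> 2 powr p * (norm (u x - v x) powr p + norm (v x - w x) powr p)" for x
      using norm_add_powr_le[OF assms(4), of "u x - v x" "v x - w x"] by simp
  qed (use d[OF assms(1,3)] d[OF assms(1,2)] d[OF assms(2,3)] in simp_all)
  then show ?thesis
    using d[OF assms(1,2)] d[OF assms(2,3)] by (simp add: Lp_gap_def)
qed

lemma Lp_gap_cong_AE:
  assumes "u \<in> borel_measurable M" "v \<in> borel_measurable M" "u' \<in> borel_measurable M" "v' \<in> borel_measurable M"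
    "AE x in M. u x = u' x" "AE x in M. v x = v' x"
  shows "Lp_gap M p u v = Lp_gap M p u' v'"
  unfolding Lp_gap_def
  by (rule integral_cong_AE) (use assms in auto)

lemma Lp_gap_0_AE:
  assumes "Lp_mem M p u" "Lp_mem M p v" "p \<ge> 0" "Lp_gap M p u v = 0"
  shows "AE x in M. u x = v x"
proof -
  have "AE x in M. norm (u x - v x) powr p = 0"
    using assms(4) integral_nonneg_eq_0_iff_AE[OF Lp_memD(2)[OF Lp_mem_diff[OF assms(1-3)]]]
    by (simp add: Lp_gap_def)
  then show ?thesis by eventually_elim simp
qed

lemma Lp_gap_tendsto_trans:
  assumes "\<And>n. Lp_mem M p (u n)" "\<And>n. Lp_mem M p (v n)" "Lp_mem M p w" "p \<ge> 0"
    and "(\<lambda>n. Lp_gap M p (u n) (v n)) \<longlonglongrightarrow> 0" "Lp_tendsto M p v w"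
  shows "Lp_tendsto M p u w"
proof (rule tendsto_sandwich[of "\<lambda>_. 0"])
  show "(\<lambda>n. 2 powr p * (Lp_gap M p (u n) (v n) + Lp_gap M p (v n) w)) \<longlonglongrightarrow> 0"
    using tendsto_mult[OF tendsto_const[of "2 powr p"] tendsto_add[OF assms(5,6)]] by simp
qed (use assms Lp_gap_triangle[OF assms(1,2,3,4)] in auto)

lemma (in finite_measure) Lp_gap_lower:
  assumes "\<And>n. Lp_mem M p (u n)" "Lp_mem M p v" "0 < q" "q \<le> p"
    and "Lp_tendsto M p u v"
  shows "Lp_tendsto M q u v"
proof (rule LIMSEQ_I)
  fix e :: real assume e: "e > 0"
  \<comment> \<open>The summand 1 keeps \<open>K\<close> positive when the measure vanishes.\<close>
  define K where "K = measure M (space M) + 1"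
  have K: "K > 0" by (simp add: K_def add_nonneg_pos)
  \<comment> \<open>Chosen so that the constant term \<open>\<delta> powr q\<close> integrates to at
    most \<open>e / 2\<close>.\<close>
  define \<delta> where "\<delta> = (e / (2 * K)) powr (1 / q)"
  have \<delta>: "\<delta> > 0" "\<delta> powr q = e / (2 * K)"
    using e K assms(3) by (auto simp: \<delta>_def powr_powr)
  obtain N where N: "\<And>n. n \<ge> N \<Longrightarrow> \<bar>Lp_gap M p (u n) v\<bar> < e / 2 / \<delta> powr (q - p)"
    using LIMSEQ_D[OF assms(5), of "e / 2 / \<delta> powr (q - p)"] e \<delta>(1) by auto
  show "\<exists>no. \<forall>n\<ge>no. norm (Lp_gap M q (u n) v - 0) < e"
  proof (intro exI[of _ N] allI impI)
    fix n assume n: "n \<ge> N"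
    have d: "Lp_mem M p (\<lambda>x. u n x - v x)" using Lp_mem_diff[OF assms(1,2)] assms by auto
    have "Lp_gap M q (u n) v \<le> (LINT x|M. \<delta> powr q + \<delta> powr (q - p) * norm (u n x - v x) powr p)"
      unfolding Lp_gap_def
      by (intro integral_mono powr_le_powr_add)
        (use assms d \<delta> Lp_mem_lower[OF d] in \<open>auto simp: Lp_mem_def\<close>)
    also have "\<dots> = measure M (space M) * \<delta> powr q + \<delta> powr (q - p) * Lp_gap M p (u n) v"
      using d by (simp add: Lp_mem_def Lp_gap_def)
    also have "\<dots> < e"
    proof -
      have "measure M (space M) * \<delta> powr q \<le> K * (e / (2 * K))"
        unfolding \<delta>(2) using e K by (intro mult_right_mono) (auto simp: K_def)
      moreover have "\<delta> powr (q - p) * Lp_gap M p (u n) v < e / 2"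
        using N[OF n] \<delta>(1) by (simp add: field_simps)
      ultimately show ?thesis using K by simp
    qed
    finally show "norm (Lp_gap M q (u n) v - 0) < e" by simp
  qed
qed

lemma Lp_gap_AE_subseq:
  assumes "\<And>n. Lp_mem M p (u n)" "Lp_mem M p v" "p > 0"
    and "Lp_tendsto M p u v"
  shows "\<exists>r::nat\<Rightarrow>nat. strict_mono r \<and> (AE x in M. (\<lambda>n. u (r n) x) \<longlonglongrightarrow> v x)"
proof -
  have "\<exists>r::nat\<Rightarrow>nat. strict_mono r \<and> (AE x in M. (\<lambda>n. norm (u (r n) x - v x) powr p) \<longlonglongrightarrow> 0)"
  proof (rule tendsto_L1_AE_subseq)
    show "integrable M (\<lambda>x. norm (u n x - v x) powr p)" for n
      using Lp_mem_diff[OF assms(1,2)] assms(3) by (auto simp: Lp_mem_def)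
    show "(\<lambda>n. LINT x|M. norm (norm (u n x - v x) powr p)) \<longlonglongrightarrow> 0"
      using assms(4) by (simp add: Lp_gap_def)
  qed
  then obtain r :: "nat \<Rightarrow> nat" where r: "strict_mono r"
    "AE x in M. (\<lambda>n. norm (u (r n) x - v x) powr p) \<longlonglongrightarrow> 0" by auto
  have "AE x in M. (\<lambda>n. u (r n) x) \<longlonglongrightarrow> v x"
    using r(2)
  proof eventually_elim
    case (elim x)
    have p0: "p \<noteq> 0" using assms(3) by simp
    have "(\<lambda>n. (norm (u (r n) x - v x) powr p) powr (1 / p)) \<longlonglongrightarrow> 0"
      by (rule tendsto_zero_powrI[OF elim, where b = "1 / p"]) (use assms(3) in auto)
    then have "(\<lambda>n. norm (u (r n) x - v x)) \<longlonglongrightarrow> 0"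
      by (simp add: powr_powr p0)
    then show ?case 
      by (rule LIM_zero_cancel[OF tendsto_norm_zero_cancel])
  qed
  with r show ?thesis by blast
qed

text \<open>A subsequence with rapidly shrinking gaps converges almost everywhere, and Fatou's lemma
  carries the Cauchy bound of the full sequence over to that limit.\<close>

lemma Riesz_Fischer:
  fixes f :: "nat \<Rightarrow> 'a \<Rightarrow> 'b::euclidean_space"
  assumes mem: "\<And>n. Lp_mem M p (f n)" and p: "p > 0"
    and cauchy: "\<And>e. e > 0 \<Longrightarrow> \<exists>N. \<forall>m\<ge>N. \<forall>n\<ge>N. Lp_gap M p (f m) (f n) < e"
  shows "\<exists>g. Lp_mem M p g \<and> Lp_tendsto M p f g"
proof -
  have int: "integrable M (\<lambda>x. norm (f m x - f n x) powr p)" for m n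
    using Lp_mem_diff[OF mem mem] p by (auto simp: Lp_mem_def)
  note [measurable] = Lp_memD(1)[OF mem]
  \<comment> \<open>Here \<open>(2 powr p) ^ k * e k = (1/2) ^ k\<close>, so the gaps stay summable
    after the weighting in \<open>h\<close>.\<close>
  define e where "e k = (2 powr (- p) / 2) ^ k" for k :: nat
  have e: "e k > 0" for k by (simp add: e_def)
  obtain N where N: "\<And>k m n. m \<ge> N k \<Longrightarrow> n \<ge> N k \<Longrightarrow> Lp_gap M p (f m) (f n) < e k"
    using cauchy[OF e] by metis
  \<comment> \<open>Summing the thresholds makes \<open>r\<close> increasing with
    \<open>r k \<ge> N k\<close>; the summand \<open>k\<close> drives it to infinity.\<close>
  define r where "r k = (\<Sum>i\<le>k. N i) + k" for k
  have rN: "r k \<ge> N k" for k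
    unfolding r_def by (rule trans_le_add1, rule member_le_sum) auto
  have rmono: "r k \<le> r (Suc k)" for k by (simp add: r_def)
  have rk: "r k \<ge> k" for k by (simp add: r_def)
  \<comment> \<open>The weight is tuned so that \<open>h k x < 1\<close> forces the
    \<open>k\<close>-th increment at \<open>x\<close> to be at most
    \<open>(1/2) ^ k\<close>.\<close>
  define h where "h k x = (2 powr p) ^ k * norm (f (r (Suc k)) x - f (r k) x) powr p" for k x
  have hint: "integrable M (h k)" for k unfolding h_def using int by simp
  have [measurable]: "h k \<in> borel_measurable M" for k using hint by auto
  have hnn: "h k x \<ge> 0" for k x by (simp add: h_def)
  have hle: "(\<integral>\<^sup>+x. ennreal (h k x) \<partial>M) \<le> ennreal ((1/2) ^ k)" for k
  proof -
    have "(\<integral>\<^sup>+x. ennreal (h k x) \<partial>M) = ennreal (LINT x|M. h k x)"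
      by (rule nn_integral_eq_integral) (use hint hnn in auto)
    also have "(LINT x|M. h k x) = (2 powr p) ^ k * Lp_gap M p (f (r (Suc k))) (f (r k))"
      by (simp add: h_def Lp_gap_def)
    also have "\<dots> \<le> (2 powr p) ^ k * e k"
      using N[of k "r (Suc k)" "r k"] rN[of k] rmono[of k] by (intro mult_left_mono) auto
    also have "\<dots> = (1/2) ^ k"
      unfolding e_def power_mult_distrib[symmetric] by (simp add: powr_minus)
    finally show ?thesis by (simp add: ennreal_leI)
  qed
  have "(\<integral>\<^sup>+x. (\<Sum>k. ennreal (h k x)) \<partial>M) = (\<Sum>k. \<integral>\<^sup>+x. ennreal (h k x) \<partial>M)"
    by (rule nn_integral_suminf) auto
  also have "\<dots> \<le> (\<Sum>k. ennreal ((1/2) ^ k))"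
    by (intro suminf_le hle) auto
  also have "\<dots> = ennreal (\<Sum>k. (1/2) ^ k)"
    by (rule suminf_ennreal2) auto
  also have "\<dots> < \<infinity>" by simp
  finally have "(\<integral>\<^sup>+x. (\<Sum>k. ennreal (h k x)) \<partial>M) \<noteq> \<infinity>" by simp
  then have "AE x in M. (\<Sum>k. ennreal (h k x)) \<noteq> \<infinity>"
    by (intro nn_integral_PInf_AE) auto
  then have conv: "AE x in M. convergent (\<lambda>k. f (r k) x)"
  proof eventually_elim
    case (elim x)
    then have "summable (\<lambda>k. h k x)"
      using hnn by (intro summable_suminf_not_top) auto
    then have "(\<lambda>k. h k x) \<longlonglongrightarrow> 0" by (rule summable_LIMSEQ_zero)
    then have "\<forall>\<^sub>F k in sequentially. h k x < 1" by (rule order_tendstoD) simp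
    then have ev: "\<forall>\<^sub>F k in sequentially. norm (f (r (Suc k)) x - f (r k) x) \<le> (1/2) ^ k"
    proof eventually_elim
      case (elim k)
      show ?case
      proof (rule ccontr)
        assume "\<not> ?thesis"
        then have "((1/2) ^ k) powr p \<le> norm (f (r (Suc k)) x - f (r k) x) powr p"
          using p by (intro powr_mono2) auto
        then have "(2 powr p) ^ k * ((1/2) ^ k) powr p \<le> h k x"
          unfolding h_def by (intro mult_left_mono) auto
        moreover have "(2 powr p) ^ k * ((1/2) ^ k) powr p = 1"
        proof -
          have "(2 powr p) ^ k = (2 ^ k) powr p"
            by (simp add: powr_powr mult.commute flip: powr_realpow)
          then show ?thesis by (simp flip: powr_mult power_mult_distrib)
        qed
        ultimately show False using elim by simp
      qed
    qed
    have "summable (\<lambda>k. f (r (Suc k)) x - f (r k) x)"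
      by (rule summable_comparison_test_ev[OF ev]) (simp add: summable_geometric)
    then have "convergent (\<lambda>n. \<Sum>k<n. f (r (Suc k)) x - f (r k) x)"
      by (simp add: summable_iff_convergent)
    then have "convergent (\<lambda>n. f (r n) x - f (r 0) x)"
      using sum_lessThan_telescope[of "\<lambda>n. f (r n) x"] by simp
    then have "convergent (\<lambda>n. (f (r n) x - f (r 0) x) + f (r 0) x)"
      by (intro convergent_add convergent_const)
    then show ?case by simp
  qed
  define g where "g x = lim (\<lambda>k. f (r k) x)" for x
  have gm [measurable]: "g \<in> borel_measurable M"
    unfolding g_def by (rule borel_measurable_lim_metric) auto
  have lim: "AE x in M. (\<lambda>k. f (r k) x) \<longlonglongrightarrow> g x"
    using conv by eventually_elim (simp add: g_def convergent_LIMSEQ_iff)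
  \<comment> \<open>The gap bound is assumed only from some index \<open>K\<close> on;
    \<open>r k \<ge> k\<close> brings the subsequence there.\<close>
  have fatou: "(\<integral>\<^sup>+x. ennreal (norm (f n x - g x) powr p) \<partial>M) \<le> ennreal d"
    if d: "\<And>m. m \<ge> K \<Longrightarrow> Lp_gap M p (f n) (f m) \<le> d" for n K d
  proof -
    have "(\<integral>\<^sup>+x. ennreal (norm (f n x - g x) powr p) \<partial>M)
      = (\<integral>\<^sup>+x. liminf (\<lambda>k. ennreal (norm (f n x - f (r k) x) powr p)) \<partial>M)"
    proof (rule nn_integral_cong_AE)
      show "AE x in M. ennreal (norm (f n x - g x) powr p)
          = liminf (\<lambda>k. ennreal (norm (f n x - f (r k) x) powr p))"
        using lim
      proof eventually_elim
        case (elim x)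
        have "(\<lambda>k. ennreal (norm (f n x - f (r k) x) powr p)) \<longlonglongrightarrow> ennreal (norm (f n x - g x) powr p)"
          by (intro tendsto_ennrealI tendsto_powr' tendsto_intros elim) (use p in auto)
        then show ?case by (rule lim_imp_Liminf[OF trivial_limit_sequentially, symmetric])
      qed
    qed
    also have "\<dots> \<le> liminf (\<lambda>k. \<integral>\<^sup>+x. ennreal (norm (f n x - f (r k) x) powr p) \<partial>M)"
      by (rule nn_integral_liminf) auto
    also have "\<dots> \<le> liminf (\<lambda>k. ennreal d)"
    proof (rule Liminf_mono)
      show "\<forall>\<^sub>F k in sequentially. (\<integral>\<^sup>+x. ennreal (norm (f n x - f (r k) x) powr p) \<partial>M) \<le> ennreal d"
        using eventually_ge_at_top[of K]
      proof eventually_elim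
        case (elim k)
        have "(\<integral>\<^sup>+x. ennreal (norm (f n x - f (r k) x) powr p) \<partial>M) = ennreal (Lp_gap M p (f n) (f (r k)))"
          unfolding Lp_gap_def by (rule nn_integral_eq_integral) (use int in auto)
        also have "\<dots> \<le> ennreal d" using d[of "r k"] rk[of k] elim by (intro ennreal_leI) auto
        finally show ?case .
      qed
    qed
    also have "\<dots> = ennreal d" by (simp add: Liminf_const)
    finally show ?thesis .
  qed
  have dmem: "Lp_mem M p (\<lambda>x. f n x - g x)" if "\<And>m. m \<ge> K \<Longrightarrow> Lp_gap M p (f n) (f m) \<le> d" for n K d
    unfolding Lp_mem_def
  proof (intro conjI integrableI_bounded)
    have "(\<integral>\<^sup>+x. ennreal (norm (norm (f n x - g x) powr p)) \<partial>M) \<le> ennreal d"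
      using fatou[OF that] by simp
    then show "(\<integral>\<^sup>+x. ennreal (norm (norm (f n x - g x) powr p)) \<partial>M) < \<infinity>"
      by (rule order_le_less_trans) simp
  qed auto
  have dle: "Lp_gap M p (f n) g \<le> d" if d: "\<And>m. m \<ge> K \<Longrightarrow> Lp_gap M p (f n) (f m) \<le> d" for n K d
  proof -
    have d0: "d \<ge> 0" using d[of K] Lp_gap_nonneg[of M p "f n" "f K"] by linarith
    have "ennreal (Lp_gap M p (f n) g) = (\<integral>\<^sup>+x. ennreal (norm (f n x - g x) powr p) \<partial>M)"
      unfolding Lp_gap_def
      by (rule nn_integral_eq_integral[symmetric]) (use dmem[OF d] in \<open>auto simp: Lp_mem_def\<close>)
    also have "\<dots> \<le> ennreal d" by (rule fatou[OF d])
    finally show ?thesis using d0 by (simp add: ennreal_le_iff)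
  qed
  obtain N1 where N1: "\<And>m n. m \<ge> N1 \<Longrightarrow> n \<ge> N1 \<Longrightarrow> Lp_gap M p (f m) (f n) < 1"
    using cauchy[of 1] by auto
  \<comment> \<open>\<open>g\<close> itself is then \<open>f N1\<close> minus this
    difference.\<close>
  have "Lp_mem M p (\<lambda>x. f N1 x - g x)"
    by (rule dmem[of N1 _ 1]) (use N1[of N1] in \<open>auto intro: less_imp_le\<close>)
  from Lp_mem_diff[OF mem[of N1] this] p have "Lp_mem M p g" by simp
  moreover have "Lp_tendsto M p f g"
  proof (rule LIMSEQ_I)
    fix d :: real assume "d > 0"
    then obtain K where K: "\<And>m n. m \<ge> K \<Longrightarrow> n \<ge> K \<Longrightarrow> Lp_gap M p (f m) (f n) < d / 2"
      using cauchy[of "d/2"] by auto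
    have "Lp_gap M p (f n) g \<le> d / 2" if "n \<ge> K" for n
      by (rule dle[of K]) (use K[OF that] in \<open>auto intro: less_imp_le\<close>)
    then show "\<exists>no. \<forall>n\<ge>no. norm (Lp_gap M p (f n) g - 0) < d"
      using \<open>d > 0\<close> by (intro exI[of _ K]) fastforce
  qed
  ultimately show ?thesis by blast
qed

section \<open>Pairings of square-integrable functions\<close>

lemma L2_mult_integrable:
  fixes f g :: "'a \<Rightarrow> real"
  assumes "Lp_mem M 2 f" "Lp_mem M 2 g"
  shows "integrable M (\<lambda>x. f x * g x)"
proof (rule Bochner_Integration.integrable_bound)
  show "integrable M (\<lambda>x. norm (f x) powr 2 + norm (g x) powr 2)"
    using assms by (simp add: Lp_mem_def)
  have "\<bar>a * b\<bar> \<le> a\<^sup>2 + b\<^sup>2" for a b :: real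
  proof -
    have "2 * \<bar>a\<bar> * \<bar>b\<bar> \<le> \<bar>a\<bar>\<^sup>2 + \<bar>b\<bar>\<^sup>2" using sum_squares_bound by blast
    moreover have "\<bar>a\<bar> * \<bar>b\<bar> \<ge> 0" by simp
    ultimately have "\<bar>a\<bar> * \<bar>b\<bar> \<le> \<bar>a\<bar>\<^sup>2 + \<bar>b\<bar>\<^sup>2" by linarith
    then show ?thesis by (simp add: abs_mult)
  qed
  then show "AE x in M. norm (f x * g x) \<le> norm (norm (f x) powr 2 + norm (g x) powr 2)"
    by simp
qed (use assms in \<open>auto simp: Lp_mem_def\<close>)

lemma L2_Cauchy_Schwarz:
  fixes f g :: "'a \<Rightarrow> real"
  assumes f: "Lp_mem M 2 f" and g: "Lp_mem M 2 g"
  shows "(LINT x|M. f x * g x)\<^sup>2 \<le> (LINT x|M. (f x)\<^sup>2) * (LINT x|M. (g x)\<^sup>2)"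
proof -
  let ?A = "LINT x|M. (f x)\<^sup>2" and ?B = "LINT x|M. f x * g x" and ?C = "LINT x|M. (g x)\<^sup>2"
  have fi: "integrable M (\<lambda>x. (f x)\<^sup>2)" and gi: "integrable M (\<lambda>x. (g x)\<^sup>2)"
    using f g by (simp_all add: Lp_mem_def)
  note fg = L2_mult_integrable[OF f g]
  have Q: "0 \<le> c\<^sup>2 * ?A + 2 * c * d * ?B + d\<^sup>2 * ?C" for c d
  proof -
    have "0 \<le> (LINT x|M. (c * f x + d * g x)\<^sup>2)" by (rule integral_nonneg_AE) simp
    also have "(\<lambda>x. (c * f x + d * g x)\<^sup>2) = (\<lambda>x. c\<^sup>2 * (f x)\<^sup>2 + 2 * c * d * (f x * g x) + d\<^sup>2 * (g x)\<^sup>2)"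
      by (auto simp: power2_eq_square algebra_simps)
    also have "(LINT x|M. c\<^sup>2 * (f x)\<^sup>2 + 2 * c * d * (f x * g x) + d\<^sup>2 * (g x)\<^sup>2)
        = c\<^sup>2 * ?A + 2 * c * d * ?B + d\<^sup>2 * ?C"
      using fi gi fg by simp
    finally show ?thesis .
  qed
  have A: "?A \<ge> 0" and C: "?C \<ge> 0" by auto
  show ?thesis
  proof (cases "?C = 0")
    case True
    have "?B = 0"
    proof (rule ccontr)
      assume B: "?B \<noteq> 0"
      \<comment> \<open>With \<open>?C = 0\<close> the form is affine in its second coefficient, and
        this choice gives it the value -1.\<close>
      from Q[of 1 "- (?A + 1) / (2 * ?B)"] B show False by (simp add: True field_simps)
    qed
    then show ?thesis by (simp add: True)
  next
    case False
    with C have "?C > 0" by linarith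
    \<comment> \<open>The coefficients \<open>?C\<close> and \<open>- ?B\<close> minimise the form
      up to scaling and produce the discriminant.\<close>
    have "0 \<le> ?C * (?A * ?C - ?B\<^sup>2)"
      using Q[of ?C "- ?B"] by (simp add: power2_eq_square algebra_simps)
    with \<open>?C > 0\<close> show ?thesis by (simp add: zero_le_mult_iff)
  qed
qed

lemma Lp_gap_2: "Lp_gap M 2 f g = (LINT x|M. (f x - g x)\<^sup>2)" for f g :: "'a \<Rightarrow> real"
  by (simp add: Lp_gap_def)

lemma L2_pairing_tendsto:
  fixes f :: "nat \<Rightarrow> 'a \<Rightarrow> real" and f' g :: "'a \<Rightarrow> real"
  assumes "\<And>n. Lp_mem M 2 (f n)" "Lp_mem M 2 f'" "Lp_mem M 2 g"
    and "Lp_tendsto M 2 f f'"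
  shows "(\<lambda>n. LINT x|M. f n x * g x) \<longlonglongrightarrow> (LINT x|M. f' x * g x)"
proof -
  have "(\<lambda>n. (LINT x|M. (f n x - f' x) * g x)\<^sup>2) \<longlonglongrightarrow> 0"
  proof (rule tendsto_sandwich[of "\<lambda>_. 0"])
    show "\<forall>\<^sub>F n in sequentially. (LINT x|M. (f n x - f' x) * g x)\<^sup>2
        \<le> Lp_gap M 2 (f n) f' * (LINT x|M. (g x)\<^sup>2)"
      unfolding Lp_gap_2
      by (intro always_eventually allI L2_Cauchy_Schwarz Lp_mem_diff assms) auto
    show "(\<lambda>n. Lp_gap M 2 (f n) f' * (LINT x|M. (g x)\<^sup>2)) \<longlonglongrightarrow> 0"
      using tendsto_mult_right[OF assms(4), of "LINT x|M. (g x)\<^sup>2"] by simp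
  qed auto
  then have "(\<lambda>n. LINT x|M. (f n x - f' x) * g x) \<longlonglongrightarrow> 0"
    using tendsto_real_sqrt[of "\<lambda>n. (LINT x|M. (f n x - f' x) * g x)\<^sup>2" 0]
    by (simp add: tendsto_rabs_zero_iff)
  moreover have "(LINT x|M. (f n x - f' x) * g x) = (LINT x|M. f n x * g x) - (LINT x|M. f' x * g x)" for n
    using L2_mult_integrable[OF assms(1) assms(3)] L2_mult_integrable[OF assms(2,3)]
    by (simp add: left_diff_distrib)
  ultimately show ?thesis by (simp add: LIM_zero_iff)
qed


section \<open>Near-minimisers and symmetric games\<close>

text \<open>Near-minimisers of \<open>N\<close> over growing finite intersections are Cauchy with respect to the
  defect \<open>D\<close> of midpoint convexity; this replaces weak compactness.\<close>

lemma directed_near_minimizers: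
  fixes C :: "'j \<Rightarrow> 'u set" and N :: "'u \<Rightarrow> real"
  assumes bdd: "\<And>G. finite G \<Longrightarrow> G \<subseteq> J \<Longrightarrow> \<exists>u\<in>X. (\<forall>j\<in>G. u \<in> C j) \<and> N u \<le> B"
    and nonneg: "\<And>u. u \<in> X \<Longrightarrow> N u \<ge> 0"
    and midX: "\<And>u v. u \<in> X \<Longrightarrow> v \<in> X \<Longrightarrow> mid u v \<in> X"
    and midC: "\<And>u v j. u \<in> X \<Longrightarrow> v \<in> X \<Longrightarrow> j \<in> J \<Longrightarrow> u \<in> C j \<Longrightarrow> v \<in> C j \<Longrightarrow> mid u v \<in> C j"
    and para: "\<And>u v. u \<in> X \<Longrightarrow> v \<in> X \<Longrightarrow> D u v + 2 * N (mid u v) \<le> N u + N v"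
  shows "\<exists>u::nat \<Rightarrow> 'u. (\<forall>n. u n \<in> X) \<and> (\<forall>e>0. \<exists>K. \<forall>m\<ge>K. \<forall>n\<ge>K. D (u m) (u n) < e) \<and>
    (\<forall>j\<in>J. \<exists>u'::nat \<Rightarrow> 'u. \<forall>n. u' n \<in> X \<and> u' n \<in> C j \<and> D (u' n) (u n) \<le> 4 / real (Suc n))"
proof -
  define S where "S G = {u\<in>X. \<forall>j\<in>G. u \<in> C j}" for G
  define d where "d G = Inf (N ` S G)" for G
  define F where "F = {G. finite G \<and> G \<subseteq> J}"
  have bb: "bdd_below (N ` S G)" for G
    using nonneg by (intro bdd_belowI[of _ 0]) (auto simp: S_def)
  have ne: "N ` S G \<noteq> {}" if "G \<in> F" for G
    using bdd[of G] that by (auto simp: F_def S_def)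
  have dle: "d G \<le> N u" if "u \<in> S G" for G u
    unfolding d_def using that bb by (intro cINF_lower)
  have dB: "d G \<le> B" if G: "G \<in> F" for G
    using bdd[of G] dle[of _ G] G by (force simp: F_def S_def)
  \<comment> \<open>\<open>d\<close> grows as constraints are added and never exceeds
    \<open>B\<close>, so its supremum over the finite sets of constraints is finite.\<close>
  define s where "s = Sup (d ` F)"
  have Fne: "F \<noteq> {}" by (auto simp: F_def)
  have ba: "bdd_above (d ` F)" using dB by (intro bdd_aboveI[of _ B]) auto
  have ds: "d G \<le> s" if "G \<in> F" for G
    unfolding s_def using that ba by (intro cSUP_upper)
  have "\<exists>G\<in>F. s - 1 / real (Suc n) < d G" for n
  proof -
    have "s - 1 / real (Suc n) < Sup (d ` F)" by (simp add: s_def)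
    then show ?thesis using less_cSup_iff[of "d ` F"] ba Fne by auto
  qed
  then obtain G where G: "\<And>n. G n \<in> F" "\<And>n. s - 1 / real (Suc n) < d (G n)" by metis
  \<comment> \<open>Accumulating the constraints makes the feasible sets nested, while monotonicity
    of \<open>d\<close> keeps \<open>d (H n)\<close> within \<open>1 / real (Suc n)\<close> of
    \<open>s\<close>.\<close>
  define H where "H n = (\<Union>i\<le>n. G i)" for n
  have HF: "H n \<in> F" for n using G(1) by (fastforce simp: H_def F_def)
  have Hmono: "S (H n) \<subseteq> S (H m)" if "m \<le> n" for m n
    using that by (fastforce simp: S_def H_def)
  have dmono: "d A \<le> d A'" if "A \<subseteq> A'" "A' \<in> F" for A A'
    unfolding d_def using that ne[of A'] bb by (intro cINF_superset_mono) (auto simp: S_def)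
  have dH: "s - 1 / real (Suc n) < d (H n)" for n
  proof -
    have "G n \<subseteq> H n" by (auto simp: H_def)
    from dmono[OF this HF] G(2)[of n] show ?thesis by linarith
  qed
  have near: "\<exists>u\<in>S A. N u < s + 1 / real (Suc n)" if A: "A \<in> F" for A n
  proof -
    have "d A < s + 1 / real (Suc n)"
      using ds[OF A] by (rule order_le_less_trans) simp
    then show ?thesis unfolding d_def using cINF_less_iff[OF ne[OF A, simplified] bb] ne[OF A] by auto
  qed
  have "\<exists>u\<in>S (H n). N u < s + 1 / real (Suc n)" for n using near[OF HF] .
  then obtain u where u: "\<And>n. u n \<in> S (H n)" "\<And>n. N (u n) < s + 1 / real (Suc n)" by metis
  \<comment> \<open>The midpoint is feasible, so its energy exceeds
    \<open>s - 1 / real (Suc K)\<close>. Subtracting twice this from the two upper bounds leaves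
    four errors of size \<open>1 / real (Suc K)\<close>.\<close>
  have key: "D v w \<le> 4 / real (Suc K)"
    if "v \<in> S (H K)" "w \<in> S (H K)" "N v < s + 1 / real (Suc K)" "N w < s + 1 / real (Suc K)" for v w K
  proof -
    have "mid v w \<in> S (H K)"
      using that(1,2) midX midC HF[of K] by (auto simp: S_def F_def)
    then have "s - 1 / real (Suc K) < N (mid v w)" using dH[of K] dle[of "mid v w" "H K"] by simp
    moreover have "D v w + 2 * N (mid v w) \<le> N v + N w"
      using that by (intro para) (auto simp: S_def)
    ultimately have "D v w \<le> 4 * (1 / real (Suc K))" using that(3,4) by argo
    then show ?thesis by simp
  qed
  have "\<exists>K. \<forall>m\<ge>K. \<forall>n\<ge>K. D (u m) (u n) < e" if "e > 0" for e
  proof -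
    obtain K :: nat where K: "4 / e < real K" using reals_Archimedean2 by blast
    have "4 / real (Suc K) < e" using K that by (simp add: field_simps)
    moreover have "D (u m) (u n) \<le> 4 / real (Suc K)" if "m \<ge> K" "n \<ge> K" for m n
    proof (rule key)
      have "1 / real (Suc m) \<le> 1 / real (Suc K)" "1 / real (Suc n) \<le> 1 / real (Suc K)"
        using that by (auto simp: frac_le)
      then show "N (u m) < s + 1 / real (Suc K)" "N (u n) < s + 1 / real (Suc K)"
        using u(2)[of m] u(2)[of n] by linarith+
    qed (use u(1) Hmono that in blast)+
    ultimately show ?thesis by (intro exI[of _ K]) (auto intro: order_le_less_trans)
  qed
  moreover have "\<exists>u'::nat \<Rightarrow> 'u. \<forall>n. u' n \<in> X \<and> u' n \<in> C j \<and> D (u' n) (u n) \<le> 4 / real (Suc n)"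
    if j: "j \<in> J" for j
  proof -
    \<comment> \<open>One more constraint leaves the set finite, so its infimum is still at most
      \<open>s\<close>. A near-minimiser there satisfies \<open>j\<close> and is also one for
      \<open>H n\<close>, hence close to \<open>u n\<close>. In this way one sequence, built from
      countably many constraints, is shadowed inside every \<open>C j\<close>.\<close>
    have "insert j (H n) \<in> F" for n using HF[of n] j by (auto simp: F_def)
    then have "\<exists>v\<in>S (insert j (H n)). N v < s + 1 / real (Suc n)" for n by (rule near)
    then obtain u' where u': "\<And>n. u' n \<in> S (insert j (H n))" "\<And>n. N (u' n) < s + 1 / real (Suc n)"
      by metis
    have "D (u' n) (u n) \<le> 4 / real (Suc n)" for n
      by (rule key) (use u u' in \<open>auto simp: S_def\<close>)
    then show ?thesis using u'(1) by (intro exI[of _ u']) (auto simp: S_def)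
  qed
  ultimately show ?thesis using u(1) by (intro exI[of _ u]) (auto simp: S_def)
qed

text \<open>A symmetric zero-sum game has value \<open>0\<close>.  If \<open>y\<close> is the positive part of the payoff of
  \<open>\<lambda>\<close>, the payoff of the strategy proportional to \<open>y\<close> is orthogonal to \<open>y\<close> by antisymmetry, so
  moving towards it decreases \<open>\<bar>y\<bar>\<^sup>2\<close>.\<close>

lemma antisymmetric_game:
  fixes b :: "'i \<Rightarrow> 'i \<Rightarrow> real"
  assumes fin: "finite I" and ne: "I \<noteq> {}" and anti: "\<And>i j. i \<in> I \<Longrightarrow> j \<in> I \<Longrightarrow> b i j = - b j i"
    and eps: "\<epsilon> > 0"
  shows "\<exists>l. (\<forall>i\<in>I. l i \<ge> 0) \<and> sum l I = 1 \<and> (\<forall>j\<in>I. (\<Sum>i\<in>I. l i * b i j) \<le> \<epsilon>)"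
proof -
  define \<Lambda> where "\<Lambda> = {l. (\<forall>i\<in>I. l i \<ge> 0) \<and> sum l I = (1::real)}"
  define P where "P l j = (\<Sum>i\<in>I. l i * b i j)" for l j
  define g where "g l = (\<Sum>j\<in>I. (max 0 (P l j))\<^sup>2)" for l
  \<comment> \<open>Only near-minimisers of \<open>g\<close> are ever taken, which is why the
    conclusion carries \<open>\<epsilon>\<close>.\<close>
  define d where "d = Inf (g ` \<Lambda>)"
  have gnn: "g l \<ge> 0" for l by (simp add: g_def sum_nonneg)
  have bb: "bdd_below (g ` \<Lambda>)" using gnn by (intro bdd_belowI[of _ 0]) auto
  obtain i0 where "i0 \<in> I" using ne by auto
  then have "(\<lambda>i. if i = i0 then 1 else 0) \<in> \<Lambda>" by (simp add: \<Lambda>_def fin)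
  then have Lne: "\<Lambda> \<noteq> {}" by auto
  have dle: "d \<le> g l" if "l \<in> \<Lambda>" for l unfolding d_def using that bb by (intro cINF_lower)
  have near: "\<exists>l\<in>\<Lambda>. g l < e" if "d < e" for e
    using that cINF_less_iff[OF Lne bb] by (auto simp: d_def)
  have d0: "d \<ge> 0" unfolding d_def using Lne gnn by (intro cINF_greatest) auto
  have "d = 0"
  proof (rule ccontr)
    assume "d \<noteq> 0"
    with d0 have d: "d > 0" by simp
    define C where "C = (\<Sum>j\<in>I. (\<Sum>i\<in>I. \<bar>b i j\<bar>)\<^sup>2)"
    have C: "C \<ge> 0" by (simp add: C_def sum_nonneg)
    have PC: "(\<Sum>j\<in>I. (P l j)\<^sup>2) \<le> C" if l: "l \<in> \<Lambda>" for l
      unfolding C_def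
    proof (rule sum_mono)
      fix j assume "j \<in> I"
      have l1: "l i \<le> 1" if "i \<in> I" for i
        using member_le_sum[OF that, of l] l fin by (auto simp: \<Lambda>_def)
      have "\<bar>P l j\<bar> \<le> (\<Sum>i\<in>I. \<bar>l i * b i j\<bar>)" unfolding P_def by (rule sum_abs)
      also have "\<dots> \<le> (\<Sum>i\<in>I. \<bar>b i j\<bar>)"
        using l l1 by (intro sum_mono) (auto simp: \<Lambda>_def abs_mult intro!: mult_left_le_one_le)
      finally show "(P l j)\<^sup>2 \<le> (\<Sum>i\<in>I. \<bar>b i j\<bar>)\<^sup>2"
        by (intro abs_le_square_iff[THEN iffD1]) (simp add: sum_nonneg)
    qed
    \<comment> \<open>\<open>s\<close> minimises \<open>(1 - s)\<^sup>2 * d + s\<^sup>2 * C\<close>,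
      whose minimum lies \<open>2 * \<delta>\<close> below \<open>d\<close>. Spending half of that
      gain on the choice of \<open>l\<close> still leaves the new strategy below
      \<open>d\<close>.\<close>
    define s \<delta> where "s = d / (d + C)" and "\<delta> = d\<^sup>2 / (2 * (d + C))"
    have s: "0 < s" "s \<le> 1" using d C by (auto simp: s_def)
    have \<delta>: "\<delta> > 0" using d C by (simp add: \<delta>_def)
    have sd: "(1 - s)\<^sup>2 * d + s\<^sup>2 * C = d - 2 * \<delta>"
    proof -
      have e: "s * (d + C) = d" using d C by (simp add: s_def)
      have "2 * \<delta> = s * d" using d C by (simp add: \<delta>_def s_def power2_eq_square divide_simps)
      moreover have "(1 - s)\<^sup>2 * d + s\<^sup>2 * C = d - 2 * s * d + s * (s * (d + C))"
        by (simp add: power2_eq_square algebra_simps)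
      ultimately show ?thesis by (simp add: e)
    qed
    obtain l where l: "l \<in> \<Lambda>" "g l < d + \<delta>" using near[of "d + \<delta>"] \<delta> by auto
    define y where "y j = max 0 (P l j)" for j
    define Y where "Y = sum y I"
    have ynn: "y j \<ge> 0" for j by (simp add: y_def)
    have "Y \<noteq> 0"
    proof
      assume "Y = 0"
      then have "\<forall>j\<in>I. y j = 0" using ynn fin by (simp add: Y_def sum_nonneg_eq_0_iff)
      then have "g l = 0" by (simp add: g_def y_def)
      then show False using dle[OF l(1)] d by simp
    qed
    then have Y: "Y > 0" using ynn by (simp add: Y_def order_less_le sum_nonneg)
    define \<mu> where "\<mu> j = y j / Y" for j
    have mu: "\<mu> \<in> \<Lambda>" using Y ynn by (auto simp: \<Lambda>_def \<mu>_def Y_def simp flip: sum_divide_distrib)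
    have orth: "(\<Sum>j\<in>I. y j * P \<mu> j) = 0"
    proof -
      let ?T = "\<Sum>j\<in>I. \<Sum>i\<in>I. y j * y i * b i j"
      have "?T = (\<Sum>j\<in>I. \<Sum>i\<in>I. y i * y j * b j i)" by (rule sum.swap)
      also have "\<dots> = (\<Sum>j\<in>I. \<Sum>i\<in>I. - (y j * y i * b i j))"
      proof (intro sum.cong refl)
        fix j i assume "j \<in> I" "i \<in> I"
        then show "y i * y j * b j i = - (y j * y i * b i j)"
          by (subst anti[of j i]) simp_all
      qed
      also have "\<dots> = - ?T" by (simp add: sum_negf)
      finally have "?T = 0" by simp
      moreover have "(\<Sum>j\<in>I. y j * P \<mu> j) = ?T / Y"
      proof -
        have "y j * P \<mu> j = (\<Sum>i\<in>I. y j * y i * b i j) / Y" for j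
          by (simp add: P_def \<mu>_def sum_distrib_left sum_divide_distrib mult.assoc)
        then show ?thesis by (simp only: sum_divide_distrib)
      qed
      ultimately show ?thesis by simp
    qed
    define l' where "l' i = (1 - s) * l i + s * \<mu> i" for i
    have l': "l' \<in> \<Lambda>" using l(1) mu s
      by (auto simp: \<Lambda>_def l'_def sum.distrib simp flip: sum_distrib_left)
    have Pl': "P l' j = (1 - s) * P l j + s * P \<mu> j" for j
      unfolding P_def l'_def sum_distrib_left sum.distrib[symmetric] by (simp add: algebra_simps)
    \<comment> \<open>As \<open>s \<le> 1\<close>, replacing \<open>P l j\<close> by its positive
      part can only increase the positive part of the payoff; the cross term then falls to
      orthogonality.\<close>
    have "g l' \<le> (\<Sum>j\<in>I. ((1 - s) * y j + s * P \<mu> j)\<^sup>2)"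
      unfolding g_def
    proof (rule sum_mono)
      fix j
      have "(1 - s) * P l j \<le> (1 - s) * y j" using s by (intro mult_left_mono) (auto simp: y_def)
      then have "P l' j \<le> (1 - s) * y j + s * P \<mu> j" by (simp add: Pl')
      then have "\<bar>max 0 (P l' j)\<bar> \<le> \<bar>(1 - s) * y j + s * P \<mu> j\<bar>" by auto
      then show "(max 0 (P l' j))\<^sup>2 \<le> ((1 - s) * y j + s * P \<mu> j)\<^sup>2"
        by (rule abs_le_square_iff[THEN iffD1])
    qed
    also have "\<dots> = (\<Sum>j\<in>I. (1 - s)\<^sup>2 * (y j)\<^sup>2 + 2 * s * (1 - s) * (y j * P \<mu> j) + s\<^sup>2 * (P \<mu> j)\<^sup>2)"
      by (intro sum.cong refl) (simp add: power2_eq_square algebra_simps)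
    also have "\<dots> = (1 - s)\<^sup>2 * g l + 2 * s * (1 - s) * (\<Sum>j\<in>I. y j * P \<mu> j) + s\<^sup>2 * (\<Sum>j\<in>I. (P \<mu> j)\<^sup>2)"
      by (simp add: sum.distrib sum_distrib_left g_def y_def)
    also have "\<dots> \<le> (1 - s)\<^sup>2 * (d + \<delta>) + s\<^sup>2 * C"
      using orth l(2) PC[OF mu] by (auto intro!: add_mono mult_left_mono)
    also have "\<dots> = (1 - s)\<^sup>2 * \<delta> + (d - 2 * \<delta>)" using sd by (simp add: algebra_simps)
    also have "(1 - s)\<^sup>2 * \<delta> \<le> 1 * \<delta>"
      using s \<delta> by (intro mult_right_mono) (auto simp: power2_eq_square intro: mult_le_one)
    finally have "g l' < d" using \<delta> by simp
    then show False using dle[OF l'] by simp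
  qed
  then obtain l where l: "l \<in> \<Lambda>" "g l < \<epsilon>\<^sup>2" using near[of "\<epsilon>\<^sup>2"] eps by auto
  have "P l j \<le> \<epsilon>" if "j \<in> I" for j
  proof -
    have "(max 0 (P l j))\<^sup>2 \<le> g l" unfolding g_def using that fin by (intro member_le_sum) auto
    then have "(max 0 (P l j))\<^sup>2 < \<epsilon>\<^sup>2" using l(2) by simp
    then have "max 0 (P l j) < \<epsilon>" by (rule power2_less_imp_less) (use eps in simp)
    then show ?thesis by simp
  qed
  then show ?thesis using l(1) by (intro exI[of _ l]) (auto simp: \<Lambda>_def P_def)
qed

text \<open>Functions into the reals are not an instance of the class of real vector spaces, so the
  library's Jensen inequality for \<open>convex_on\<close> does not apply.\<close>

lemma Jensen_pointwise:
  fixes v :: "'i \<Rightarrow> 'a \<Rightarrow> real"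
  assumes conv: "\<And>u w t. u \<in> D \<Longrightarrow> w \<in> D \<Longrightarrow> 0 \<le> t \<Longrightarrow> t \<le> 1 \<Longrightarrow>
      (\<lambda>x. (1 - t) * u x + t * w x) \<in> D \<and> \<Phi> (\<lambda>x. (1 - t) * u x + t * w x) \<le> (1 - t) * \<Phi> u + t * \<Phi> w"
    and "finite I" "\<And>i. i \<in> I \<Longrightarrow> v i \<in> D" "\<And>i. i \<in> I \<Longrightarrow> l i \<ge> 0" "sum l I = 1"
  shows "(\<lambda>x. \<Sum>i\<in>I. l i * v i x) \<in> D \<and> \<Phi> (\<lambda>x. \<Sum>i\<in>I. l i * v i x) \<le> (\<Sum>i\<in>I. l i * (\<Phi> (v i) :: real))"
  using assms(2-)
proof (induction I arbitrary: l)
  case (insert i I)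
  have s: "sum l I = 1 - l i" using insert by simp
  have li: "0 \<le> l i" "l i \<le> 1" using insert.prems s sum_nonneg[of I l] by auto
  show ?case
  \<comment> \<open>The induction rescales the other weights by \<open>1 / (1 - l i)\<close>, so
    this case is set apart.\<close>
  proof (cases "l i = 1")
    case True
    then have "\<forall>j\<in>I. l j = 0" using s insert by (simp add: sum_nonneg_eq_0_iff)
    then have "(\<Sum>j\<in>I. l j * z j) = 0" for z by simp
    then show ?thesis using insert True by simp
  next
    case False
    define t where "t = 1 - l i"
    have t: "t > 0" "t \<le> 1" using False li by (auto simp: t_def)
    define k where "k j = l j / t" for j
    have lk: "l j = t * k j" for j using t by (simp add: k_def)
    have IH: "(\<lambda>x. \<Sum>j\<in>I. k j * v j x) \<in> D \<and> \<Phi> (\<lambda>x. \<Sum>j\<in>I. k j * v j x) \<le> (\<Sum>j\<in>I. k j * \<Phi> (v j))"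
      by (rule insert.IH) (use insert.prems t s in \<open>auto simp: k_def t_def simp flip: sum_divide_distrib\<close>)
    have e: "(\<Sum>j\<in>insert i I. l j * z j) = (1 - t) * z i + t * (\<Sum>j\<in>I. k j * z j)" for z
    proof -
      have "(\<Sum>j\<in>I. l j * z j) = t * (\<Sum>j\<in>I. k j * z j)"
        by (simp add: lk sum_distrib_left mult_ac)
      then show ?thesis using insert.hyps by (simp add: t_def)
    qed
    have "t * \<Phi> (\<lambda>x. \<Sum>j\<in>I. k j * v j x) \<le> t * (\<Sum>j\<in>I. k j * \<Phi> (v j))"
      using IH t by (intro mult_left_mono) auto
    then show ?thesis unfolding e
      using conv[of "v i" "\<lambda>x. \<Sum>j\<in>I. k j * v j x" t] IH insert.prems(1)[of i] t by (auto intro: order_trans)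
  qed
qed simp

section \<open>Test functions\<close>

lemma pderiv_at_eq:
  assumes "(u has_derivative D) (at x)"
  shows "pderiv_at i u x = D (axis i 1)"
  using frechet_derivative_at[OF assms] by (simp add: pderiv_at_def)

lemma pderiv_at_const [simp]: "pderiv_at i (\<lambda>x. c) x = 0"
  by (rule pderiv_at_eq[where D = "\<lambda>_. 0"]) simp

lemma pderiv_at_add:
  assumes "u differentiable at x" "v differentiable at x"
  shows "pderiv_at i (\<lambda>x. u x + v x) x = pderiv_at i u x + pderiv_at i v x"
  using pderiv_at_eq[OF has_derivative_add[OF assms[unfolded frechet_derivative_works]]]
  by (simp add: pderiv_at_def)

lemma pderiv_at_mult:
  assumes "u differentiable at x" "v differentiable at x"
  shows "pderiv_at i (\<lambda>x. u x * v x) x = u x * pderiv_at i v x + pderiv_at i u x * v x"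
  using pderiv_at_eq[OF has_derivative_mult[OF assms[unfolded frechet_derivative_works]]]
  by (simp add: pderiv_at_def)

lemma pderiv_at_cmult:
  assumes "u differentiable at x"
  shows "pderiv_at i (\<lambda>x. c * u x) x = c * pderiv_at i u x"
  using pderiv_at_mult[of "\<lambda>_. c" x u] assms by simp

lemma pderiv_at_cong_open:
  assumes "open S" "x \<in> S" "\<And>y. y \<in> S \<Longrightarrow> u y = v y" "v differentiable at x"
  shows "u differentiable at x" "pderiv_at i u x = pderiv_at i v x"
proof -
  have "(u has_derivative frechet_derivative v (at x)) (at x)"
    using assms by (intro has_derivative_transform_within_open[OF frechet_derivative_works[THEN iffD1, OF assms(4)]]) auto
  then show "u differentiable at x" "pderiv_at i u x = pderiv_at i v x"
    by (auto simp: differentiable_def pderiv_at_eq pderiv_at_def dest: frechet_derivative_at)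
qed

lemma pderiv_at_outside:
  assumes "closed K" "\<And>x. x \<notin> K \<Longrightarrow> u x = 0" "x \<notin> K"
  shows "pderiv_at i u x = 0"
  using pderiv_at_cong_open(2)[of "- K" x u "\<lambda>_. 0" i] assms by (auto simp: open_Compl)

text \<open>The parameter \<open>k\<close> makes the family closed under differentiation up to linear combinations.\<close>

definition flat_exp :: "nat \<Rightarrow> real \<Rightarrow> real" where
  "flat_exp k t = (if t \<le> 0 then 0 else (1 / t) ^ k / exp (1 / t))"

lemma flat_exp_tendsto_0: "(flat_exp k \<longlongrightarrow> 0) (at 0)"
proof -
  have "((\<lambda>x. x ^ k / exp x) \<longlongrightarrow> (0::real)) at_top" by (rule tendsto_power_div_exp_0)
  from filterlim_compose[OF this filterlim_inverse_at_top_right]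
  have "((\<lambda>t. (1 / t) ^ k / exp (1 / t)) \<longlongrightarrow> (0::real)) (at_right 0)"
    by (simp add: inverse_eq_divide)
  then have r: "(flat_exp k \<longlongrightarrow> 0) (at_right 0)"
    by (rule Lim_transform_eventually)
      (auto simp: flat_exp_def eventually_at_filter)
  have "((\<lambda>t. 0) \<longlongrightarrow> (0::real)) (at_left 0)" by simp
  then have l: "(flat_exp k \<longlongrightarrow> 0) (at_left 0)"
    by (rule Lim_transform_eventually)
      (auto simp: flat_exp_def eventually_at_filter)
  show ?thesis using l r by (rule filterlim_split_at)
qed

lemma DERIV_flat_exp:
  "(flat_exp k has_real_derivative (flat_exp (k + 2) t - real k * flat_exp (k + 1) t)) (at t)"
proof (cases t "0::real" rule: linorder_cases)
  case less
  have "((\<lambda>_. 0) has_real_derivative 0) (at t)" by simp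
  then have "(flat_exp k has_real_derivative 0) (at t)"
    by (rule has_field_derivative_transform_within_open[of _ _ _ "{..<0}"])
      (use less in \<open>auto simp: flat_exp_def\<close>)
  then show ?thesis using less by (simp add: flat_exp_def)
next
  case equal
  \<comment> \<open>Away from 0 the difference quotient is exactly \<open>flat_exp (k + 1)\<close>,
    so flatness to all orders is the one limit \<open>flat_exp_tendsto_0\<close>.\<close>
  have "((\<lambda>y. (flat_exp k y - flat_exp k 0) / (y - 0)) \<longlongrightarrow> 0) (at 0)"
    by (rule Lim_transform_eventually[OF flat_exp_tendsto_0[of "k + 1"]])
      (auto simp: flat_exp_def eventually_at_filter)
  then have "(flat_exp k has_real_derivative 0) (at 0)" by (simp add: has_field_derivative_iff)
  then show ?thesis using equal by (simp add: flat_exp_def)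
next
  case greater
  have inv: "((\<lambda>t. 1 / t) has_real_derivative - ((1 / t)\<^sup>2)) (at t)"
    using greater by (auto intro!: derivative_eq_intros simp: field_simps power2_eq_square)
  have pow: "((\<lambda>t. (1 / t) ^ k) has_real_derivative - real k * (1 / t) ^ (k + 1)) (at t)"
  proof (cases k)
    case (Suc j)
    show ?thesis unfolding Suc
      by (rule DERIV_cong[OF DERIV_power_Suc[OF inv]]) (simp add: power2_eq_square algebra_simps divide_inverse)
  qed simp
  have "((\<lambda>t. (1 / t) ^ k * exp (- (1 / t))) has_real_derivative
      (- real k * (1 / t) ^ (k + 1)) * exp (- (1 / t)) + (exp (- (1 / t)) * - (- ((1 / t)\<^sup>2))) * (1 / t) ^ k) (at t)"
    by (intro DERIV_mult pow DERIV_fun_exp DERIV_minus inv)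
  then have "((\<lambda>t. (1 / t) ^ k / exp (1 / t)) has_real_derivative
      (flat_exp (k + 2) t - real k * flat_exp (k + 1) t)) (at t)"
    using greater by (simp add: flat_exp_def exp_minus divide_inverse power2_eq_square algebra_simps)
  then show ?thesis
    by (rule has_field_derivative_transform_within_open[of _ _ _ "{0<..}"])
      (use greater in \<open>auto simp: flat_exp_def\<close>)
qed

text \<open>Smoothness asks every iterated partial derivative to be differentiable. It therefore
  suffices to have a class of differentiable functions closed under partial differentiation, and
  then to induct over the list of directions.\<close>

inductive_set bump_algebra :: "(real^'n::finite \<Rightarrow> real) set" where
  const: "(\<lambda>x. c) \<in> bump_algebra"
| gen: "(\<lambda>x. flat_exp k (c + s * x $ i)) \<in> bump_algebra"
| add: "u \<in> bump_algebra \<Longrightarrow> v \<in> bump_algebra \<Longrightarrow> (\<lambda>x. u x + v x) \<in> bump_algebra"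
| mult: "u \<in> bump_algebra \<Longrightarrow> v \<in> bump_algebra \<Longrightarrow> (\<lambda>x. u x * v x) \<in> bump_algebra"

lemma bump_algebra_pderiv:
  fixes u :: "real^'n::finite \<Rightarrow> real"
  assumes "u \<in> bump_algebra"
  shows "(\<forall>x. u differentiable at x) \<and> (\<forall>i. pderiv_at i u \<in> bump_algebra)"
  using assms
proof induction
  case (const c)
  have "pderiv_at i (\<lambda>x::real^'n. c) = (\<lambda>x. 0)" for i by (rule ext) simp
  then show ?case by (simp add: bump_algebra.const)
next
  case (gen k c s i)
  let ?u = "\<lambda>x::real^'n. flat_exp k (c + s * x $ i)"
  let ?D = "\<lambda>t. flat_exp (k + 2) t - real k * flat_exp (k + 1) t"
  have d: "(?u has_derivative (\<lambda>h. (s * h $ i) * ?D (c + s * x $ i))) (at x)" for x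
  proof -
    have 1: "((\<lambda>x::real^'n. c + s * x $ i) has_derivative (\<lambda>h. s * h $ i)) (at x)"
      by (auto intro!: derivative_eq_intros bounded_linear_imp_has_derivative bounded_linear_vec_nth)
    show ?thesis
      by (rule has_derivative_compose[OF 1 DERIV_flat_exp[unfolded has_field_derivative_def], THEN has_derivative_eq_rhs])
        (simp add: mult.commute)
  qed
  have "pderiv_at j ?u = (\<lambda>x. (s * axis j 1 $ i) *
      (flat_exp (k + 2) (c + s * x $ i) + (- real k) * flat_exp (k + 1) (c + s * x $ i)))" for j
    using pderiv_at_eq[OF d, of j] by (intro ext) simp
  moreover have "(\<lambda>x::real^'n. (s * axis j 1 $ i) *
      (flat_exp (k + 2) (c + s * x $ i) + (- real k) * flat_exp (k + 1) (c + s * x $ i))) \<in> bump_algebra" for j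
    by (intro bump_algebra.intros)
  ultimately show ?case using d by (auto simp: differentiable_def)
next
  case (add u v)
  have "pderiv_at i (\<lambda>x. u x + v x) = (\<lambda>x. pderiv_at i u x + pderiv_at i v x)" for i
    using add.IH by (intro ext pderiv_at_add) auto
  then show ?case using add.IH by (auto intro: bump_algebra.add)
next
  case (mult u v)
  have "pderiv_at i (\<lambda>x. u x * v x) = (\<lambda>x. u x * pderiv_at i v x + pderiv_at i u x * v x)" for i
    using mult.IH by (intro ext pderiv_at_mult) auto
  then show ?case using mult by (auto intro!: bump_algebra.add bump_algebra.mult)
qed

lemma bump_algebra_smooth:
  assumes "u \<in> bump_algebra"
  shows "smooth_on UNIV u"
proof -
  have "iter_pderiv is u \<in> bump_algebra" for "is"
    by (induction "is") (use assms bump_algebra_pderiv in auto)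
  then show ?thesis using bump_algebra_pderiv
    by (auto simp: smooth_on_def differentiable_on_def)
qed

lemma bump_algebra_prod:
  assumes "finite I" "\<And>i. i \<in> I \<Longrightarrow> u i \<in> bump_algebra"
  shows "(\<lambda>x. \<Prod>i\<in>I. u i x) \<in> bump_algebra"
  using assms by (induction I rule: finite_induct) (auto intro: bump_algebra.intros)

text \<open>The factor \<open>n\<close> drives each \<open>flat_exp 0\<close> to 1 inside the box
  while leaving the support in place, so that indicators of open boxes become bounded pointwise
  limits of test functions.\<close>

definition box_bump :: "real^'n::finite \<Rightarrow> real^'n \<Rightarrow> nat \<Rightarrow> real^'n \<Rightarrow> real" where
  "box_bump a b n x =
     (\<Prod>i\<in>UNIV. flat_exp 0 (real n * (x $ i - a $ i)) * flat_exp 0 (real n * (b $ i - x $ i)))"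

lemma flat_exp_0_bounds: "0 \<le> flat_exp 0 t" "flat_exp 0 t \<le> 1"
  by (auto simp: flat_exp_def)

lemma box_bump_bounds: "0 \<le> box_bump a b n x" "box_bump a b n x \<le> 1"
  using flat_exp_0_bounds
  by (auto simp: box_bump_def intro!: prod_nonneg prod_le_1 mult_le_one)

lemma box_bump_outside: "x \<notin> box a b \<Longrightarrow> box_bump a b n x = 0"
  by (force simp: box_bump_def mem_box_cart prod_zero_iff flat_exp_def mult_le_0_iff not_less)

lemma box_bump_smooth: "smooth_on UNIV (box_bump a b n)"
proof -
  have "(\<lambda>x. \<Prod>i\<in>UNIV. flat_exp 0 (- (real n * a $ i) + real n * x $ i) *
      flat_exp 0 (real n * b $ i + (- real n) * x $ i)) \<in> bump_algebra"
    by (intro bump_algebra_prod bump_algebra.intros) auto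
  then show ?thesis
    by (intro bump_algebra_smooth) (simp add: box_bump_def[abs_def] right_diff_distrib)
qed

lemma flat_exp_0_tendsto_1:
  assumes "t > 0" shows "(\<lambda>n. flat_exp 0 (real n * t)) \<longlonglongrightarrow> 1"
proof -
  have "(\<lambda>n. inverse (real n) * (1 / t)) \<longlonglongrightarrow> 0 * (1 / t)"
    by (intro tendsto_mult lim_inverse_n tendsto_const)
  then have "(\<lambda>n. 1 / exp (inverse (real n) * (1 / t))) \<longlonglongrightarrow> 1 / exp (0 * (1 / t))"
    by (rule tendsto_divide[OF tendsto_const tendsto_exp]) simp
  then have "(\<lambda>n. 1 / exp (inverse (real n) * (1 / t))) \<longlonglongrightarrow> 1"
    by (simp only: mult_zero_left exp_zero div_by_1)
  then show ?thesis
    by (rule Lim_transform_eventually)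
      (use assms in \<open>auto intro!: eventually_sequentiallyI[of 1] simp: flat_exp_def inverse_eq_divide mult_le_0_iff\<close>)
qed

lemma box_bump_tendsto: "(\<lambda>n. box_bump a b n x) \<longlonglongrightarrow> indicator (box a b) x"
proof (cases "x \<in> box a b")
  case True
  then have "(\<lambda>n. box_bump a b n x) \<longlonglongrightarrow> (\<Prod>i\<in>(UNIV::'a set). 1 * 1)"
    unfolding box_bump_def mem_box_cart
    by (intro tendsto_prod tendsto_mult flat_exp_0_tendsto_1) auto
  then show ?thesis using True by simp
qed (simp add: box_bump_outside)

lemma box_bump_test:
  assumes "cbox a b \<subseteq> \<Omega>"
  shows "box_bump a b n \<in> test_functions \<Omega>"
  using assms box_bump_smooth[of a b n] box_bump_outside[of _ a b n] box_subset_cbox[of a b]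
  by (auto simp: test_functions_def intro!: exI[of _ "cbox a b"])

text \<open>Testing with box bumps and dominated convergence shows that \<open>h\<close> has
  integral zero over every closed box inside \<Omega>. Lebesgue differentiation then recovers
  \<open>h\<close> almost everywhere from its averages over small boxes.\<close>

lemma fundamental_lemma:
  fixes h :: "real^'n::finite \<Rightarrow> real"
  assumes "open \<Omega>" and loc: "locally_integrable \<Omega> h"
    and zero: "\<And>\<psi>. \<psi> \<in> test_functions \<Omega> \<Longrightarrow> (LINT x|lebesgue_on \<Omega>. h x * \<psi> x) = 0"
  shows "AE x in lebesgue_on \<Omega>. h x = 0"
proof -
  have Om [measurable]: "\<Omega> \<in> sets lebesgue" using assms(1) by auto
  have abs: "h absolutely_integrable_on cbox c d" if "cbox c d \<subseteq> \<Omega>" for c d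
    using loc that by (auto simp: locally_integrable_def)
  have box0: "integral (cbox c d) h = 0" if cd: "cbox c d \<subseteq> \<Omega>" for c d
  proof -
    have eq: "(LINT x|lebesgue_on \<Omega>. h x * box_bump c d n x) = (LINT x|lebesgue. indicator (cbox c d) x * h x * box_bump c d n x)" for n
    proof -
      have "(LINT x|lebesgue_on \<Omega>. h x * box_bump c d n x) = (LINT x|lebesgue. indicator \<Omega> x *\<^sub>R (h x * box_bump c d n x))"
        by (rule integral_restrict_space) simp
      also have "\<dots> = (LINT x|lebesgue. indicator (cbox c d) x * h x * box_bump c d n x)"
        using cd box_bump_outside[of _ c d n] box_subset_cbox[of c d]
        by (intro Bochner_Integration.integral_cong refl) (auto simp: indicator_def split: if_splits)
      finally show ?thesis .
    qed
    have hi: "integrable lebesgue (\<lambda>x. indicator (cbox c d) x * h x)"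
      using abs[OF cd] by (simp add: set_integrable_def)
    have "(\<lambda>n. LINT x|lebesgue. indicator (cbox c d) x * h x * box_bump c d n x)
      \<longlonglongrightarrow> (LINT x|lebesgue. indicator (cbox c d) x * h x * indicator (box c d) x)"
    proof (rule integral_dominated_convergence[where w = "\<lambda>x. \<bar>indicator (cbox c d) x * h x\<bar>"])
      have [measurable]: "(\<lambda>x. indicator (cbox c d) x * h x) \<in> borel_measurable lebesgue" using hi by auto
      have "continuous_on UNIV (box_bump c d n)" for n
        using box_bump_smooth[of c d n] unfolding smooth_on_def
        by (metis differentiable_imp_continuous_on iter_pderiv.simps(1))
      then have [measurable]: "box_bump c d n \<in> borel_measurable lebesgue" for n
        by (intro measurable_completion) (auto intro: borel_measurable_continuous_onI)
      show "(\<lambda>x. indicator (cbox c d) x * h x * box_bump c d n x) \<in> borel_measurable lebesgue" for n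
        by measurable
      have [measurable]: "box c d \<in> sets lebesgue" by auto
      show "(\<lambda>x. indicator (cbox c d) x * h x * indicator (box c d) x) \<in> borel_measurable lebesgue"
        by measurable
      show "AE x in lebesgue. norm (indicator (cbox c d) x * h x * box_bump c d n x) \<le> \<bar>indicator (cbox c d) x * h x\<bar>" for n
        using box_bump_bounds[of c d n] by (auto simp: abs_mult intro!: mult_left_le)
      show "AE x in lebesgue. (\<lambda>n. indicator (cbox c d) x * h x * box_bump c d n x) \<longlonglongrightarrow> indicator (cbox c d) x * h x * indicator (box c d) x"
        by (intro AE_I2 tendsto_mult_left box_bump_tendsto)
    qed (use hi in auto)
    then have "(LINT x|lebesgue. indicator (cbox c d) x * h x * indicator (box c d) x) = 0"
      using zero[OF box_bump_test[OF cd]] by (simp add: eq LIMSEQ_const_iff)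
    also have "(\<lambda>x. indicator (cbox c d) x * h x * indicator (box c d) x) = (\<lambda>x. indicator (box c d) x *\<^sub>R h x)"
      using box_subset_cbox[of c d] by (auto simp: indicator_def fun_eq_iff)
    finally have z: "(LINT x|lebesgue. indicator (box c d) x *\<^sub>R h x) = 0" .
    have "h absolutely_integrable_on box c d"
      using abs[OF cd] by (simp add: absolutely_integrable_on_open_interval)
    then have "integral (box c d) h = 0"
      using set_lebesgue_integral_eq_integral(2)[of "box c d" h] z by (simp add: set_lebesgue_integral_def)
    then show ?thesis by (simp add: integral_open_interval)
  qed
  have box: "AE x in lebesgue. x \<in> cbox c d \<longrightarrow> h x = 0" if cd: "cbox c d \<subseteq> \<Omega>" for c d
  proof -
    \<comment> \<open>Extension by zero makes the function integrable on every box, as the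
      differentiation theorem demands.\<close>
    define F where "F x = (if x \<in> cbox c d then h x else 0)" for x
    have "F integrable_on UNIV"
      unfolding F_def integrable_restrict_UNIV using abs[OF cd] absolutely_integrable_imp_integrable
      by (auto intro: set_lebesgue_integral_eq_integral(1))
    then have Fi: "F integrable_on cbox x y" for x y by (rule integrable_on_subcbox) simp
    obtain N where N: "negligible N"
      "\<And>x e. \<lbrakk>x \<notin> N; 0 < e\<rbrakk> \<Longrightarrow> \<exists>t>0. \<forall>h. 0 < h \<and> h < t \<longrightarrow>
         norm (integral (cbox x (x + h *\<^sub>R One)) F /\<^sub>R h ^ DIM(real^'n) - F x) < e"
      using integrable_ccontinuous_explicit[OF Fi] by blast
    have z: "h x = 0" if x: "x \<in> box c d" "x \<notin> N" for x
    proof (rule ccontr)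
      assume "h x \<noteq> 0"
      then obtain t where t: "t > 0" "\<And>s. 0 < s \<Longrightarrow> s < t \<Longrightarrow>
         norm (integral (cbox x (x + s *\<^sub>R One)) F /\<^sub>R s ^ DIM(real^'n) - F x) < \<bar>h x\<bar>"
        using N(2)[OF x(2), of "\<bar>h x\<bar>"] by auto
      have "((\<lambda>s. x + s *\<^sub>R One) \<longlongrightarrow> x + 0 *\<^sub>R One) (at_right 0)"
        by (intro tendsto_intros)
      then have "\<forall>\<^sub>F s in at_right 0. x + s *\<^sub>R One \<in> box c d"
        using x(1) by (intro topological_tendstoD) (auto simp: open_box)
      moreover have "\<forall>\<^sub>F s in at_right 0. s < t" using t(1) by (intro eventually_at_rightI[of 0 t]) auto
      moreover have "\<forall>\<^sub>F s in at_right 0. (0::real) < s" by (rule eventually_at_right_less)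
      ultimately have "\<forall>\<^sub>F s in at_right 0. x + s *\<^sub>R One \<in> box c d \<and> s < t \<and> 0 < s"
        by eventually_elim auto
      then obtain s where s: "x + s *\<^sub>R One \<in> box c d" "s < t" "0 < s"
        using eventually_happens[of _ "at_right (0::real)"] by (auto simp: trivial_limit_at_right_real)
      have sub: "cbox x (x + s *\<^sub>R One) \<subseteq> cbox c d"
        using x(1) s(1) by (auto simp: subset_box mem_box intro: less_imp_le)
      have "integral (cbox x (x + s *\<^sub>R One)) F = integral (cbox x (x + s *\<^sub>R One)) h"
        by (rule integral_cong) (use sub in \<open>auto simp: F_def\<close>)
      also have "\<dots> = 0" using sub cd by (intro box0) auto
      finally have "norm (F x) < \<bar>h x\<bar>" using t(2)[OF s(3,2)] by simp
      then show False using x(1) box_subset_cbox[of c d] by (auto simp: F_def)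
    qed
    \<comment> \<open>The small boxes fit only around points of the open box; the faces of
      \<open>cbox c d\<close> are null and join the exceptional set.\<close>
    have "negligible (N \<union> (cbox c d - box c d))"
      using N(1) by (intro negligible_Un negligible_frontier_interval)
    then show ?thesis
      by (intro AE_I'[of "N \<union> (cbox c d - box c d)"]) (use z in \<open>auto simp: negligible_iff_null_sets\<close>)
  qed
  \<comment> \<open>Countably many closed boxes fill \<Omega>, so their exceptional sets have a null
    union.\<close>
  obtain \<D> where D: "countable \<D>" "\<D> \<subseteq> Pow \<Omega>" "\<And>X. X \<in> \<D> \<Longrightarrow> \<exists>c d. X = cbox c d"
      "\<Union>\<D> = \<Omega>"
    using open_countable_Union_open_cbox[OF assms(1)] by blast
  have "AE x in lebesgue. \<forall>X\<in>\<D>. x \<in> X \<longrightarrow> h x = 0"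
    unfolding AE_ball_countable[OF D(1)]
  proof
    fix X assume X: "X \<in> \<D>"
    then obtain c d where "X = cbox c d" "cbox c d \<subseteq> \<Omega>" using D(2,3) by blast
    then show "AE x in lebesgue. x \<in> X \<longrightarrow> h x = 0" using box by simp
  qed
  then have "AE x in lebesgue. x \<in> \<Omega> \<longrightarrow> h x = 0"
    by eventually_elim (use D(4) in auto)
  then show ?thesis by (subst AE_restrict_space_iff) auto
qed

section \<open>Supports, bounds and combinations of test functions\<close>

lemma test_smooth:
  assumes "\<psi> \<in> test_functions \<Omega>"
  shows "\<psi> differentiable at x" "pderiv_at i \<psi> differentiable at x"
    "continuous_on S \<psi>" "continuous_on S (pderiv_at i \<psi>)" "continuous_on S (grad \<psi>)"
proof -
  have s: "iter_pderiv is \<psi> differentiable_on UNIV" for "is"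
    using assms by (auto simp: test_functions_def smooth_on_def)
  have 1: "\<psi> differentiable_on UNIV" "pderiv_at i \<psi> differentiable_on UNIV" for i
    using s[of "[]"] s[of "[i]"] by auto
  show "\<psi> differentiable at x" "pderiv_at i \<psi> differentiable at x"
    using 1 by (auto simp: differentiable_on_def)
  have c: "continuous_on S (pderiv_at i \<psi>)" for i
    using differentiable_imp_continuous_on[OF 1(2)] continuous_on_subset by blast
  show "continuous_on S \<psi>" using differentiable_imp_continuous_on[OF 1(1)] continuous_on_subset by blast
  show "continuous_on S (pderiv_at i \<psi>)" by (rule c)
  show "continuous_on S (grad \<psi>)"
    unfolding grad_def[abs_def] by (intro continuous_on_vec_lambda c)
qed

lemma test_support:
  assumes "\<psi> \<in> test_functions \<Omega>"
  obtains K where "compact K" "K \<subseteq> \<Omega>" "\<And>x. x \<notin> K \<Longrightarrow> \<psi> x = 0"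
    "\<And>x i. x \<notin> K \<Longrightarrow> pderiv_at i \<psi> x = 0" "\<And>x. x \<notin> K \<Longrightarrow> grad \<psi> x = 0"
proof -
  obtain K where K: "compact K" "K \<subseteq> \<Omega>" "\<And>x. x \<notin> K \<Longrightarrow> \<psi> x = 0"
    using assms by (auto simp: test_functions_def)
  then have "pderiv_at i \<psi> x = 0" if "x \<notin> K" for x i
    using pderiv_at_outside[OF compact_imp_closed, of K \<psi> x i] that by blast
  then show ?thesis using that[OF K] by (simp add: grad_def vec_eq_iff)
qed

lemma continuous_compact_support_bounded:
  fixes f :: "'a::metric_space \<Rightarrow> 'b::real_normed_vector"
  assumes "continuous_on UNIV f" "compact K" "\<And>x. x \<notin> K \<Longrightarrow> f x = 0"
  obtains B where "B \<ge> 0" "\<And>x. norm (f x) \<le> B"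
proof -
  have "compact (f ` K)"
    using assms by (intro compact_continuous_image) (auto intro: continuous_on_subset)
  then obtain B where B: "\<And>y. y \<in> f ` K \<Longrightarrow> norm y \<le> B"
    using bounded_iff compact_imp_bounded by metis
  have "norm (f x) \<le> max B 0" for x
    using B[of "f x"] assms(3)[of x] by (cases "x \<in> K") auto
  then show ?thesis using that[of "max B 0"] by simp
qed

lemma test_bounded:
  assumes "\<psi> \<in> test_functions \<Omega>"
  obtains B where "B \<ge> 0" "\<And>x. \<bar>\<psi> x\<bar> \<le> B" "\<And>x. norm (grad \<psi> x) \<le> B" "\<And>x i. \<bar>pderiv_at i \<psi> x\<bar> \<le> B"
proof -
  obtain K where K: "compact K" "K \<subseteq> \<Omega>" "\<And>x. x \<notin> K \<Longrightarrow> \<psi> x = 0"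
    "\<And>x i. x \<notin> K \<Longrightarrow> pderiv_at i \<psi> x = 0" "\<And>x. x \<notin> K \<Longrightarrow> grad \<psi> x = 0"
    using test_support[OF assms] by metis
  obtain B1 where B1: "B1 \<ge> 0" "\<And>x. norm (\<psi> x) \<le> B1"
    using continuous_compact_support_bounded[OF test_smooth(3)[OF assms] K(1,3)] by blast
  obtain B2 where B2: "B2 \<ge> 0" "\<And>x. norm (grad \<psi> x) \<le> B2"
    using continuous_compact_support_bounded[OF test_smooth(5)[OF assms] K(1,5)] by blast
  have g: "\<bar>pderiv_at i \<psi> x\<bar> \<le> norm (grad \<psi> x)" for i x
    using component_le_norm_cart[of "grad \<psi> x" i] by (simp add: grad_def)
  have "\<bar>\<psi> x\<bar> \<le> max B1 B2" "norm (grad \<psi> x) \<le> max B1 B2" "\<bar>pderiv_at i \<psi> x\<bar> \<le> max B1 B2" for x i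
    using B1(2)[of x] B2(2)[of x] g[of i x] by auto
  then show ?thesis using that[of "max B1 B2"] B1(1) by auto
qed

lemma iter_pderiv_linear:
  assumes "smooth_on UNIV u" "smooth_on UNIV v"
  shows "iter_pderiv is (\<lambda>x. c * u x + d * v x) = (\<lambda>x. c * iter_pderiv is u x + d * iter_pderiv is v x)"
proof (induction "is")
  case (Cons i "is")
  have d: "iter_pderiv is u differentiable at x" "iter_pderiv is v differentiable at x" for x
    using assms by (auto simp: smooth_on_def differentiable_on_def)
  show ?case unfolding iter_pderiv.simps Cons.IH
    by (rule ext) (use d in \<open>simp add: pderiv_at_add pderiv_at_cmult\<close>)
qed simp

lemma test_linear:
  assumes "\<psi> \<in> test_functions \<Omega>" "\<eta> \<in> test_functions \<Omega>"
  shows "(\<lambda>x. c * \<psi> x + d * \<eta> x) \<in> test_functions \<Omega>"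
    and "grad (\<lambda>x. c * \<psi> x + d * \<eta> x) x = c *\<^sub>R grad \<psi> x + d *\<^sub>R grad \<eta> x"
proof -
  have sm: "smooth_on UNIV \<psi>" "smooth_on UNIV \<eta>" using assms by (auto simp: test_functions_def)
  obtain K L where K: "compact K" "K \<subseteq> \<Omega>" "\<And>x. x \<notin> K \<Longrightarrow> \<psi> x = 0"
    and L: "compact L" "L \<subseteq> \<Omega>" "\<And>x. x \<notin> L \<Longrightarrow> \<eta> x = 0"
    using assms by (auto simp: test_functions_def)
  have "smooth_on UNIV (\<lambda>x. c * \<psi> x + d * \<eta> x)"
    unfolding smooth_on_def iter_pderiv_linear[OF sm]
    using sm by (auto simp: smooth_on_def intro!: differentiable_on_add differentiable_on_mult)
  moreover have "\<exists>K. compact K \<and> K \<subseteq> \<Omega> \<and> (\<forall>x. x \<notin> K \<longrightarrow> c * \<psi> x + d * \<eta> x = 0)"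
    using K L by (intro exI[of _ "K \<union> L"]) auto
  ultimately show "(\<lambda>x. c * \<psi> x + d * \<eta> x) \<in> test_functions \<Omega>"
    by (simp add: test_functions_def)
  show "grad (\<lambda>x. c * \<psi> x + d * \<eta> x) x = c *\<^sub>R grad \<psi> x + d *\<^sub>R grad \<eta> x"
    using test_smooth(1)[OF assms(1)] test_smooth(1)[OF assms(2)]
    by (simp add: grad_def vec_eq_iff pderiv_at_add pderiv_at_cmult)
qed

lemma test_zero [simp]: "(\<lambda>x. 0) \<in> test_functions \<Omega>"
proof -
  have "iter_pderiv is (\<lambda>x. 0) = (\<lambda>x. 0)" for "is" :: "'a::finite list"
    by (induction "is") auto
  then show ?thesis by (auto simp: test_functions_def smooth_on_def)
qed

lemma grad_zero [simp]: "grad (\<lambda>x. 0) = (\<lambda>x. 0)"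
  by (simp add: grad_def fun_eq_iff vec_eq_iff)

section \<open>Integration by parts\<close>

text \<open>The difference quotients in direction \<open>i\<close> have integral zero by translation invariance.\<close>

lemma integral_pderiv_compact_support:
  fixes G :: "real^'n::finite \<Rightarrow> real"
  assumes diff: "\<And>x. G differentiable at x" and cont: "continuous_on UNIV (pderiv_at i G)"
    and K: "compact K" "\<And>x. x \<notin> K \<Longrightarrow> G x = 0"
  shows "(LINT x|lborel. pderiv_at i G x) = 0"
proof -
  let ?e = "axis i 1 :: real^'n"
  define g where "g = pderiv_at i G"
  have g0: "g x = 0" if "x \<notin> K" for x
    unfolding g_def using pderiv_at_outside[OF compact_imp_closed[OF K(1)], of G x i] K(2) that by blast
  obtain B where B: "B \<ge> 0" "\<And>x. norm (g x) \<le> B"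
    using continuous_compact_support_bounded[OF cont K(1)] g0 unfolding g_def by blast
  obtain R where R: "\<And>x. x \<in> K \<Longrightarrow> norm x \<le> R"
    using compact_imp_bounded[OF K(1)] bounded_iff by metis
  have line: "((\<lambda>t. G (x + t *\<^sub>R ?e)) has_real_derivative g (x + t *\<^sub>R ?e)) (at t)" for x t
  proof -
    let ?y = "x + t *\<^sub>R ?e"
    have 1: "((\<lambda>t. x + t *\<^sub>R ?e) has_derivative (\<lambda>h. h *\<^sub>R ?e)) (at t)"
      by (auto intro!: derivative_eq_intros)
    have 2: "(G has_derivative frechet_derivative G (at ?y)) (at ?y)"
      using diff frechet_derivative_works by blast
    have "frechet_derivative G (at ?y) (h *\<^sub>R ?e) = g ?y * h" for h
      using linear_scale[OF has_derivative_linear[OF 2], of h ?e]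
      by (simp add: g_def pderiv_at_def mult.commute)
    then show ?thesis
      using has_derivative_compose[OF 1 2] by (simp add: has_field_derivative_def mult_commute_abs)
  qed
  have Gc: "continuous_on UNIV G"
    using diff by (meson differentiable_at_withinI differentiable_imp_continuous_on differentiable_on_def)
  have [measurable]: "G \<in> borel_measurable borel" "g \<in> borel_measurable borel"
    using Gc cont by (auto simp: g_def intro: borel_measurable_continuous_onI)
  obtain BG where BG: "\<And>x. norm (G x) \<le> BG"
    using continuous_compact_support_bounded[OF Gc K] by blast
  have Gi: "integrable lborel G"
  proof (rule Bochner_Integration.integrable_bound)
    show "integrable lborel (\<lambda>x. BG * indicator K x)"
      using K(1) by (intro integrable_mult_right integrable_real_indicator)
        (auto simp: emeasure_bounded_finite[unfolded infinity_ennreal_def] compact_imp_bounded borel_compact)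
    show "AE x in lborel. norm (G x) \<le> norm (BG * indicator K x)"
    proof (rule AE_I2)
      fix x show "norm (G x) \<le> norm (BG * indicator K x)"
        using BG[of x] K(2)[of x] by (cases "x \<in> K") auto
    qed
  qed simp
  define Q where "Q n x = (G (x + (1 / real (Suc n)) *\<^sub>R ?e) - G x) * real (Suc n)" for n x
  have Qm [measurable]: "Q n \<in> borel_measurable lborel" for n unfolding Q_def by measurable
  have tr: "integrable lborel (\<lambda>x. G (x + c))" "(LINT x|lborel. G (x + c)) = (LINT x|lborel. G x)" for c
  proof -
    have "integrable (distr lborel borel ((+) c)) G" using Gi by (simp add: lborel_distr_plus)
    then show "integrable lborel (\<lambda>x. G (x + c))" by (subst (asm) integrable_distr_eq) (auto simp: add.commute)
    have "(LINT x|distr lborel borel ((+) c). G x) = (LINT x|lborel. G (c + x))"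
      by (rule integral_distr) auto
    then show "(LINT x|lborel. G (x + c)) = (LINT x|lborel. G x)" by (simp add: lborel_distr_plus add.commute)
  qed
  have Q0: "(LINT x|lborel. Q n x) = 0" for n
    unfolding Q_def using tr Gi by simp
  have Qlim: "(\<lambda>n. Q n x) \<longlonglongrightarrow> g x" for x
  proof -
    have "((\<lambda>h. (G (x + h *\<^sub>R ?e) - G x) / h) \<longlongrightarrow> g x) (at 0)"
      using line[of x 0] by (simp add: has_field_derivative_iff)
    moreover have "filterlim (\<lambda>n. 1 / real (Suc n)) (at 0) sequentially"
      using LIMSEQ_inverse_real_of_nat by (simp add: filterlim_at inverse_eq_divide del: of_nat_Suc)
    ultimately have "(\<lambda>n. (G (x + (1 / real (Suc n)) *\<^sub>R ?e) - G x) / (1 / real (Suc n))) \<longlonglongrightarrow> g x"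
      by (rule filterlim_compose)
    then show ?thesis by (simp add: Q_def)
  qed
  \<comment> \<open>By the mean value theorem each quotient is a value of \<open>g\<close>, hence
    bounded by \<open>B\<close>. The step is at most 1, so the support grows by at most 1, whence
    the radius \<open>R + 1\<close>.\<close>
  have Qb: "norm (Q n x) \<le> B * indicator (cball 0 (R + 1)) x" for n x
  proof -
    let ?h = "1 / real (Suc n)"
    have h: "0 < ?h" "?h \<le> 1" by auto
    have "\<exists>z>0. z < ?h \<and> G (x + ?h *\<^sub>R ?e) - G (x + 0 *\<^sub>R ?e) = (?h - 0) * g (x + z *\<^sub>R ?e)"
      by (rule MVT2[OF h(1)]) (rule line)
    then obtain z where "G (x + ?h *\<^sub>R ?e) - G x = ?h * g (x + z *\<^sub>R ?e)" by auto
    then have "Q n x = g (x + z *\<^sub>R ?e)" by (simp add: Q_def)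
    then have 1: "norm (Q n x) \<le> B" using B(2) by simp
    have "Q n x = 0" if "x \<notin> cball 0 (R + 1)"
    proof -
      have "norm x > R + 1" using that by simp
      moreover have "norm x \<le> norm (x + ?h *\<^sub>R ?e) + norm (?h *\<^sub>R ?e)"
        using norm_triangle_ineq4[of "x + ?h *\<^sub>R ?e" "?h *\<^sub>R ?e"] by simp
      moreover have "norm (?h *\<^sub>R ?e) \<le> 1" using h by (simp add: norm_axis_1)
      ultimately have "norm x > R" "norm (x + ?h *\<^sub>R ?e) > R" by linarith+
      then have "x \<notin> K" "x + ?h *\<^sub>R ?e \<notin> K" using R by (meson not_le)+
      then show ?thesis using K(2) by (simp add: Q_def)
    qed
    then show ?thesis using 1 by (auto simp: indicator_def)
  qed
  have "(\<lambda>n. LINT x|lborel. Q n x) \<longlonglongrightarrow> (LINT x|lborel. g x)"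
  proof (rule integral_dominated_convergence[where w = "\<lambda>x. B * indicator (cball 0 (R + 1)) x"])
    show "integrable lborel (\<lambda>x. B * indicator (cball (0::real^'n) (R + 1)) x)"
      by (intro integrable_mult_right integrable_real_indicator)
        (auto simp: emeasure_bounded_finite[unfolded infinity_ennreal_def])
  qed (use Qlim Qb in auto)
  then show ?thesis using Q0 by (simp add: LIMSEQ_const_iff g_def)
qed

text \<open>The open sets \<Omega> and \<open>- K\<close> cover the whole space, and on the second
  one \<open>G\<close> vanishes. So \<open>G\<close> is globally of class \<open>C^1\<close>,
  although a factor of it, such as the field \<open>a\<close>, may be smooth in \<Omega>
  only.\<close>

lemma integral_pderiv_zero_on:
  fixes G :: "real^'n::finite \<Rightarrow> real"
  assumes "open \<Omega>" and diff: "\<And>x. x \<in> \<Omega> \<Longrightarrow> G differentiable at x"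
    and cont: "continuous_on \<Omega> (pderiv_at i G)"
    and K: "compact K" "K \<subseteq> \<Omega>" "\<And>x. x \<notin> K \<Longrightarrow> G x = 0"
  shows "(LINT x|lebesgue_on \<Omega>. pderiv_at i G x) = 0"
proof -
  have oK: "open (- K)" using K(1) by (simp add: compact_imp_closed open_Compl)
  have g0: "pderiv_at i G x = 0" if "x \<notin> K" for x
    using pderiv_at_outside[OF compact_imp_closed[OF K(1)], of G x i] K(3) that by blast
  have UN: "\<Omega> \<union> - K = UNIV" using K(2) by auto
  have d: "G differentiable at x" for x
  proof (cases "x \<in> K")
    case False
    then show ?thesis using pderiv_at_cong_open(1)[of "- K" x G "\<lambda>_. 0"] oK K(3) by auto
  qed (use diff K(2) in auto)
  have "continuous_on (- K) (pderiv_at i G)"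
    using g0 by (subst continuous_on_cong[OF refl, of _ _ "\<lambda>_. 0"]) auto
  then have c: "continuous_on UNIV (pderiv_at i G)"
    using continuous_on_open_Un[OF assms(1) oK cont] UN by simp
  have "(LINT x|lebesgue_on \<Omega>. pderiv_at i G x) = (LINT x|lebesgue. (if x \<in> \<Omega> then pderiv_at i G x else 0))"
    using assms(1) by (intro Lebesgue_Measure.integral_restrict_UNIV[symmetric]) auto
  also have "(\<lambda>x. if x \<in> \<Omega> then pderiv_at i G x else 0) = pderiv_at i G"
    using g0 K(2) by (auto simp: fun_eq_iff)
  also have "(LINT x|lebesgue. pderiv_at i G x) = (LINT x|lborel. pderiv_at i G x)"
    using borel_measurable_continuous_onI[OF c] by (intro integral_completion) simp
  also have "\<dots> = 0" by (rule integral_pderiv_compact_support[OF d c K(1,3)])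
  finally show ?thesis .
qed

text \<open>For \<open>q < 2\<close> the scalar factor blows up at the origin, but the product has
  norm \<open>norm b powr (q - 1)\<close>, which tends to 0. The range \<open>1 < q < 2\<close>
  occurs below with the exponent \<open>m\<close>.\<close>

lemma continuous_norm_powr_scaleR:
  fixes b :: "'a::real_normed_vector"
  assumes "q > 1"
  shows "isCont (\<lambda>b. norm b powr (q - 2) *\<^sub>R b) b"
proof (cases "b = 0")
  case False
  then show ?thesis by (intro continuous_intros) auto
next
  case True
  have "((\<lambda>b. norm (b::'a) powr (q - 1)) \<longlongrightarrow> norm (0::'a) powr (q - 1)) (at 0)"
    using assms by (intro tendsto_powr' tendsto_intros) auto
  then have "((\<lambda>b. norm (b::'a) powr (q - 1)) \<longlongrightarrow> 0) (at 0)" by simp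
  moreover have "norm (norm b powr (q - 2) *\<^sub>R b) = norm b powr (q - 1)" for b :: 'a
    using powr_add[of "norm b" "q - 2" 1] by (cases "b = 0") (auto simp: powr_one)
  ultimately have "((\<lambda>b. norm (b::'a) powr (q - 2) *\<^sub>R b) \<longlongrightarrow> 0) (at 0)"
    by (intro tendsto_norm_zero_cancel[of "\<lambda>b. norm b powr (q - 2) *\<^sub>R b"]) simp
  then show ?thesis by (simp add: True isCont_def)
qed

text \<open>Squeezed between the subgradients at \<open>t\<close> and at the neighbouring point.\<close>

lemma DERIV_abs_powr:
  fixes t :: real
  assumes "q > 1"
  shows "((\<lambda>t. \<bar>t\<bar> powr q) has_real_derivative q * (\<bar>t\<bar> powr (q - 2) * t)) (at t)"
proof -
  define F where "F t = q * (\<bar>t\<bar> powr (q - 2) * t)" for t :: real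
  have sub: "\<bar>t\<bar> powr q + F t * (s - t) \<le> \<bar>s\<bar> powr q" for s t
    using norm_powr_gradient_ineq[OF assms, of t s] by (simp add: F_def mult_ac)
  have "isCont F t"
    using continuous_norm_powr_scaleR[OF assms, of t] by (simp add: isCont_def F_def[abs_def] tendsto_mult_left)
  then have lim: "(F \<longlongrightarrow> F t) (at t)" by (simp add: isCont_def)
  have bd: "\<bar>(\<bar>s\<bar> powr q - \<bar>t\<bar> powr q) / (s - t) - F t\<bar> \<le> \<bar>F s - F t\<bar>" if "s \<noteq> t" for s
  proof -
    have "0 \<le> \<bar>s\<bar> powr q - \<bar>t\<bar> powr q - F t * (s - t)" using sub[of t s] by simp
    moreover have "\<bar>s\<bar> powr q - \<bar>t\<bar> powr q - F t * (s - t) \<le> (F s - F t) * (s - t)"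
      using sub[of s t] by (simp add: algebra_simps)
    ultimately have "\<bar>\<bar>s\<bar> powr q - \<bar>t\<bar> powr q - F t * (s - t)\<bar> \<le> \<bar>F s - F t\<bar> * \<bar>s - t\<bar>"
      by (simp flip: abs_mult)
    then have "\<bar>\<bar>s\<bar> powr q - \<bar>t\<bar> powr q - F t * (s - t)\<bar> / \<bar>s - t\<bar> \<le> \<bar>F s - F t\<bar>"
      using that by (simp add: divide_le_eq)
    moreover have "(\<bar>s\<bar> powr q - \<bar>t\<bar> powr q) / (s - t) - F t = (\<bar>s\<bar> powr q - \<bar>t\<bar> powr q - F t * (s - t)) / (s - t)"
      using that by (simp add: field_simps)
    ultimately show ?thesis by (simp add: abs_divide)
  qed
  have "((\<lambda>s. (\<bar>s\<bar> powr q - \<bar>t\<bar> powr q) / (s - t) - F t) \<longlongrightarrow> 0) (at t)"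
  proof (rule Lim_null_comparison[where g = "\<lambda>s. \<bar>F s - F t\<bar>"])
    show "\<forall>\<^sub>F s in at t. norm ((\<bar>s\<bar> powr q - \<bar>t\<bar> powr q) / (s - t) - F t) \<le> \<bar>F s - F t\<bar>"
      using bd by (auto simp: eventually_at_filter)
    show "((\<lambda>s. \<bar>F s - F t\<bar>) \<longlongrightarrow> 0) (at t)"
      using tendsto_rabs_zero[OF LIM_zero[OF lim]] .
  qed
  then have "((\<lambda>s. (\<bar>s\<bar> powr q - \<bar>t\<bar> powr q) / (s - t)) \<longlongrightarrow> F t) (at t)" by (rule LIM_zero_cancel)
  then show ?thesis by (simp add: has_field_derivative_iff F_def)
qed

text \<open>A crude form of Young's inequality, by comparing \<open>2 * t\<close> with
  \<open>s\<close>. The coefficient 1/2 lets the first term be absorbed in the proof of Poincare's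
  inequality.\<close>

lemma powr_mult_le_split:
  fixes s t :: real
  assumes "p \<ge> 1" "s \<ge> 0" "t \<ge> 0"
  shows "s powr (p - 1) * t \<le> s powr p / 2 + (2 * t) powr p"
proof (cases "2 * t \<le> s")
  case True
  have "s powr (p - 1) * t \<le> s powr (p - 1) * (s / 2)" using True by (intro mult_left_mono) auto
  also have "\<dots> = s powr p / 2"
    using powr_add[of s "p - 1" 1] assms by (cases "s = 0") (auto simp: powr_one)
  finally show ?thesis by (simp add: add_increasing2)
next
  case False
  have "s powr (p - 1) * t \<le> (2 * t) powr (p - 1) * (2 * t)"
    using False assms by (intro mult_mono powr_mono2) auto
  also have "\<dots> = (2 * t) powr p"
    using powr_add[of "2 * t" "p - 1" 1] assms by (cases "t = 0") (auto simp: powr_one)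
  finally show ?thesis by (simp add: add_increasing)
qed

section \<open>Poincare's inequality for test functions\<close>

lemma open_lebesgue_on_facts:
  fixes \<Omega> :: "(real^'n::finite) set"
  assumes "open \<Omega>" "bounded \<Omega>"
  shows "finite_measure (lebesgue_on \<Omega>)" "\<Omega> \<in> sets lebesgue"
  using assms by (auto intro!: finite_measure_lebesgue_on lmeasurable_open)

lemma test_Lp:
  assumes "open \<Omega>" "bounded \<Omega>" "\<psi> \<in> test_functions \<Omega>" "q \<ge> 0"
  shows "Lp_mem (lebesgue_on \<Omega>) q \<psi>" "Lp_mem (lebesgue_on \<Omega>) q (grad \<psi>)"
    "Lp_mem (lebesgue_on \<Omega>) q (pderiv_at i \<psi>)"
proof -
  interpret finite_measure "lebesgue_on \<Omega>" using open_lebesgue_on_facts assms by blast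
  obtain B where B: "\<And>x. \<bar>\<psi> x\<bar> \<le> B" "\<And>x. norm (grad \<psi> x) \<le> B" "\<And>x i. \<bar>pderiv_at i \<psi> x\<bar> \<le> B"
    using test_bounded[OF assms(3)] by metis
  note m = continuous_imp_measurable_on_sets_lebesgue[OF _ open_lebesgue_on_facts(2)[OF assms(1,2)]]
  show "Lp_mem (lebesgue_on \<Omega>) q \<psi>" "Lp_mem (lebesgue_on \<Omega>) q (grad \<psi>)"
    "Lp_mem (lebesgue_on \<Omega>) q (pderiv_at i \<psi>)"
    using B test_smooth[OF assms(3)] assms(4)
    by (auto intro!: Lp_mem_bounded[of _ B] m)
qed

text \<open>Integrating the \<open>i\<close>-th derivative of
  \<open>x $ i * \<bar>\<psi> x\<bar> powr p\<close> over \<Omega> gives zero. The product rule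
  splits off the integral of \<open>\<bar>\<psi> x\<bar> powr p\<close>; boundedness of \<Omega>
  controls \<open>x $ i\<close> in the other term, half of whose estimate is absorbed.\<close>

lemma poincare_test:
  fixes \<Omega> :: "(real^'n::finite) set"
  assumes "open \<Omega>" "bounded \<Omega>" "p \<ge> 2"
  shows "\<exists>C>0. \<forall>\<psi>\<in>test_functions \<Omega>. (LINT x|lebesgue_on \<Omega>. \<bar>\<psi> x\<bar> powr p)
      \<le> C * (LINT x|lebesgue_on \<Omega>. norm (grad \<psi> x) powr p)"
proof -
  obtain R where R: "R > 0" "\<And>x. x \<in> \<Omega> \<Longrightarrow> norm x \<le> R" using bounded_pos[THEN iffD1, OF assms(2)] by auto
  \<comment> \<open>Any coordinate direction serves.\<close>
  let ?i = "undefined :: 'n"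
  \<comment> \<open>\<open>2 * (p * R)\<close> comes from \<open>powr_mult_le_split\<close>; the
    leading 2 from absorbing one half of the left-hand side.\<close>
  define C where "C = 2 * (2 * (p * R)) powr p"
  have "(LINT x|lebesgue_on \<Omega>. \<bar>\<psi> x\<bar> powr p) \<le> C * (LINT x|lebesgue_on \<Omega>. norm (grad \<psi> x) powr p)"
    if psi: "\<psi> \<in> test_functions \<Omega>" for \<psi>
  proof -
    obtain K where K: "compact K" "K \<subseteq> \<Omega>" "\<And>x. x \<notin> K \<Longrightarrow> \<psi> x = 0" using test_support[OF psi] by metis
    define F where "F x = p * (\<bar>\<psi> x\<bar> powr (p - 2) * \<psi> x)" for x
    define G where "G x = x $ ?i * \<bar>\<psi> x\<bar> powr p" for x
    have dP: "((\<lambda>x. \<bar>\<psi> x\<bar> powr p) has_derivative (\<lambda>h. F x * frechet_derivative \<psi> (at x) h)) (at x)" for x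
      unfolding F_def
      using has_derivative_compose[OF frechet_derivative_works[THEN iffD1, OF test_smooth(1)[OF psi]]
          DERIV_abs_powr[of p, unfolded has_field_derivative_def]] assms(3) by simp
    have dX: "((\<lambda>x. x $ ?i) has_derivative (\<lambda>h. h $ ?i)) (at x)" for x :: "real^'n"
      by (intro bounded_linear_imp_has_derivative bounded_linear_vec_nth)
    have dG: "G differentiable at x" "pderiv_at ?i G x = x $ ?i * (F x * pderiv_at ?i \<psi> x) + \<bar>\<psi> x\<bar> powr p" for x
    proof -
      have 1: "(\<lambda>x. x $ ?i) differentiable at x" "(\<lambda>x. \<bar>\<psi> x\<bar> powr p) differentiable at x"
        using dP dX by (auto simp: differentiable_def)
      show "G differentiable at x" unfolding G_def using 1 by (rule differentiable_mult)
      show "pderiv_at ?i G x = x $ ?i * (F x * pderiv_at ?i \<psi> x) + \<bar>\<psi> x\<bar> powr p"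
        unfolding G_def pderiv_at_mult[OF 1] pderiv_at_eq[OF dP] pderiv_at_eq[OF dX]
        by (simp add: pderiv_at_def)
    qed
    have Fc: "continuous_on UNIV F"
    proof -
      have "continuous_on UNIV (\<lambda>t::real. norm t powr (p - 2) *\<^sub>R t)"
      proof (intro continuous_at_imp_continuous_on ballI)
        show "isCont (\<lambda>t::real. norm t powr (p - 2) *\<^sub>R t) t" for t
          using continuous_norm_powr_scaleR[of p t] assms(3) by simp
      qed
      from continuous_on_compose2[OF this test_smooth(3)[OF psi]]
      show ?thesis unfolding F_def by (intro continuous_on_mult_left) auto
    qed
    have Pc: "continuous_on UNIV (\<lambda>x. \<bar>\<psi> x\<bar> powr p)"
      using test_smooth(3)[OF psi] assms(3) by (intro continuous_on_powr' continuous_intros) auto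
    have "continuous_on UNIV (pderiv_at ?i G)"
      unfolding dG(2)[abs_def] by (intro continuous_intros Fc Pc test_smooth(4)[OF psi])
    then have cG: "continuous_on \<Omega> (pderiv_at ?i G)" using continuous_on_subset by blast
    have "(LINT x|lebesgue_on \<Omega>. pderiv_at ?i G x) = 0"
      by (rule integral_pderiv_zero_on[OF assms(1) dG(1) cG K(1,2)]) (use K(3) in \<open>auto simp: G_def\<close>)
    then have I0: "(LINT x|lebesgue_on \<Omega>. x $ ?i * (F x * pderiv_at ?i \<psi> x) + \<bar>\<psi> x\<bar> powr p) = 0"
      by (simp add: dG(2))
    have Pi: "integrable (lebesgue_on \<Omega>) (\<lambda>x. \<bar>\<psi> x\<bar> powr p)"
      and Di: "integrable (lebesgue_on \<Omega>) (\<lambda>x. norm (grad \<psi> x) powr p)"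
      using test_Lp[OF assms(1,2) psi, of p] assms(3) by (auto simp: Lp_mem_def)
    have "(LINT x|lebesgue_on \<Omega>. x $ ?i * (F x * pderiv_at ?i \<psi> x) + \<bar>\<psi> x\<bar> powr p)
        \<ge> (LINT x|lebesgue_on \<Omega>. \<bar>\<psi> x\<bar> powr p / 2 - (2 * (p * R)) powr p * norm (grad \<psi> x) powr p)"
    proof (rule integral_mono_AE)
      have Fm: "continuous_on \<Omega> (\<lambda>x. x $ ?i * (F x * pderiv_at ?i \<psi> x) + \<bar>\<psi> x\<bar> powr p)"
        using cG by (simp add: dG(2))
      have le: "\<bar>x $ ?i * (F x * pderiv_at ?i \<psi> x)\<bar> \<le> \<bar>\<psi> x\<bar> powr p / 2 + (2 * (p * R)) powr p * norm (grad \<psi> x) powr p"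
        if "x \<in> \<Omega>" for x
      proof -
        have "\<bar>pderiv_at ?i \<psi> x\<bar> \<le> norm (grad \<psi> x)"
          using component_le_norm_cart[of "grad \<psi> x" ?i] by (simp add: grad_def)
        moreover have "\<bar>x $ ?i\<bar> \<le> R" using component_le_norm_cart[of x ?i] R(2)[OF that] by simp
        moreover have "\<bar>F x\<bar> = p * \<bar>\<psi> x\<bar> powr (p - 1)"
          using powr_add[of "\<bar>\<psi> x\<bar>" "p - 2" 1] assms(3)
          by (cases "\<psi> x = 0") (auto simp: F_def abs_mult powr_one)
        ultimately have "\<bar>x $ ?i * (F x * pderiv_at ?i \<psi> x)\<bar> \<le> R * ((p * \<bar>\<psi> x\<bar> powr (p - 1)) * norm (grad \<psi> x))"
          unfolding abs_mult using R(1) assms(3) by (intro mult_mono) auto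
        also have "\<dots> = \<bar>\<psi> x\<bar> powr (p - 1) * (p * R * norm (grad \<psi> x))" by simp
        also have "\<dots> \<le> \<bar>\<psi> x\<bar> powr p / 2 + (2 * (p * R * norm (grad \<psi> x))) powr p"
          using assms(3) R(1) by (intro powr_mult_le_split) auto
        also have "2 * (p * R * norm (grad \<psi> x)) = (2 * (p * R)) * norm (grad \<psi> x)" by simp
        finally show ?thesis using R(1) assms(3) by (simp only: powr_mult)
      qed
      show "AE x in lebesgue_on \<Omega>. \<bar>\<psi> x\<bar> powr p / 2 - (2 * (p * R)) powr p * norm (grad \<psi> x) powr p
        \<le> x $ ?i * (F x * pderiv_at ?i \<psi> x) + \<bar>\<psi> x\<bar> powr p"
        using le by (intro AE_I2) (fastforce simp: abs_le_iff)
      show "integrable (lebesgue_on \<Omega>) (\<lambda>x. x $ ?i * (F x * pderiv_at ?i \<psi> x) + \<bar>\<psi> x\<bar> powr p)"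
      proof (rule Bochner_Integration.integrable_bound)
        show "integrable (lebesgue_on \<Omega>) (\<lambda>x. 2 * \<bar>\<psi> x\<bar> powr p + (2 * (p * R)) powr p * norm (grad \<psi> x) powr p)"
          using Pi Di by auto
        show "(\<lambda>x. x $ ?i * (F x * pderiv_at ?i \<psi> x) + \<bar>\<psi> x\<bar> powr p) \<in> borel_measurable (lebesgue_on \<Omega>)"
          using continuous_imp_measurable_on_sets_lebesgue[OF Fm] assms(1) by auto
        show "AE x in lebesgue_on \<Omega>. norm (x $ ?i * (F x * pderiv_at ?i \<psi> x) + \<bar>\<psi> x\<bar> powr p)
          \<le> norm (2 * \<bar>\<psi> x\<bar> powr p + (2 * (p * R)) powr p * norm (grad \<psi> x) powr p)"
        proof (rule AE_I2)
          fix x assume "x \<in> space (lebesgue_on \<Omega>)"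
          then have "\<bar>x $ ?i * (F x * pderiv_at ?i \<psi> x)\<bar> \<le> \<bar>\<psi> x\<bar> powr p / 2 + (2 * (p * R)) powr p * norm (grad \<psi> x) powr p"
            using le by simp
          moreover have "\<bar>\<psi> x\<bar> powr p \<ge> 0" "(2 * (p * R)) powr p * norm (grad \<psi> x) powr p \<ge> 0" by auto
          ultimately show "norm (x $ ?i * (F x * pderiv_at ?i \<psi> x) + \<bar>\<psi> x\<bar> powr p)
            \<le> norm (2 * \<bar>\<psi> x\<bar> powr p + (2 * (p * R)) powr p * norm (grad \<psi> x) powr p)"
            unfolding real_norm_def by linarith
        qed
      qed
    qed (use Pi Di in auto)
    then show ?thesis using I0 Pi Di by (simp add: C_def)
  qed
  moreover have "C > 0" using R(1) assms(3) by (simp add: C_def)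
  ultimately show ?thesis by blast
qed

section \<open>Limits of components and combinations, and Clarkson's inequality for
  integrals\<close>

lemma tendsto_0_bound:
  fixes f g :: "nat \<Rightarrow> real"
  assumes "\<And>n. 0 \<le> f n" "\<And>n. f n \<le> g n" "g \<longlonglongrightarrow> 0"
  shows "f \<longlonglongrightarrow> 0"
  by (rule tendsto_sandwich[OF _ _ tendsto_const assms(3)]) (use assms(1,2) in auto)

text \<open>Extended by zero, both functions live on the complete Lebesgue measure. This supplies
  measurability of the arbitrarily chosen \<open>wgrad\<close>.\<close>

lemma borel_measurable_lebesgue_on_AE:
  fixes f g :: "'a::euclidean_space \<Rightarrow> 'b::euclidean_space"
  assumes S: "S \<in> sets lebesgue" and f: "f \<in> borel_measurable (lebesgue_on S)"
    and eq: "AE x in lebesgue_on S. f x = g x"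
  shows "g \<in> borel_measurable (lebesgue_on S)"
proof -
  have "(\<lambda>x. if x \<in> S then f x else 0) \<in> borel_measurable lebesgue"
    using f by (simp add: borel_measurable_if[OF S])
  moreover have "AE x in lebesgue. (if x \<in> S then f x else 0) = (if x \<in> S then g x else 0)"
    using eq S by (subst (asm) AE_restrict_space_iff) (auto elim: eventually_mono)
  ultimately have "(\<lambda>x. if x \<in> S then g x else 0) \<in> borel_measurable lebesgue"
    by (rule borel_measurable_AE)
  then show ?thesis by (simp add: borel_measurable_if[OF S])
qed

lemma Lp_mem_component:
  fixes g :: "'a \<Rightarrow> real^'n::finite"
  assumes "Lp_mem M p g" "p \<ge> 0"
  shows "Lp_mem M p (\<lambda>x. g x $ i)"
proof (rule Lp_mem_bound[OF _ Lp_memD(2)[OF assms(1)]])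
  have "(\<lambda>x. g x $ i) = (\<lambda>x. g x \<bullet> axis i 1)" by (simp add: inner_axis)
  then show "(\<lambda>x. g x $ i) \<in> borel_measurable M"
    using Lp_memD(1)[OF assms(1)] by simp
  show "AE x in M. norm (g x $ i) powr p \<le> norm (g x) powr p"
    using assms(2) by (intro AE_I2 powr_mono2) (auto intro: component_le_norm_cart)
qed

lemma Lp_gap_component_tendsto:
  fixes g :: "nat \<Rightarrow> 'a \<Rightarrow> real^'n::finite"
  assumes "\<And>n. Lp_mem M p (g n)" "Lp_mem M p h" "p \<ge> 0" "Lp_tendsto M p g h"
  shows "Lp_tendsto M p (\<lambda>n x. g n x $ i) (\<lambda>x. h x $ i)"
proof (rule tendsto_sandwich[OF _ _ tendsto_const assms(4)])
  show "\<forall>\<^sub>F n in sequentially. Lp_gap M p (\<lambda>x. g n x $ i) (\<lambda>x. h x $ i) \<le> Lp_gap M p (g n) h"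
  proof (intro always_eventually allI)
    fix n
    have d: "Lp_mem M p (\<lambda>x. g n x - h x)" using Lp_mem_diff[OF assms(1,2,3)] .
    have e: "norm (g n x $ i - h x $ i) \<le> norm (g n x - h x)" for x
      using component_le_norm_cart[of "g n x - h x" i] by simp
    show "Lp_gap M p (\<lambda>x. g n x $ i) (\<lambda>x. h x $ i) \<le> Lp_gap M p (g n) h"
      unfolding Lp_gap_def
      using Lp_mem_component[OF d assms(3), of i] d assms(3) e
      by (intro integral_mono powr_mono2) (auto simp: Lp_mem_def)
  qed
qed simp

lemma Lp_gap_lincomb_tendsto:
  fixes f :: "nat \<Rightarrow> 'a \<Rightarrow> 'b::euclidean_space"
  assumes "\<And>n. Lp_mem M p (f n)" "Lp_mem M p f'" "\<And>n. Lp_mem M p (g n)" "Lp_mem M p g'" "p \<ge> 0"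
    and "Lp_tendsto M p f f'" "Lp_tendsto M p g g'"
  shows "Lp_tendsto M p (\<lambda>n x. c *\<^sub>R f n x + d *\<^sub>R g n x) (\<lambda>x. c *\<^sub>R f' x + d *\<^sub>R g' x)"
proof (rule tendsto_sandwich[of "\<lambda>_. 0"])
  show "(\<lambda>n. 2 powr p * (\<bar>c\<bar> powr p * Lp_gap M p (f n) f' + \<bar>d\<bar> powr p * Lp_gap M p (g n) g')) \<longlonglongrightarrow> 0"
    using tendsto_mult[OF tendsto_const[of "2 powr p"] tendsto_add[OF
      tendsto_mult[OF tendsto_const[of "\<bar>c\<bar> powr p"] assms(6)]
      tendsto_mult[OF tendsto_const[of "\<bar>d\<bar> powr p"] assms(7)]]] by simp
  show "\<forall>\<^sub>F n in sequentially. Lp_gap M p (\<lambda>x. c *\<^sub>R f n x + d *\<^sub>R g n x) (\<lambda>x. c *\<^sub>R f' x + d *\<^sub>R g' x)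
     \<le> 2 powr p * (\<bar>c\<bar> powr p * Lp_gap M p (f n) f' + \<bar>d\<bar> powr p * Lp_gap M p (g n) g')"
  proof (intro always_eventually allI)
    fix n
    have d: "Lp_mem M p (\<lambda>x. f n x - f' x)" "Lp_mem M p (\<lambda>x. g n x - g' x)"
      using assms by (auto intro: Lp_mem_diff)
    have m: "Lp_mem M p (\<lambda>x. (c *\<^sub>R f n x + d *\<^sub>R g n x) - (c *\<^sub>R f' x + d *\<^sub>R g' x))"
      using assms by (auto intro!: Lp_mem_diff Lp_mem_add Lp_mem_scaleR)
    have "Lp_gap M p (\<lambda>x. c *\<^sub>R f n x + d *\<^sub>R g n x) (\<lambda>x. c *\<^sub>R f' x + d *\<^sub>R g' x)
      \<le> (LINT x|M. 2 powr p * (\<bar>c\<bar> powr p * norm (f n x - f' x) powr p + \<bar>d\<bar> powr p * norm (g n x - g' x) powr p))"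
      unfolding Lp_gap_def
    proof (rule integral_mono)
      fix x
      show "norm ((c *\<^sub>R f n x + d *\<^sub>R g n x) - (c *\<^sub>R f' x + d *\<^sub>R g' x)) powr p
        \<le> 2 powr p * (\<bar>c\<bar> powr p * norm (f n x - f' x) powr p + \<bar>d\<bar> powr p * norm (g n x - g' x) powr p)"
      proof -
        have "(c *\<^sub>R f n x + d *\<^sub>R g n x) - (c *\<^sub>R f' x + d *\<^sub>R g' x)
            = c *\<^sub>R (f n x - f' x) + d *\<^sub>R (g n x - g' x)"
          by (simp add: algebra_simps)
        then show ?thesis
          using norm_add_powr_le[OF assms(5), of "c *\<^sub>R (f n x - f' x)" "d *\<^sub>R (g n x - g' x)"]
          by (simp only: norm_scaleR powr_mult)
      qed
    qed (use d m in \<open>auto simp: Lp_mem_def\<close>)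
    then show "Lp_gap M p (\<lambda>x. c *\<^sub>R f n x + d *\<^sub>R g n x) (\<lambda>x. c *\<^sub>R f' x + d *\<^sub>R g' x)
     \<le> 2 powr p * (\<bar>c\<bar> powr p * Lp_gap M p (f n) f' + \<bar>d\<bar> powr p * Lp_gap M p (g n) g')"
      using d by (simp add: Lp_mem_def Lp_gap_def)
  qed
qed auto

lemma (in finite_measure) Lp_mem_integrable:
  assumes "Lp_mem M p u" "p \<ge> 1"
  shows "integrable M u"
  using Lp_mem_lower[OF assms(1), of 1] assms(2)
  by (auto simp: Lp_mem_def integrable_norm_iff)

text \<open>The factor \<open>(1/2) powr p\<close> leaves the half difference in
  \<open>clarkson\<close> by homogeneity, and 2 clears the mean on the right. The gap term is the
  convexity defect \<open>D\<close> fed to \<open>directed_near_minimizers\<close>.\<close>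

lemma clarkson_integral:
  fixes g h :: "'a \<Rightarrow> 'b::euclidean_space"
  assumes "Lp_mem M p g" "Lp_mem M p h" "p \<ge> 2"
  shows "2 * (1/2) powr p * Lp_gap M p g h + 2 * (LINT x|M. norm ((1/2) *\<^sub>R g x + (1/2) *\<^sub>R h x) powr p)
    \<le> (LINT x|M. norm (g x) powr p) + (LINT x|M. norm (h x) powr p)"
proof -
  have p0: "p \<ge> 0" using assms by simp
  have m: "Lp_mem M p (\<lambda>x. (1/2) *\<^sub>R g x + (1/2) *\<^sub>R h x)" "Lp_mem M p (\<lambda>x. g x - h x)"
    using assms(1,2) p0 by (auto intro!: Lp_mem_add Lp_mem_diff Lp_mem_scaleR)
  have "(LINT x|M. norm ((1/2) *\<^sub>R g x + (1/2) *\<^sub>R h x) powr p + (1/2) powr p * norm (g x - h x) powr p)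
     \<le> (LINT x|M. (norm (g x) powr p + norm (h x) powr p) / 2)"
  proof (rule integral_mono)
    fix x
    show "norm ((1/2) *\<^sub>R g x + (1/2) *\<^sub>R h x) powr p + (1/2) powr p * norm (g x - h x) powr p
      \<le> (norm (g x) powr p + norm (h x) powr p) / 2"
      using clarkson[OF assms(3), of "g x" "h x"]
      by (simp add: scaleR_add_right powr_mult[of "1/2", symmetric])
  qed (use assms m in \<open>auto simp: Lp_mem_def\<close>)
  then show ?thesis using assms m by (simp add: Lp_mem_def Lp_gap_def)
qed

section \<open>The Sobolev space\<close>

locale sobolev_setting =
  fixes \<Omega> :: "(real^'n::finite) set" and p :: real
  assumes open_dom: "open \<Omega>" and bounded_dom: "bounded \<Omega>" and p_ge_2: "p \<ge> 2"
begin

abbreviation "\<mu> \<equiv> lebesgue_on \<Omega>"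

sublocale finite_measure \<mu>
  using open_lebesgue_on_facts[OF open_dom bounded_dom] by simp

lemma dom_sets [measurable]: "\<Omega> \<in> sets lebesgue"
  using open_lebesgue_on_facts[OF open_dom bounded_dom] by simp

lemma p_nonneg: "p \<ge> 0" and p_pos: "p > 0" and p_gt_1: "p > 1" using p_ge_2 by auto

lemma Lp_locally_integrable:
  assumes "Lp_mem \<mu> q u" "q \<ge> 1"
  shows "locally_integrable \<Omega> u"
  unfolding locally_integrable_def
proof (intro allI impI)
  fix K assume K: "compact K \<and> K \<subseteq> \<Omega>"
  have "set_integrable lebesgue \<Omega> u"
    using Lp_mem_integrable[OF assms] dom_sets by (simp add: set_integrable_def integrable_restrict_space)
  moreover have "K \<in> sets lebesgue" using K by (auto simp: borel_compact)
  ultimately show "u absolutely_integrable_on K"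
    using K by (blast intro: set_integrable_subset)
qed

lemma locally_integrable_test:
  fixes h :: "real^'n \<Rightarrow> real"
  assumes "locally_integrable \<Omega> h" "K \<subseteq> \<Omega>" "compact K" "\<And>x. x \<notin> K \<Longrightarrow> \<psi> x = 0" "continuous_on UNIV \<psi>"
  shows "integrable \<mu> (\<lambda>x. h x * \<psi> x)"
proof -
  have hK: "integrable lebesgue (\<lambda>x. indicator K x * h x)"
    using assms by (simp add: locally_integrable_def set_integrable_def)
  obtain B where B: "\<And>x. norm (\<psi> x) \<le> B"
    using continuous_compact_support_bounded[OF assms(5,3,4)] by metis
  have [measurable]: "(\<lambda>x. indicator K x * h x) \<in> borel_measurable lebesgue" using hK by auto
  have [measurable]: "\<psi> \<in> borel_measurable lebesgue"
    using assms(5) by (intro measurable_completion) (simp add: borel_measurable_continuous_onI)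
  have "integrable lebesgue (\<lambda>x. (indicator K x * h x) * \<psi> x)"
  proof (rule Bochner_Integration.integrable_bound)
    show "integrable lebesgue (\<lambda>x. (indicator K x * h x) * B)" using hK by simp
    show "AE x in lebesgue. norm (indicator K x * h x * \<psi> x) \<le> norm (indicator K x * h x * B)"
      unfolding norm_mult
      by (intro AE_I2 mult_left_mono order_trans[OF B]) auto
  qed simp
  moreover have "(\<lambda>x. (indicator K x * h x) * \<psi> x) = (\<lambda>x. indicator \<Omega> x *\<^sub>R (h x * \<psi> x))"
    using assms(2,4) by (auto simp: fun_eq_iff indicator_def)
  ultimately show ?thesis by (simp add: integrable_restrict_space)
qed

lemma weak_gradient_unique:
  assumes "has_weak_gradient \<Omega> u g" "has_weak_gradient \<Omega> u h"
  shows "AE x in \<mu>. g x = h x"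
proof -
  have "AE x in \<mu>. (g x - h x) $ i = 0" for i
  proof (rule fundamental_lemma[OF open_dom])
    have comp: "locally_integrable \<Omega> (\<lambda>x. w x $ i)" if "locally_integrable \<Omega> w" for w :: "real^'n \<Rightarrow> real^'n"
      using that absolutely_integrable_component[where b = "axis i 1" and f = w]
      by (auto simp: locally_integrable_def inner_axis)
    have gi: "locally_integrable \<Omega> (\<lambda>x. g x $ i)" and hi: "locally_integrable \<Omega> (\<lambda>x. h x $ i)"
      using assms comp by (auto simp: has_weak_gradient_def)
    show "locally_integrable \<Omega> (\<lambda>x. (g x - h x) $ i)"
      using gi hi by (auto simp: locally_integrable_def intro: set_integral_diff)
    fix \<psi> assume psi: "\<psi> \<in> test_functions \<Omega>"
    obtain K where K: "compact K" "K \<subseteq> \<Omega>" "\<And>x. x \<notin> K \<Longrightarrow> \<psi> x = 0" using test_support[OF psi] by metis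
    note t = locally_integrable_test[OF _ K(2,1,3) test_smooth(3)[OF psi]]
    show "(LINT x|\<mu>. (g x - h x) $ i * \<psi> x) = 0"
      using assms psi t[OF gi] t[OF hi] by (simp add: left_diff_distrib has_weak_gradient_def)
  qed
  then have "AE x in \<mu>. \<forall>i. (g x - h x) $ i = 0" by (subst AE_all_countable) auto
  then show ?thesis by eventually_elim (simp add: vec_eq_iff)
qed

text \<open>\<open>sob u g\<close> means that \<open>u\<close> lies in \<open>W\<^sub>0\<^sup>1\<^sup>,\<^sup>p\<close> with gradient \<open>g\<close>; it avoids the arbitrary choice in \<open>wgrad\<close>.\<close>

definition sob :: "(real^'n \<Rightarrow> real) \<Rightarrow> (real^'n \<Rightarrow> real^'n) \<Rightarrow> bool" where
  "sob u g \<longleftrightarrow> Lp_mem \<mu> p u \<and> Lp_mem \<mu> p g \<and> (\<exists>\<psi>. (\<forall>k::nat. \<psi> k \<in> test_functions \<Omega>) \<and>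
     Lp_tendsto \<mu> p \<psi> u \<and> Lp_tendsto \<mu> p (\<lambda>k. grad (\<psi> k)) g)"

lemma sobD: "sob u g \<Longrightarrow> Lp_mem \<mu> p u" "sob u g \<Longrightarrow> Lp_mem \<mu> p g"
  by (auto simp: sob_def)

lemma sobE:
  assumes "sob u g"
  obtains \<psi> where "\<And>k::nat. \<psi> k \<in> test_functions \<Omega>"
    "Lp_tendsto \<mu> p \<psi> u" "Lp_tendsto \<mu> p (\<lambda>k. grad (\<psi> k)) g"
  using assms by (auto simp: sob_def)

lemmas test_Lp' = test_Lp[OF open_dom bounded_dom]

lemma pairing_tendsto:
  fixes f :: "nat \<Rightarrow> real^'n \<Rightarrow> real"
  assumes "\<And>n. Lp_mem \<mu> p (f n)" "Lp_mem \<mu> p f'" "Lp_mem \<mu> 2 g" "Lp_tendsto \<mu> p f f'"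
  shows "(\<lambda>n. LINT x|\<mu>. f n x * g x) \<longlonglongrightarrow> (LINT x|\<mu>. f' x * g x)"
  using assms(1,2,3) p_ge_2
  by (intro L2_pairing_tendsto Lp_gap_lower[OF assms(1,2) _ p_ge_2 assms(4)]) (auto intro: Lp_mem_lower[of p])

lemma test_ibp:
  assumes "\<psi> \<in> test_functions \<Omega>" "\<eta> \<in> test_functions \<Omega>"
  shows "(LINT x|\<mu>. \<psi> x * pderiv_at i \<eta> x) = - (LINT x|\<mu>. pderiv_at i \<psi> x * \<eta> x)"
proof -
  obtain K where K: "compact K" "K \<subseteq> \<Omega>" "\<And>x. x \<notin> K \<Longrightarrow> \<psi> x = 0" using test_support[OF assms(1)] by metis
  have d: "pderiv_at i (\<lambda>x. \<psi> x * \<eta> x) = (\<lambda>x. \<psi> x * pderiv_at i \<eta> x + pderiv_at i \<psi> x * \<eta> x)"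
    using test_smooth(1)[OF assms(1)] test_smooth(1)[OF assms(2)] by (intro ext pderiv_at_mult)
  have "(LINT x|\<mu>. pderiv_at i (\<lambda>x. \<psi> x * \<eta> x) x) = 0"
  proof (rule integral_pderiv_zero_on[OF open_dom _ _ K(1,2)])
    show "(\<lambda>x. \<psi> x * \<eta> x) differentiable at x" for x
      using test_smooth(1)[OF assms(1)] test_smooth(1)[OF assms(2)] by (rule differentiable_mult)
    show "continuous_on \<Omega> (pderiv_at i (\<lambda>x. \<psi> x * \<eta> x))"
      unfolding d using assms by (intro continuous_intros test_smooth)
  qed (use K in auto)
  moreover have "integrable \<mu> (\<lambda>x. \<psi> x * pderiv_at i \<eta> x)" "integrable \<mu> (\<lambda>x. pderiv_at i \<psi> x * \<eta> x)"
    using test_Lp'[OF assms(1)] test_Lp'[OF assms(2)] by (auto intro!: L2_mult_integrable)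
  ultimately show ?thesis by (simp add: d)
qed

text \<open>Test functions satisfy the identity by \<open>test_ibp\<close>, and both sides are
  pairings with a fixed \<open>L^2\<close> function, hence continuous along the approximating
  sequence.\<close>

lemma sob_weak_gradient:
  assumes "sob u g"
  shows "has_weak_gradient \<Omega> u g"
  unfolding has_weak_gradient_def
proof (intro conjI ballI allI)
  show "locally_integrable \<Omega> u" "locally_integrable \<Omega> g"
    using Lp_locally_integrable[OF sobD(1)[OF assms]] Lp_locally_integrable[OF sobD(2)[OF assms]] p_ge_2 by auto
  fix \<eta> i assume eta: "\<eta> \<in> test_functions \<Omega>"
  obtain \<psi> where psi: "\<And>k::nat. \<psi> k \<in> test_functions \<Omega>"
    "Lp_tendsto \<mu> p \<psi> u" "Lp_tendsto \<mu> p (\<lambda>k. grad (\<psi> k)) g"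
    using sobE[OF assms] by metis
  have 1: "(\<lambda>k. LINT x|\<mu>. \<psi> k x * pderiv_at i \<eta> x) \<longlonglongrightarrow> (LINT x|\<mu>. u x * pderiv_at i \<eta> x)"
    using psi sobD[OF assms] test_Lp'[OF eta] test_Lp'[OF psi(1)] p_nonneg by (intro pairing_tendsto) auto
  have 2: "(\<lambda>k. LINT x|\<mu>. grad (\<psi> k) x $ i * \<eta> x) \<longlonglongrightarrow> (LINT x|\<mu>. g x $ i * \<eta> x)"
    using sobD[OF assms] test_Lp'[OF eta] test_Lp'[OF psi(1)] p_nonneg psi(3)
    by (intro pairing_tendsto Lp_gap_component_tendsto Lp_mem_component) auto
  have "(LINT x|\<mu>. \<psi> k x * pderiv_at i \<eta> x) = - (LINT x|\<mu>. grad (\<psi> k) x $ i * \<eta> x)" for k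
    using test_ibp[OF psi(1) eta] by (simp add: grad_def)
  then have "(\<lambda>k. LINT x|\<mu>. \<psi> k x * pderiv_at i \<eta> x) \<longlonglongrightarrow> - (LINT x|\<mu>. g x $ i * \<eta> x)"
    using tendsto_minus[OF 2] by simp
  then show "(LINT x|\<mu>. u x * pderiv_at i \<eta> x) = - (LINT x|\<mu>. g x $ i * \<eta> x)"
    using LIMSEQ_unique[OF 1] by simp
qed

lemma sob_cong_AE:
  assumes "sob u g" "AE x in \<mu>. u x = u' x" "AE x in \<mu>. g x = g' x"
  shows "sob u' g'"
proof -
  obtain \<psi> where psi: "\<And>k::nat. \<psi> k \<in> test_functions \<Omega>"
    "Lp_tendsto \<mu> p \<psi> u" "Lp_tendsto \<mu> p (\<lambda>k. grad (\<psi> k)) g"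
    using sobE[OF assms(1)] by metis
  note m = sobD[OF assms(1), THEN Lp_memD(1)]
  have m': "u' \<in> borel_measurable \<mu>" "g' \<in> borel_measurable \<mu>"
    using borel_measurable_lebesgue_on_AE[OF dom_sets m(1) assms(2)]
      borel_measurable_lebesgue_on_AE[OF dom_sets m(2) assms(3)] by auto
  have "Lp_gap \<mu> p (\<psi> k) u = Lp_gap \<mu> p (\<psi> k) u'" "Lp_gap \<mu> p (grad (\<psi> k)) g = Lp_gap \<mu> p (grad (\<psi> k)) g'" for k
    using test_Lp'[OF psi(1)] m m' assms(2,3) p_nonneg
    by (auto intro!: Lp_gap_cong_AE simp: Lp_mem_def)
  then show ?thesis
    unfolding sob_def using psi Lp_mem_cong_AE[OF sobD(1)[OF assms(1)] m'(1) assms(2)]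
      Lp_mem_cong_AE[OF sobD(2)[OF assms(1)] m'(2) assms(3)] by auto
qed

lemma sob_wgrad:
  assumes "sob u g"
  shows "u \<in> W01p p \<Omega>" "AE x in \<mu>. wgrad \<Omega> u x = g x"
proof -
  have hw: "has_weak_gradient \<Omega> u g" by (rule sob_weak_gradient[OF assms])
  then have "has_weak_gradient \<Omega> u (wgrad \<Omega> u)" unfolding wgrad_def by (rule someI[of "has_weak_gradient \<Omega> u"])
  from weak_gradient_unique[OF this hw] show ae: "AE x in \<mu>. wgrad \<Omega> u x = g x" .
  have "sob u (wgrad \<Omega> u)" by (rule sob_cong_AE[OF assms]) (use ae in auto)
  then show "u \<in> W01p p \<Omega>"
    using sobD[OF assms] hw by (auto simp: W01p_def W1p_def Lp_eq sob_def Lp_gap_def)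
qed

text \<open>\<open>W1p\<close> provides some gradient in \<open>L^p\<close>, whereas
  \<open>wgrad\<close> is an unrelated choice; almost everywhere uniqueness makes the latter
  measurable and \<open>L^p\<close> as well.\<close>

lemma W01p_iff: "u \<in> W01p p \<Omega> \<longleftrightarrow> sob u (wgrad \<Omega> u)"
proof
  assume u: "u \<in> W01p p \<Omega>"
  then obtain g where g: "Lp_mem \<mu> p g" "has_weak_gradient \<Omega> u g" and uL: "Lp_mem \<mu> p u"
    by (auto simp: W01p_def W1p_def Lp_eq)
  have "has_weak_gradient \<Omega> u (wgrad \<Omega> u)" unfolding wgrad_def using g(2) by (rule someI[of "has_weak_gradient \<Omega> u"])
  from weak_gradient_unique[OF g(2) this] have ae: "AE x in \<mu>. g x = wgrad \<Omega> u x" .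
  have "Lp_mem \<mu> p (wgrad \<Omega> u)"
    by (rule Lp_mem_cong_AE[OF g(1) _ ae])
      (rule borel_measurable_lebesgue_on_AE[OF dom_sets Lp_memD(1)[OF g(1)] ae])
  then show "sob u (wgrad \<Omega> u)" using u uL by (auto simp: W01p_def sob_def Lp_gap_def)
qed (rule sob_wgrad)

lemma W01p_Lp:
  assumes "u \<in> W01p p \<Omega>"
  shows "Lp_mem \<mu> p u" "Lp_mem \<mu> p (wgrad \<Omega> u)" "Lp_mem \<mu> 2 u" "Lp_mem \<mu> 2 (wgrad \<Omega> u)"
  using assms sobD[of u "wgrad \<Omega> u"] p_ge_2 by (auto simp: W01p_iff intro: Lp_mem_lower[of p])

lemma sob_test:
  assumes "\<psi> \<in> test_functions \<Omega>"
  shows "sob \<psi> (grad \<psi>)"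
  unfolding sob_def using test_Lp'[OF assms p_nonneg] assms by (auto intro!: exI[of _ "\<lambda>_. \<psi>"])

lemma sob_lincomb:
  assumes "sob u g" "sob v h"
  shows "sob (\<lambda>x. c * u x + d * v x) (\<lambda>x. c *\<^sub>R g x + d *\<^sub>R h x)"
proof -
  obtain \<psi> where psi: "\<And>k::nat. \<psi> k \<in> test_functions \<Omega>"
    "Lp_tendsto \<mu> p \<psi> u" "Lp_tendsto \<mu> p (\<lambda>k. grad (\<psi> k)) g"
    using sobE[OF assms(1)] by metis
  obtain \<eta> where eta: "\<And>k::nat. \<eta> k \<in> test_functions \<Omega>"
    "Lp_tendsto \<mu> p \<eta> v" "Lp_tendsto \<mu> p (\<lambda>k. grad (\<eta> k)) h"
    using sobE[OF assms(2)] by metis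
  let ?\<zeta> = "\<lambda>k x. c * \<psi> k x + d * \<eta> k x"
  note L = sobD[OF assms(1)] sobD[OF assms(2)] test_Lp'[OF psi(1) p_nonneg] test_Lp'[OF eta(1) p_nonneg]
  have "Lp_tendsto \<mu> p ?\<zeta> (\<lambda>x. c * u x + d * v x)"
    using Lp_gap_lincomb_tendsto[OF _ _ _ _ p_nonneg psi(2) eta(2), of c d] L by simp
  moreover have "Lp_tendsto \<mu> p (\<lambda>k. grad (?\<zeta> k)) (\<lambda>x. c *\<^sub>R g x + d *\<^sub>R h x)"
    using Lp_gap_lincomb_tendsto[OF _ _ _ _ p_nonneg psi(3) eta(3), of c d] L
    by (simp add: test_linear(2)[OF psi(1) eta(1), abs_def])
  moreover have "Lp_mem \<mu> p (\<lambda>x. c * u x + d * v x)" "Lp_mem \<mu> p (\<lambda>x. c *\<^sub>R g x + d *\<^sub>R h x)"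
    using L p_nonneg by (auto intro!: Lp_mem_add Lp_mem_cmult Lp_mem_scaleR)
  ultimately show ?thesis unfolding sob_def using test_linear(1)[OF psi(1) eta(1)]
    by (intro conjI exI[of _ ?\<zeta>]) auto
qed

text \<open>A diagonal argument: for each \<open>n\<close> take a test function whose gaps to
  \<open>u n\<close> and \<open>g n\<close> are below \<open>1 / real (Suc n)\<close>.\<close>

lemma sob_limit:
  assumes "\<And>n. sob (u n) (g n)" "Lp_mem \<mu> p v" "Lp_mem \<mu> p h"
    and "Lp_tendsto \<mu> p u v" "Lp_tendsto \<mu> p g h"
  shows "sob v h"
proof -
  have "\<exists>\<psi>\<in>test_functions \<Omega>. Lp_gap \<mu> p \<psi> (u n) < 1 / real (Suc n) \<and> Lp_gap \<mu> p (grad \<psi>) (g n) < 1 / real (Suc n)" for n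
  proof -
    obtain \<psi> where psi: "\<And>k::nat. \<psi> k \<in> test_functions \<Omega>"
      "Lp_tendsto \<mu> p \<psi> (u n)" "Lp_tendsto \<mu> p (\<lambda>k. grad (\<psi> k)) (g n)"
      using sobE[OF assms(1)] by metis
    have "\<forall>\<^sub>F k in sequentially. Lp_gap \<mu> p (\<psi> k) (u n) < 1 / real (Suc n) \<and> Lp_gap \<mu> p (grad (\<psi> k)) (g n) < 1 / real (Suc n)"
      by (intro eventually_conj order_tendstoD(2)[OF psi(2)] order_tendstoD(2)[OF psi(3)]) auto
    then obtain k where "Lp_gap \<mu> p (\<psi> k) (u n) < 1 / real (Suc n) \<and> Lp_gap \<mu> p (grad (\<psi> k)) (g n) < 1 / real (Suc n)"
      using eventually_happens'[OF trivial_limit_sequentially] by blast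
    then show ?thesis using psi(1)[of k] by blast
  qed
  then obtain \<psi> where psi: "\<And>n. \<psi> n \<in> test_functions \<Omega>" "\<And>n. Lp_gap \<mu> p (\<psi> n) (u n) < 1 / real (Suc n)"
    "\<And>n. Lp_gap \<mu> p (grad (\<psi> n)) (g n) < 1 / real (Suc n)" by metis
  have z: "(\<lambda>n. 1 / real (Suc n)) \<longlonglongrightarrow> 0"
    using LIMSEQ_inverse_real_of_nat by (simp add: inverse_eq_divide del: of_nat_Suc)
  have z1: "(\<lambda>n. Lp_gap \<mu> p (\<psi> n) (u n)) \<longlonglongrightarrow> 0"
    by (rule tendsto_sandwich[OF _ _ tendsto_const z]) (use psi(2) in \<open>auto intro!: always_eventually less_imp_le simp del: of_nat_Suc\<close>)
  have z2: "(\<lambda>n. Lp_gap \<mu> p (grad (\<psi> n)) (g n)) \<longlonglongrightarrow> 0"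
    by (rule tendsto_sandwich[OF _ _ tendsto_const z]) (use psi(3) in \<open>auto intro!: always_eventually less_imp_le simp del: of_nat_Suc\<close>)
  have "Lp_tendsto \<mu> p \<psi> v" "Lp_tendsto \<mu> p (\<lambda>n. grad (\<psi> n)) h"
    using test_Lp'[OF psi(1) p_nonneg] sobD[OF assms(1)]
      Lp_gap_tendsto_trans[OF _ _ assms(2) p_nonneg z1 assms(4)]
      Lp_gap_tendsto_trans[OF _ _ assms(3) p_nonneg z2 assms(5)] by auto
  then show ?thesis unfolding sob_def using assms(2,3) psi(1) by (intro conjI exI[of _ \<psi>]) auto
qed

text \<open>Approximation by test functions uses the triangle inequality twice, once for the
  function and once for its gradient. Each use costs a factor \<open>T\<close>, whence the constant
  \<open>T * (C * T)\<close>.\<close>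

lemma sob_poincare: "\<exists>C>0. \<forall>u g. sob u g \<longrightarrow> (LINT x|\<mu>. \<bar>u x\<bar> powr p) \<le> C * (LINT x|\<mu>. norm (g x) powr p)"
proof -
  obtain C where C: "C > 0" "\<And>\<psi>. \<psi> \<in> test_functions \<Omega> \<Longrightarrow> (LINT x|\<mu>. \<bar>\<psi> x\<bar> powr p)
      \<le> C * (LINT x|\<mu>. norm (grad \<psi> x) powr p)"
    using poincare_test[OF open_dom bounded_dom p_ge_2] by blast
  define T where "T = 2 powr p"
  have T: "T > 0" by (simp add: T_def)
  have "(LINT x|\<mu>. \<bar>u x\<bar> powr p) \<le> (T * (C * T)) * (LINT x|\<mu>. norm (g x) powr p)" if s: "sob u g" for u g
  proof -
    obtain \<psi> where psi: "\<And>k::nat. \<psi> k \<in> test_functions \<Omega>"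
      "Lp_tendsto \<mu> p \<psi> u" "Lp_tendsto \<mu> p (\<lambda>k. grad (\<psi> k)) g"
      using sobE[OF s] by metis
    let ?N = "\<lambda>w. LINT x|\<mu>. norm (w x) powr p"
    have N0: "Lp_gap \<mu> p w (\<lambda>x. 0) = ?N w" for w :: "real^'n \<Rightarrow> 'b::euclidean_space" by (simp add: Lp_gap_def)
    note L = sobD[OF s] test_Lp'[OF psi(1) p_nonneg]
    have le: "?N u \<le> T * (Lp_gap \<mu> p (\<psi> k) u + C * (T * (Lp_gap \<mu> p (grad (\<psi> k)) g + ?N g)))" for k
    proof -
      have "?N u \<le> T * (Lp_gap \<mu> p (\<psi> k) u + ?N (\<psi> k))"
        using Lp_gap_triangle[OF L(1) L(3) Lp_mem_0 p_nonneg, of k] 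
        unfolding N0 T_def Lp_gap_commute[of \<mu> p u "\<psi> k"] by simp
      moreover have "?N (\<psi> k) \<le> C * ?N (grad (\<psi> k))" using C(2)[OF psi(1)] by simp
      moreover have "?N (grad (\<psi> k)) \<le> T * (Lp_gap \<mu> p (grad (\<psi> k)) g + ?N g)"
        using Lp_gap_triangle[OF L(4) L(2) Lp_mem_0 p_nonneg, of k] by (simp add: N0 T_def)
      ultimately show ?thesis
        using T C(1) by (meson add_left_mono mult_left_mono order_trans less_imp_le)
    qed
    have "(\<lambda>k. T * (Lp_gap \<mu> p (\<psi> k) u + C * (T * (Lp_gap \<mu> p (grad (\<psi> k)) g + ?N g))))
        \<longlonglongrightarrow> T * (0 + C * (T * (0 + ?N g)))"
      by (intro tendsto_intros psi)
    then have "?N u \<le> T * (0 + C * (T * (0 + ?N g)))"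
      by (rule LIMSEQ_le_const) (use le in auto)
    then show ?thesis by (simp add: mult.assoc)
  qed
  then show ?thesis using T C(1) by (intro exI[of _ "T * (C * T)"]) auto
qed

text \<open>Poincare's inequality on the differences makes the functions Cauchy as soon as the
  gradients are.\<close>

lemma sob_complete:
  assumes s: "\<And>n. sob (u n) (g n)"
    and cau: "\<And>e. e > 0 \<Longrightarrow> \<exists>N. \<forall>m\<ge>N. \<forall>n\<ge>N. Lp_gap \<mu> p (g m) (g n) < e"
  shows "\<exists>v h. sob v h \<and> Lp_tendsto \<mu> p u v \<and> Lp_tendsto \<mu> p g h"
proof -
  obtain C where C: "C > 0" "\<And>u g. sob u g \<Longrightarrow> (LINT x|\<mu>. \<bar>u x\<bar> powr p) \<le> C * (LINT x|\<mu>. norm (g x) powr p)"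
    using sob_poincare by blast
  have le: "Lp_gap \<mu> p (u m) (u n) \<le> C * Lp_gap \<mu> p (g m) (g n)" for m n
    using C(2)[OF sob_lincomb[OF s[of m] s[of n], of 1 "-1"]] by (simp add: Lp_gap_def)
  have "\<exists>N. \<forall>m\<ge>N. \<forall>n\<ge>N. Lp_gap \<mu> p (u m) (u n) < e" if "e > 0" for e
  proof -
    have "e / C > 0" using that C(1) by simp
    from cau[OF this] obtain N where "\<And>m n. m \<ge> N \<Longrightarrow> n \<ge> N \<Longrightarrow> Lp_gap \<mu> p (g m) (g n) < e / C"
      by blast
    then have "\<And>m n. m \<ge> N \<Longrightarrow> n \<ge> N \<Longrightarrow> C * Lp_gap \<mu> p (g m) (g n) < e"
      using C(1) by (simp add: field_simps)
    then show ?thesis using le by (meson order_le_less_trans)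
  qed
  from Riesz_Fischer[OF sobD(1)[OF s] p_pos this]
  obtain v where v: "Lp_mem \<mu> p v" "Lp_tendsto \<mu> p u v" by blast
  from Riesz_Fischer[OF sobD(2)[OF s] p_pos cau]
  obtain h where h: "Lp_mem \<mu> p h" "Lp_tendsto \<mu> p g h" by blast
  show ?thesis using sob_limit[OF s v(1) h(1) v(2) h(2)] v h by blast
qed

lemma W01p_lincomb:
  assumes "u \<in> W01p p \<Omega>" "v \<in> W01p p \<Omega>"
  shows "(\<lambda>x. c * u x + d * v x) \<in> W01p p \<Omega>"
    "AE x in \<mu>. wgrad \<Omega> (\<lambda>x. c * u x + d * v x) x = c *\<^sub>R wgrad \<Omega> u x + d *\<^sub>R wgrad \<Omega> v x"
  using sob_wgrad[OF sob_lincomb[OF assms[unfolded W01p_iff]]] by auto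

lemma W01p_test:
  assumes "\<psi> \<in> test_functions \<Omega>"
  shows "\<psi> \<in> W01p p \<Omega>" "AE x in \<mu>. wgrad \<Omega> \<psi> x = grad \<psi> x"
  using sob_wgrad[OF sob_test[OF assms]] by auto

lemma W01p_zero: "(\<lambda>x. 0) \<in> W01p p \<Omega>" "AE x in \<mu>. wgrad \<Omega> (\<lambda>x. 0) x = 0"
  using W01p_test[OF test_zero] by auto

lemma W01p_cong_AE:
  assumes "u \<in> W01p p \<Omega>" "AE x in \<mu>. u x = v x"
  shows "v \<in> W01p p \<Omega>" "AE x in \<mu>. wgrad \<Omega> v x = wgrad \<Omega> u x"
  using sob_wgrad[OF sob_cong_AE[OF assms(1)[unfolded W01p_iff] assms(2), of "wgrad \<Omega> u"]] by auto

section \<open>Common elements of closed convex families\<close>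

definition grad_energy :: "(real^'n \<Rightarrow> real) \<Rightarrow> real" where
  "grad_energy u = (LINT x|\<mu>. norm (wgrad \<Omega> u x) powr p)"

lemma W01p_poincare: "\<exists>C>0. \<forall>u\<in>W01p p \<Omega>. (LINT x|\<mu>. \<bar>u x\<bar> powr p) \<le> C * grad_energy u"
  using sob_poincare by (auto simp: W01p_iff grad_energy_def)

text \<open>This plays the part of weak compactness of bounded sets, for arbitrarily large families.
  Near-minimisers of \<open>grad_energy\<close> have Cauchy gradients by Clarkson, so they converge
  strongly and \<open>closed\<close> may speak of strong limits. It is applied twice: to
  semicontinuity of the energy and to existence.\<close>

lemma W01p_intersection:
  assumes ne: "J \<noteq> {}"
    and fin: "\<And>G. finite G \<Longrightarrow> G \<subseteq> J \<Longrightarrow> \<exists>u\<in>W01p p \<Omega>. (\<forall>j\<in>G. u \<in> C j) \<and> grad_energy u \<le> B"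
    and mid: "\<And>u v j. u \<in> W01p p \<Omega> \<Longrightarrow> v \<in> W01p p \<Omega> \<Longrightarrow> j \<in> J \<Longrightarrow> u \<in> C j \<Longrightarrow> v \<in> C j \<Longrightarrow>
        (\<lambda>x. 1/2 * u x + 1/2 * v x) \<in> C j"
    and closed: "\<And>j w u. j \<in> J \<Longrightarrow> (\<And>n::nat. w n \<in> W01p p \<Omega> \<and> w n \<in> C j) \<Longrightarrow> u \<in> W01p p \<Omega> \<Longrightarrow>
        Lp_tendsto \<mu> p w u \<Longrightarrow> Lp_tendsto \<mu> p (\<lambda>n. wgrad \<Omega> (w n)) (wgrad \<Omega> u) \<Longrightarrow> u \<in> C j"
  shows "\<exists>u\<in>W01p p \<Omega>. \<forall>j\<in>J. u \<in> C j"
proof -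
  define c where "c = 2 * (1/2) powr p"
  have c: "c > 0" by (simp add: c_def)
  let ?W = "W01p p \<Omega>"
  let ?mid = "\<lambda>u v x. 1/2 * u x + 1/2 * (v x :: real)"
  let ?D = "\<lambda>u v. c * Lp_gap \<mu> p (wgrad \<Omega> u) (wgrad \<Omega> v)"
  have "\<exists>u::nat \<Rightarrow> real^'n \<Rightarrow> real. (\<forall>n. u n \<in> ?W) \<and> (\<forall>e>0. \<exists>K. \<forall>m\<ge>K. \<forall>n\<ge>K. ?D (u m) (u n) < e) \<and>
    (\<forall>j\<in>J. \<exists>u'::nat \<Rightarrow> real^'n \<Rightarrow> real. \<forall>n. u' n \<in> ?W \<and> u' n \<in> C j \<and> ?D (u' n) (u n) \<le> 4 / real (Suc n))"
  proof (rule directed_near_minimizers[where mid = ?mid and N = grad_energy])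
    show "\<exists>u\<in>?W. (\<forall>j\<in>G. u \<in> C j) \<and> grad_energy u \<le> B" if "finite G" "G \<subseteq> J" for G using fin[OF that] .
    show "grad_energy u \<ge> 0" for u by (simp add: grad_energy_def)
    show "?mid u v \<in> ?W" if "u \<in> ?W" "v \<in> ?W" for u v using W01p_lincomb(1)[OF that] .
    show "?mid u v \<in> C j" if "u \<in> ?W" "v \<in> ?W" "j \<in> J" "u \<in> C j" "v \<in> C j" for u v j using mid[OF that] .
    show "?D u v + 2 * grad_energy (?mid u v) \<le> grad_energy u + grad_energy v" if uv: "u \<in> ?W" "v \<in> ?W" for u v
    proof -
      note m = W01p_Lp(2)[OF uv(1)] W01p_Lp(2)[OF uv(2)] W01p_Lp(2)[OF W01p_lincomb(1)[OF uv, of "1/2" "1/2"]]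
      have "grad_energy (?mid u v) = (LINT x|\<mu>. norm ((1/2) *\<^sub>R wgrad \<Omega> u x + (1/2) *\<^sub>R wgrad \<Omega> v x) powr p)"
        unfolding grad_energy_def
      proof (rule integral_cong_AE)
        show "AE x in \<mu>. norm (wgrad \<Omega> (?mid u v) x) powr p = norm ((1/2) *\<^sub>R wgrad \<Omega> u x + (1/2) *\<^sub>R wgrad \<Omega> v x) powr p"
          using W01p_lincomb(2)[OF uv, of "1/2" "1/2"] by eventually_elim (simp only:)
      qed (use m[THEN Lp_memD(1)] in measurable)
      then show ?thesis
        using clarkson_integral[OF m(1,2) p_ge_2] unfolding grad_energy_def c_def by linarith
    qed
  qed
  then obtain u where u: "\<And>n::nat. u n \<in> ?W" "\<And>e. e > 0 \<Longrightarrow> \<exists>K. \<forall>m\<ge>K. \<forall>n\<ge>K. ?D (u m) (u n) < e"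
    and u': "\<And>j. j \<in> J \<Longrightarrow> \<exists>u'::nat \<Rightarrow> real^'n \<Rightarrow> real. \<forall>n. u' n \<in> ?W \<and> u' n \<in> C j \<and> ?D (u' n) (u n) \<le> 4 / real (Suc n)"
    by blast
  have "\<exists>K. \<forall>m\<ge>K. \<forall>n\<ge>K. Lp_gap \<mu> p (wgrad \<Omega> (u m)) (wgrad \<Omega> (u n)) < e" if "e > 0" for e
  proof -
    have "\<exists>K. \<forall>m\<ge>K. \<forall>n\<ge>K. ?D (u m) (u n) < c * e" using u(2)[of "c * e"] that c by simp
    then show ?thesis using c by simp
  qed
  from sob_complete[OF u(1)[unfolded W01p_iff] this]
  obtain v h where vh: "sob v h" "Lp_tendsto \<mu> p u v" "Lp_tendsto \<mu> p (\<lambda>n. wgrad \<Omega> (u n)) h"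
    by blast
  obtain P where P: "P > 0" "\<And>u g. sob u g \<Longrightarrow> (LINT x|\<mu>. \<bar>u x\<bar> powr p) \<le> P * (LINT x|\<mu>. norm (g x) powr p)"
    using sob_poincare by blast
  have v: "v \<in> ?W" and ae: "AE x in \<mu>. wgrad \<Omega> v x = h x" using sob_wgrad[OF vh(1)] by auto
  have "v \<in> C j" if j: "j \<in> J" for j
  proof -
    \<comment> \<open>\<open>u n\<close> itself need not lie in \<open>C j\<close>. The companion
      sequence \<open>w\<close> does, and its gradients approach those of \<open>u n\<close>, so it
      shares the limit \<open>v\<close>.\<close>
    obtain w where w: "\<And>n::nat. w n \<in> ?W" "\<And>n. w n \<in> C j" "\<And>n. ?D (w n) (u n) \<le> 4 / real (Suc n)"
      using u'[OF j] by blast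
    have lim: "(\<lambda>n. (4 / c) * (1 / real (Suc n))) \<longlonglongrightarrow> 0"
      using tendsto_mult_left[OF LIMSEQ_inverse_real_of_nat, of "4 / c"]
      by (simp add: inverse_eq_divide del: of_nat_Suc)
    have le: "Lp_gap \<mu> p (wgrad \<Omega> (w n)) (wgrad \<Omega> (u n)) \<le> (4 / c) * (1 / real (Suc n))" for n
    proof -
      have "Lp_gap \<mu> p (wgrad \<Omega> (w n)) (wgrad \<Omega> (u n)) \<le> (4 / real (Suc n)) / c"
        using w(3)[of n] by (simp only: pos_le_divide_eq[OF c] mult.commute[of _ c])
      then show ?thesis by (simp add: mult.commute)
    qed
    have g0: "(\<lambda>n. Lp_gap \<mu> p (wgrad \<Omega> (w n)) (wgrad \<Omega> (u n))) \<longlonglongrightarrow> 0"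
      by (rule tendsto_0_bound[OF Lp_gap_nonneg le lim])
    have le2: "Lp_gap \<mu> p (w n) (u n) \<le> P * Lp_gap \<mu> p (wgrad \<Omega> (w n)) (wgrad \<Omega> (u n))" for n
      using P(2)[OF sob_lincomb[OF w(1)[of n, unfolded W01p_iff] u(1)[of n, unfolded W01p_iff], of 1 "-1"]]
      by (simp add: Lp_gap_def)
    have f0: "(\<lambda>n. Lp_gap \<mu> p (w n) (u n)) \<longlonglongrightarrow> 0"
      by (rule tendsto_0_bound[OF Lp_gap_nonneg le2]) (use tendsto_mult_left[OF g0, of P] in simp)
    have 1: "Lp_tendsto \<mu> p w v"
      by (rule Lp_gap_tendsto_trans[OF _ _ _ p_nonneg f0 vh(2)]) (use W01p_Lp(1) w(1) u(1) v in auto)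
    have 2: "Lp_tendsto \<mu> p (\<lambda>n. wgrad \<Omega> (w n)) h"
      by (rule Lp_gap_tendsto_trans[OF _ _ _ p_nonneg g0 vh(3)]) (use W01p_Lp(2) w(1) u(1) sobD(2)[OF vh(1)] in auto)
    have "Lp_gap \<mu> p (wgrad \<Omega> (w n)) h = Lp_gap \<mu> p (wgrad \<Omega> (w n)) (wgrad \<Omega> v)" for n
      by (rule Lp_gap_cong_AE) (use W01p_Lp(2)[OF w(1)] W01p_Lp(2)[OF v] sobD(2)[OF vh(1)] ae in \<open>auto simp: Lp_mem_def elim: eventually_mono\<close>)
    then show ?thesis using closed[OF j _ v 1] w 2 by simp
  qed
  then show ?thesis using v by blast
qed

end

context sobolev_setting
begin

lemma integrable_locally_integrable:
  fixes u :: "real^'n \<Rightarrow> 'b::euclidean_space"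
  assumes "integrable \<mu> u"
  shows "locally_integrable \<Omega> u"
  using assms by (intro Lp_locally_integrable[of 1]) (auto simp: Lp_mem_def)

text \<open>Pairing \<open>w n - u\<close> with \<open>v - u\<close> tends to \<open>?S\<close> and
  is at most \<open>(?S + d) / 2\<close> by the inequality between products and squares, so
  \<open>?S \<le> d\<close>. This keeps the bound free of the factor in
  \<open>Lp_gap_triangle\<close>.\<close>

lemma L2_dist_closed:
  fixes w :: "nat \<Rightarrow> real^'n \<Rightarrow> real"
  assumes w: "\<And>n. Lp_mem \<mu> 2 (w n)" and v: "Lp_mem \<mu> 2 v" and u: "Lp_mem \<mu> 2 u"
    and lim: "Lp_tendsto \<mu> 2 w v" and le: "\<And>n. Lp_gap \<mu> 2 (w n) u \<le> d"
  shows "Lp_gap \<mu> 2 v u \<le> d"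
proof -
  let ?S = "Lp_gap \<mu> 2 v u"
  have vu: "Lp_mem \<mu> 2 (\<lambda>x. v x - u x)" and wu: "\<And>n. Lp_mem \<mu> 2 (\<lambda>x. w n x - u x)"
    using u v w by (auto intro: Lp_mem_diff)
  have "(\<lambda>n. LINT x|\<mu>. w n x * (v x - u x)) \<longlonglongrightarrow> (LINT x|\<mu>. v x * (v x - u x))"
    by (rule L2_pairing_tendsto[OF w v vu lim])
  then have "(\<lambda>n. (LINT x|\<mu>. w n x * (v x - u x)) - (LINT x|\<mu>. u x * (v x - u x)))
      \<longlonglongrightarrow> (LINT x|\<mu>. v x * (v x - u x)) - (LINT x|\<mu>. u x * (v x - u x))"
    by (intro tendsto_intros)
  moreover have "(LINT x|\<mu>. w n x * (v x - u x)) - (LINT x|\<mu>. u x * (v x - u x))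
      = (LINT x|\<mu>. (w n x - u x) * (v x - u x))" for n
    using L2_mult_integrable[OF w vu] L2_mult_integrable[OF u vu] by (simp add: left_diff_distrib)
  moreover have "(LINT x|\<mu>. v x * (v x - u x)) - (LINT x|\<mu>. u x * (v x - u x)) = ?S"
    using L2_mult_integrable[OF v vu] L2_mult_integrable[OF u vu]
    by (simp add: Lp_gap_2 left_diff_distrib power2_eq_square)
  ultimately have lim2: "(\<lambda>n. LINT x|\<mu>. (w n x - u x) * (v x - u x)) \<longlonglongrightarrow> ?S" by simp
  have "(LINT x|\<mu>. (w n x - u x) * (v x - u x)) \<le> (?S + d) / 2" for n
  proof -
    have "(LINT x|\<mu>. (w n x - u x) * (v x - u x)) \<le> (LINT x|\<mu>. ((w n x - u x)\<^sup>2 + (v x - u x)\<^sup>2) / 2)"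
    proof (rule integral_mono)
      show "integrable \<mu> (\<lambda>x. (w n x - u x) * (v x - u x))" using wu vu by (rule L2_mult_integrable)
      show "integrable \<mu> (\<lambda>x. ((w n x - u x)\<^sup>2 + (v x - u x)\<^sup>2) / 2)"
        using wu[of n] vu by (auto simp: Lp_mem_def)
      show "(w n x - u x) * (v x - u x) \<le> ((w n x - u x)\<^sup>2 + (v x - u x)\<^sup>2) / 2" for x
      proof -
        have "s * t \<le> (s\<^sup>2 + t\<^sup>2) / 2" for s t :: real using sum_squares_bound[of s t] by simp
        then show ?thesis .
      qed
    qed
    also have "\<dots> = (Lp_gap \<mu> 2 (w n) u + ?S) / 2"
      using wu[of n] vu by (auto simp: Lp_mem_def Lp_gap_2)
    also have "\<dots> \<le> (?S + d) / 2" using le[of n] by simp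
    finally show ?thesis .
  qed
  then have "?S \<le> (?S + d) / 2" by (intro LIMSEQ_le_const2[OF lim2]) auto
  then show ?thesis by simp
qed

end

section \<open>The transport operator\<close>

locale dirichlet_setting = sobolev_setting \<Omega> p for \<Omega> :: "(real^'n::finite) set" and p +
  fixes m :: real and a :: "real^'n \<Rightarrow> real^'n" and a0 f :: "real^'n \<Rightarrow> real"
  assumes m_gt_1: "m > 1" and a_smooth: "smooth_vector_field_on_closure \<Omega> a"
    and f_L2: "f \<in> L2 \<Omega>" and a0_bounded: "a0 \<in> Linfty \<Omega>"
    and nonneg: "AE x in lebesgue_on \<Omega>. 1/2 * (divergence a x + a0 x) \<ge> 0"
begin

lemma f_mem: "Lp_mem \<mu> 2 f" using f_L2 by (simp add: Lp_eq)

lemma a_smooth_on: "smooth_on \<Omega> (\<lambda>x. a x $ j)"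
  and a_extends: "\<exists>g. continuous_on (closure \<Omega>) g \<and> (\<forall>x\<in>\<Omega>. g x = iter_pderiv is (\<lambda>x. a x $ j) x)"
  using a_smooth by (auto simp: smooth_vector_field_on_closure_def smooth_on_closure_def)

lemma a_diff: "x \<in> \<Omega> \<Longrightarrow> (\<lambda>x. a x $ j) differentiable at x"
  using a_smooth_on[of j, unfolded smooth_on_def, THEN spec, of "[]"]
    differentiable_on_eq_differentiable_at[OF open_dom] by auto

lemma a_cont: "continuous_on \<Omega> (\<lambda>x. a x $ j)" "continuous_on \<Omega> (pderiv_at i (\<lambda>x. a x $ j))"
  using a_smooth_on[of j, unfolded smooth_on_def, THEN spec, of "[]"]
    a_smooth_on[of j, unfolded smooth_on_def, THEN spec, of "[i]"]
  by (auto dest: differentiable_imp_continuous_on)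

lemma a_bounded: "\<exists>C. \<forall>x\<in>\<Omega>. \<bar>iter_pderiv is (\<lambda>x. a x $ j) x\<bar> \<le> C"
proof -
  obtain g where g: "continuous_on (closure \<Omega>) g" "\<And>x. x \<in> \<Omega> \<Longrightarrow> g x = iter_pderiv is (\<lambda>x. a x $ j) x"
    using a_extends by blast
  have "compact (closure \<Omega>)" using bounded_dom by (simp add: compact_closure)
  then have "bounded (g ` closure \<Omega>)" using g(1) by (intro compact_imp_bounded compact_continuous_image)
  then obtain C where C: "\<And>x. x \<in> closure \<Omega> \<Longrightarrow> \<bar>g x\<bar> \<le> C" by (auto simp: bounded_iff)
  have "\<bar>iter_pderiv is (\<lambda>x. a x $ j) x\<bar> \<le> C" if "x \<in> \<Omega>" for x
    using C[of x] g(2)[OF that] closure_subset that by auto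
  then show ?thesis by blast
qed

lemma a_bounded_AE: "\<exists>C. AE x in \<mu>. \<bar>iter_pderiv is (\<lambda>x. a x $ j) x\<bar> \<le> C"
proof -
  obtain C where "\<And>x. x \<in> \<Omega> \<Longrightarrow> \<bar>iter_pderiv is (\<lambda>x. a x $ j) x\<bar> \<le> C"
    using a_bounded by blast
  then show ?thesis by (intro exI[of _ C] AE_I2) simp
qed

lemma cont_measurable: "continuous_on \<Omega> h \<Longrightarrow> h \<in> borel_measurable \<mu>" for h :: "real^'n \<Rightarrow> 'b::euclidean_space"
  using continuous_imp_measurable_on_sets_lebesgue dom_sets by blast

lemma a_comp_facts: "(\<lambda>x. a x $ j) \<in> borel_measurable \<mu>" "\<exists>C. AE x in \<mu>. \<bar>a x $ j\<bar> \<le> C"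
  using cont_measurable[OF a_cont(1)] a_bounded_AE[of "[]" j] by auto

lemma div_facts: "continuous_on \<Omega> (divergence a)" "divergence a \<in> borel_measurable \<mu>"
  "\<exists>C. AE x in \<mu>. \<bar>divergence a x\<bar> \<le> C"
proof -
  show c: "continuous_on \<Omega> (divergence a)"
    unfolding divergence_def[abs_def] by (intro continuous_intros a_cont)
  show "divergence a \<in> borel_measurable \<mu>" using cont_measurable[OF c] .
  have "\<exists>C. \<forall>j. \<forall>x\<in>\<Omega>. \<bar>pderiv_at j (\<lambda>x. a x $ j) x\<bar> \<le> C j"
    using a_bounded[of "[_]"] by (intro choice allI) simp
  then obtain C where C: "\<And>j x. x \<in> \<Omega> \<Longrightarrow> \<bar>pderiv_at j (\<lambda>x. a x $ j) x\<bar> \<le> C j" by blast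
  have "\<bar>divergence a x\<bar> \<le> (\<Sum>j\<in>UNIV. C j)" if "x \<in> \<Omega>" for x
    unfolding divergence_def using C[OF that] by (intro order_trans[OF sum_abs] sum_mono) simp
  then show "\<exists>C. AE x in \<mu>. \<bar>divergence a x\<bar> \<le> C" by (intro exI AE_I2) auto
qed

lemma a_mult_L2:
  fixes h :: "real^'n \<Rightarrow> real"
  assumes "Lp_mem \<mu> 2 h"
  shows "Lp_mem \<mu> 2 (\<lambda>x. a x $ j * h x)" "Lp_mem \<mu> 2 (\<lambda>x. 1/2 * divergence a x * h x)"
proof -
  obtain C where "AE x in \<mu>. \<bar>a x $ j\<bar> \<le> C" using a_comp_facts by blast
  from Lp_mem_bounded_mult[OF assms a_comp_facts(1) this] show "Lp_mem \<mu> 2 (\<lambda>x. a x $ j * h x)" by simp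
  obtain C where "AE x in \<mu>. \<bar>divergence a x\<bar> \<le> C" using div_facts by blast
  from Lp_mem_cmult[OF Lp_mem_bounded_mult[OF assms div_facts(2) this], of "1/2"]
  show "Lp_mem \<mu> 2 (\<lambda>x. 1/2 * divergence a x * h x)" by (simp add: mult.assoc)
qed

text \<open>With the gradient as an argument, the expression applies alike to test functions with
  their classical gradients and to Sobolev functions with any representative.\<close>

definition T :: "(real^'n \<Rightarrow> real) \<Rightarrow> (real^'n \<Rightarrow> real^'n) \<Rightarrow> real^'n \<Rightarrow> real" where
  "T u g x = a x \<bullet> g x + 1/2 * divergence a x * u x"

lemma T_L2:
  assumes "Lp_mem \<mu> 2 u" "Lp_mem \<mu> 2 g"
  shows "Lp_mem \<mu> 2 (\<lambda>x. a x \<bullet> g x)" "Lp_mem \<mu> 2 (T u g)"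
proof -
  have "Lp_mem \<mu> 2 (\<lambda>x. \<Sum>j\<in>I. a x $ j * g x $ j)" if "finite I" for I
    using that
  proof (induction I)
    case (insert j I)
    have "Lp_mem \<mu> 2 (\<lambda>x. a x $ j * g x $ j)"
      by (rule a_mult_L2(1)[OF Lp_mem_component[OF assms(2)]]) simp
    then show ?case using insert by (auto intro!: Lp_mem_add)
  qed simp
  then show 1: "Lp_mem \<mu> 2 (\<lambda>x. a x \<bullet> g x)" by (simp add: inner_vec_def)
  show "Lp_mem \<mu> 2 (T u g)"
    unfolding T_def[abs_def] by (intro Lp_mem_add 1 a_mult_L2 assms) simp
qed

text \<open>The coefficients are moved onto \<open>h\<close>, so that each term pairs
  \<open>u\<close> or a component of \<open>g\<close> with a fixed \<open>L^2\<close> function and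
  passes to limits.\<close>

lemma T_pairing_expand:
  assumes "Lp_mem \<mu> 2 u" "Lp_mem \<mu> 2 g" "Lp_mem \<mu> 2 h"
  shows "(LINT x|\<mu>. T u g x * h x)
    = (\<Sum>j\<in>UNIV. LINT x|\<mu>. g x $ j * (a x $ j * h x)) + (LINT x|\<mu>. u x * (1/2 * divergence a x * h x))"
proof -
  have i1: "integrable \<mu> (\<lambda>x. g x $ j * (a x $ j * h x))" for j
    using Lp_mem_component[OF assms(2)] by (intro L2_mult_integrable a_mult_L2 assms(3)) simp
  have i2: "integrable \<mu> (\<lambda>x. u x * (1/2 * divergence a x * h x))"
    using assms by (intro L2_mult_integrable a_mult_L2)
  have "(LINT x|\<mu>. T u g x * h x)
     = (LINT x|\<mu>. (\<Sum>j\<in>UNIV. g x $ j * (a x $ j * h x)) + u x * (1/2 * divergence a x * h x))"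
    by (intro Bochner_Integration.integral_cong refl)
      (simp add: T_def inner_vec_def sum_distrib_right sum_distrib_left algebra_simps)
  also have "\<dots> = (\<Sum>j\<in>UNIV. LINT x|\<mu>. g x $ j * (a x $ j * h x)) + (LINT x|\<mu>. u x * (1/2 * divergence a x * h x))"
    using i1 i2 by (subst Bochner_Integration.integral_add) auto
  finally show ?thesis .
qed

lemma T_pairing_tendsto:
  assumes psi: "\<And>k::nat. \<psi> k \<in> test_functions \<Omega>"
    "Lp_tendsto \<mu> p \<psi> u" "Lp_tendsto \<mu> p (\<lambda>k. grad (\<psi> k)) g"
    and s: "sob u g" and h: "Lp_mem \<mu> 2 h"
  shows "(\<lambda>k. LINT x|\<mu>. T (\<psi> k) (grad (\<psi> k)) x * h x) \<longlonglongrightarrow> (LINT x|\<mu>. T u g x * h x)"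
proof -
  note L = sobD[OF s] test_Lp'[OF psi(1) p_nonneg]
  have L2: "Lp_mem \<mu> 2 u" "Lp_mem \<mu> 2 g" using L p_ge_2 by (auto intro: Lp_mem_lower[of p])
  have tL2: "Lp_mem \<mu> 2 (\<psi> k)" "Lp_mem \<mu> 2 (grad (\<psi> k))" for k using test_Lp'[OF psi(1)] by auto
  have 1: "(\<lambda>k. LINT x|\<mu>. grad (\<psi> k) x $ j * (a x $ j * h x)) \<longlonglongrightarrow> (LINT x|\<mu>. g x $ j * (a x $ j * h x))" for j
    by (intro pairing_tendsto Lp_gap_component_tendsto Lp_mem_component a_mult_L2 h L psi p_nonneg)
  have 2: "(\<lambda>k. LINT x|\<mu>. \<psi> k x * (1/2 * divergence a x * h x)) \<longlonglongrightarrow> (LINT x|\<mu>. u x * (1/2 * divergence a x * h x))"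
    by (intro pairing_tendsto a_mult_L2 h L psi)
  show ?thesis
    unfolding T_pairing_expand[OF L2 h] T_pairing_expand[OF tL2 h] by (intro tendsto_intros 1 2)
qed

text \<open>The two integrands add up to the divergence of \<open>\<psi> \<eta> a\<close>, a field
  with compact support in \<Omega>, whose integral vanishes. The coefficient 1/2 in \<open>T\<close>
  is what makes the two zero-order terms amount to one full divergence.\<close>

lemma T_antisym_test:
  assumes "\<psi> \<in> test_functions \<Omega>" "\<eta> \<in> test_functions \<Omega>"
  shows "(LINT x|\<mu>. T \<psi> (grad \<psi>) x * \<eta> x) + (LINT x|\<mu>. T \<eta> (grad \<eta>) x * \<psi> x) = 0"
proof -
  obtain K where K: "compact K" "K \<subseteq> \<Omega>" "\<And>x. x \<notin> K \<Longrightarrow> \<psi> x = 0" using test_support[OF assms(1)] by metis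
  let ?G = "\<lambda>j x. (\<psi> x * \<eta> x) * a x $ j"
  note t = test_smooth[OF assms(1)] test_smooth[OF assms(2)]
  have dpe: "(\<lambda>x. \<psi> x * \<eta> x) differentiable at x" for x using t by (intro differentiable_mult)
  have d: "?G j differentiable at x" "pderiv_at j (?G j) x = (\<psi> x * \<eta> x) * pderiv_at j (\<lambda>x. a x $ j) x
      + (\<psi> x * pderiv_at j \<eta> x + pderiv_at j \<psi> x * \<eta> x) * a x $ j" if "x \<in> \<Omega>" for x j
    using differentiable_mult[OF dpe a_diff[OF that]] pderiv_at_mult[OF dpe a_diff[OF that]]
      pderiv_at_mult[OF t(1,6)] by auto
  have zero: "(LINT x|\<mu>. pderiv_at j (?G j) x) = 0" for j
  proof (rule integral_pderiv_zero_on[OF open_dom d(1) _ K(1,2)])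
    have "continuous_on \<Omega> (\<lambda>x. (\<psi> x * \<eta> x) * pderiv_at j (\<lambda>x. a x $ j) x
      + (\<psi> x * pderiv_at j \<eta> x + pderiv_at j \<psi> x * \<eta> x) * a x $ j)"
      by (intro continuous_intros t a_cont)
    then show "continuous_on \<Omega> (pderiv_at j (?G j))"
      by (rule continuous_on_eq) (simp add: d(2))
  qed (use K in auto)
  have L: "Lp_mem \<mu> 2 \<psi>" "Lp_mem \<mu> 2 \<eta>" "Lp_mem \<mu> 2 (grad \<psi>)" "Lp_mem \<mu> 2 (grad \<eta>)"
    using test_Lp'[OF assms(1)] test_Lp'[OF assms(2)] by auto
  have int: "integrable \<mu> (\<lambda>x. T \<psi> (grad \<psi>) x * \<eta> x)" "integrable \<mu> (\<lambda>x. T \<eta> (grad \<eta>) x * \<psi> x)"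
    using L by (auto intro!: L2_mult_integrable T_L2)
  have int': "integrable \<mu> (pderiv_at j (?G j))" for j
  proof -
    obtain C where C: "AE x in \<mu>. \<bar>pderiv_at j (\<lambda>x. a x $ j) x\<bar> \<le> C"
      using a_bounded_AE[of "[j]" j] by auto
    have m: "pderiv_at j (\<lambda>x. a x $ j) \<in> borel_measurable \<mu>" using cont_measurable[OF a_cont(2)] .
    have "Lp_mem \<mu> 2 (\<lambda>x. pderiv_at j (\<lambda>x. a x $ j) x * \<eta> x)"
      using Lp_mem_bounded_mult[OF L(2) m C] by simp
    then have "integrable \<mu> (\<lambda>x. \<psi> x * (pderiv_at j (\<lambda>x. a x $ j) x * \<eta> x)
        + (\<psi> x * (a x $ j * pderiv_at j \<eta> x) + (a x $ j * pderiv_at j \<psi> x) * \<eta> x))"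
      using L test_Lp'(3)[OF assms(1), of 2 j] test_Lp'(3)[OF assms(2), of 2 j]
      by (intro Bochner_Integration.integrable_add L2_mult_integrable a_mult_L2) auto
    then show ?thesis
      by (rule Bochner_Integration.integrable_cong[OF refl, THEN iffD1, rotated]) (subst d(2), simp, simp add: algebra_simps)
  qed
  have "(LINT x|\<mu>. T \<psi> (grad \<psi>) x * \<eta> x) + (LINT x|\<mu>. T \<eta> (grad \<eta>) x * \<psi> x)
      = (LINT x|\<mu>. T \<psi> (grad \<psi>) x * \<eta> x + T \<eta> (grad \<eta>) x * \<psi> x)"
    using int by simp
  also have "\<dots> = (LINT x|\<mu>. (\<Sum>j\<in>UNIV. pderiv_at j (?G j) x))"
  proof (rule Bochner_Integration.integral_cong[OF refl])
    fix x assume "x \<in> space \<mu>"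
    then have x: "x \<in> \<Omega>" by simp
    have "(\<Sum>j\<in>UNIV. pderiv_at j (?G j) x) = (\<psi> x * \<eta> x) * divergence a x
        + (\<Sum>j\<in>UNIV. (\<psi> x * pderiv_at j \<eta> x + pderiv_at j \<psi> x * \<eta> x) * a x $ j)"
      by (simp add: d(2)[OF x] sum.distrib sum_distrib_left divergence_def)
    also have "(\<Sum>j\<in>UNIV. (\<psi> x * pderiv_at j \<eta> x + pderiv_at j \<psi> x * \<eta> x) * a x $ j)
        = \<psi> x * (a x \<bullet> grad \<eta> x) + \<eta> x * (a x \<bullet> grad \<psi> x)"
      by (simp add: inner_vec_def grad_def sum_distrib_left algebra_simps sum.distrib)
    finally show "T \<psi> (grad \<psi>) x * \<eta> x + T \<eta> (grad \<eta>) x * \<psi> x = (\<Sum>j\<in>UNIV. pderiv_at j (?G j) x)"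
      by (simp add: T_def algebra_simps)
  qed
  also have "\<dots> = 0" using int' zero by simp
  finally show ?thesis .
qed

text \<open>Two limits in succession: first \<open>u\<close> is approximated against a fixed test
  function, then \<open>v\<close> against the fixed \<open>u\<close>. Each limit thus involves
  pairings with a fixed \<open>L^2\<close> function only.\<close>

lemma T_antisym:
  assumes "sob u g" "sob v h"
  shows "(LINT x|\<mu>. T u g x * v x) = - (LINT x|\<mu>. T v h x * u x)"
proof -
  have L2: "Lp_mem \<mu> 2 u" "Lp_mem \<mu> 2 g" "Lp_mem \<mu> 2 v" "Lp_mem \<mu> 2 h"
    using sobD[OF assms(1)] sobD[OF assms(2)] p_ge_2 by (auto intro: Lp_mem_lower[of p])
  have 1: "(LINT x|\<mu>. T u g x * \<eta> x) + (LINT x|\<mu>. T \<eta> (grad \<eta>) x * u x) = 0" if eta: "\<eta> \<in> test_functions \<Omega>" for \<eta>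
  proof -
    obtain \<psi> where psi: "\<And>k::nat. \<psi> k \<in> test_functions \<Omega>"
      "Lp_tendsto \<mu> p \<psi> u" "Lp_tendsto \<mu> p (\<lambda>k. grad (\<psi> k)) g"
      using sobE[OF assms(1)] by metis
    have t: "Lp_mem \<mu> 2 \<eta>" "Lp_mem \<mu> 2 (T \<eta> (grad \<eta>))" using test_Lp'[OF eta] by (auto intro: T_L2)
    have "(\<lambda>k. LINT x|\<mu>. \<psi> k x * T \<eta> (grad \<eta>) x) \<longlonglongrightarrow> (LINT x|\<mu>. u x * T \<eta> (grad \<eta>) x)"
      using test_Lp'[OF psi(1) p_nonneg] sobD[OF assms(1)] t psi by (intro pairing_tendsto) auto
    from tendsto_add[OF T_pairing_tendsto[OF psi assms(1) t(1)] this]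
    have "(\<lambda>k. 0) \<longlonglongrightarrow> (LINT x|\<mu>. T u g x * \<eta> x) + (LINT x|\<mu>. u x * T \<eta> (grad \<eta>) x)"
      using T_antisym_test[OF psi(1) eta] by (simp add: mult.commute)
    then show ?thesis by (simp add: LIMSEQ_const_iff mult.commute)
  qed
  obtain \<eta> where eta: "\<And>k::nat. \<eta> k \<in> test_functions \<Omega>"
    "Lp_tendsto \<mu> p \<eta> v" "Lp_tendsto \<mu> p (\<lambda>k. grad (\<eta> k)) h"
    using sobE[OF assms(2)] by metis
  have "(\<lambda>k. LINT x|\<mu>. \<eta> k x * T u g x) \<longlonglongrightarrow> (LINT x|\<mu>. v x * T u g x)"
    using test_Lp'[OF eta(1) p_nonneg] sobD[OF assms(2)] T_L2(2)[OF L2(1,2)] eta by (intro pairing_tendsto) auto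
  from tendsto_add[OF this T_pairing_tendsto[OF eta assms(2) L2(1)]]
  have "(\<lambda>k. 0) \<longlonglongrightarrow> (LINT x|\<mu>. v x * T u g x) + (LINT x|\<mu>. T v h x * u x)"
    using 1[OF eta(1)] by (simp add: mult.commute)
  then show ?thesis by (simp add: LIMSEQ_const_iff mult.commute)
qed

abbreviation "W \<equiv> W01p p \<Omega>"

definition A :: "(real^'n \<Rightarrow> real) \<Rightarrow> real^'n \<Rightarrow> real" where
  "A u = T u (wgrad \<Omega> u)"

lemma A_L2: "u \<in> W \<Longrightarrow> Lp_mem \<mu> 2 (A u)"
  unfolding A_def using W01p_Lp by (intro T_L2)

lemma A_antisym:
  assumes "u \<in> W" "v \<in> W"
  shows "(LINT x|\<mu>. v x * A u x) = - (LINT x|\<mu>. u x * A v x)"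
  using T_antisym[of u "wgrad \<Omega> u" v "wgrad \<Omega> v"] assms by (simp add: W01p_iff A_def mult.commute)

lemma A_self:
  assumes "u \<in> W" shows "(LINT x|\<mu>. u x * A u x) = 0"
  using A_antisym[OF assms assms] by simp

text \<open>Inside \<Omega> the divergence of \<open>\<psi> a\<close> is
  \<open>T \<psi> (grad \<psi>)\<close> plus half of \<open>divergence a * \<psi>\<close>. The
  second part cancels the zero-order term of the relation, and what remains is antisymmetry against
  \<psi>.\<close>

lemma transport_rel_A:
  assumes u: "u \<in> W"
  shows "transport_rel \<Omega> a u (A u)"
  unfolding transport_rel_def
proof (intro conjI ballI)
  show "u \<in> L2 \<Omega>" "A u \<in> L2 \<Omega>" using W01p_Lp[OF u] A_L2[OF u] by (auto simp: Lp_eq)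
  fix \<psi> assume psi: "\<psi> \<in> test_functions \<Omega>"
  note L2 = W01p_Lp(3)[OF u]
  have t: "Lp_mem \<mu> 2 \<psi>" "Lp_mem \<mu> 2 (grad \<psi>)" using test_Lp'[OF psi] by auto
  have i1: "integrable \<mu> (\<lambda>x. T \<psi> (grad \<psi>) x * u x)" using T_L2(2)[OF t] L2 by (rule L2_mult_integrable)
  have i2: "integrable \<mu> (\<lambda>x. (1/2 * divergence a x * u x) * \<psi> x)"
    by (intro L2_mult_integrable a_mult_L2 L2 t)
  have dv: "divergence (\<lambda>y. \<psi> y *\<^sub>R a y) x = a x \<bullet> grad \<psi> x + \<psi> x * divergence a x" if "x \<in> \<Omega>" for x
    using pderiv_at_mult[OF test_smooth(1)[OF psi] a_diff[OF that]]
    by (simp add: divergence_def inner_vec_def grad_def sum.distrib sum_distrib_left algebra_simps)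
  have "(LINT x|\<mu>. u x * divergence (\<lambda>y. \<psi> y *\<^sub>R a y) x)
      = (LINT x|\<mu>. T \<psi> (grad \<psi>) x * u x + (1/2 * divergence a x * u x) * \<psi> x)"
    by (intro Bochner_Integration.integral_cong refl) (simp add: dv T_def algebra_simps)
  also have "\<dots> = (LINT x|\<mu>. T \<psi> (grad \<psi>) x * u x) + (LINT x|\<mu>. 1/2 * divergence a x * u x * \<psi> x)"
    using i1 i2 by simp
  also have "(LINT x|\<mu>. T \<psi> (grad \<psi>) x * u x) = - (LINT x|\<mu>. A u x * \<psi> x)"
    unfolding A_def using T_antisym[OF sob_test[OF psi] u[unfolded W01p_iff]] .
  finally show "- (LINT x|\<mu>. u x * divergence (\<lambda>y. \<psi> y *\<^sub>R a y) x) + (LINT x|\<mu>. 1/2 * divergence a x * u x * \<psi> x)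
     = (LINT x|\<mu>. A u x * \<psi> x)" by simp
qed

text \<open>\<open>transport\<close> selects some function satisfying the relation; by the
  fundamental lemma the relation determines it almost everywhere, so the concrete \<open>A u\<close>
  can replace it under integrals.\<close>

lemma transport_AE:
  assumes u: "u \<in> W"
  shows "transport \<Omega> a u \<in> L2 \<Omega>" "AE x in \<mu>. transport \<Omega> a u x = A u x"
proof -
  have r: "transport_rel \<Omega> a u (transport \<Omega> a u)"
    unfolding transport_def using transport_rel_A[OF u] by (rule someI[of "transport_rel \<Omega> a u"])
  then show tL: "transport \<Omega> a u \<in> L2 \<Omega>" by (simp add: transport_rel_def)
  then have tm: "Lp_mem \<mu> 2 (transport \<Omega> a u)" by (simp add: Lp_eq)
  have "AE x in \<mu>. transport \<Omega> a u x - A u x = 0"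
  proof (rule fundamental_lemma[OF open_dom])
    show "locally_integrable \<Omega> (\<lambda>x. transport \<Omega> a u x - A u x)"
      by (rule Lp_locally_integrable[OF Lp_mem_diff[OF tm A_L2[OF u]]]) auto
    fix \<psi> assume psi: "\<psi> \<in> test_functions \<Omega>"
    have t: "Lp_mem \<mu> 2 \<psi>" using test_Lp'[OF psi] by auto
    have "(LINT x|\<mu>. transport \<Omega> a u x * \<psi> x) = (LINT x|\<mu>. A u x * \<psi> x)"
      using r[unfolded transport_rel_def, THEN conjunct2, THEN conjunct2, rule_format, OF psi]
        transport_rel_A[OF u, unfolded transport_rel_def, THEN conjunct2, THEN conjunct2, rule_format, OF psi]
      by linarith
    then show "(LINT x|\<mu>. (transport \<Omega> a u x - A u x) * \<psi> x) = 0"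
      using L2_mult_integrable[OF tm t] L2_mult_integrable[OF A_L2[OF u] t] by (simp add: left_diff_distrib)
  qed
  then show "AE x in \<mu>. transport \<Omega> a u x = A u x" by simp
qed

lemma transport_pairing:
  assumes "u \<in> W" "v \<in> L2 \<Omega>"
  shows "(LINT x|\<mu>. v x * transport \<Omega> a u x) = (LINT x|\<mu>. v x * A u x)"
proof (rule integral_cong_AE)
  show "AE x in \<mu>. v x * transport \<Omega> a u x = v x * A u x"
    using transport_AE(2)[OF assms(1)] by eventually_elim simp
qed (use transport_AE(1)[OF assms(1)] A_L2[OF assms(1)] assms(2) in \<open>auto simp: Lp_def Lp_mem_def\<close>)

end

context dirichlet_setting
begin

section \<open>The energy functional\<close>

definition \<kappa> :: "real^'n \<Rightarrow> real" where "\<kappa> x = divergence a x + a0 x"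

lemma kappa_meas [measurable]: "\<kappa> \<in> borel_measurable \<mu>"
  using div_facts(2) a0_bounded unfolding \<kappa>_def[abs_def] Linfty_def by auto

lemma kappa_nonneg: "AE x in \<mu>. \<kappa> x \<ge> 0"
  using nonneg by eventually_elim (simp add: \<kappa>_def)

lemma kappa_bounded: "\<exists>C. AE x in \<mu>. \<bar>\<kappa> x\<bar> \<le> C"
proof -
  obtain C where C: "AE x in \<mu>. \<bar>divergence a x\<bar> \<le> C" using div_facts by blast
  obtain D where D: "AE x in \<mu>. \<bar>a0 x\<bar> \<le> D" using a0_bounded by (auto simp: Linfty_def)
  have "AE x in \<mu>. \<bar>\<kappa> x\<bar> \<le> C + D" using C D by eventually_elim (simp add: \<kappa>_def)
  then show ?thesis by blast
qed

lemma kappa_mult_L2: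
  fixes h :: "real^'n \<Rightarrow> real"
  assumes "Lp_mem \<mu> 2 h" shows "Lp_mem \<mu> 2 (\<lambda>x. \<kappa> x * h x)"
proof -
  obtain C where "AE x in \<mu>. \<bar>\<kappa> x\<bar> \<le> C" using kappa_bounded by blast
  from Lp_mem_bounded_mult[OF assms kappa_meas this] show ?thesis by simp
qed

lemma kappa_sq_integrable:
  assumes "Lp_mem \<mu> 2 u" shows "integrable \<mu> (\<lambda>x. \<kappa> x * (u x)\<^sup>2)"
  using L2_mult_integrable[OF kappa_mult_L2[OF assms] assms] by (simp add: power2_eq_square mult.assoc)

text \<open>The effective domain of \<phi>, on which the real number \<open>E u\<close> can stand
  for the extended real energy.\<close>

definition Dom :: "(real^'n \<Rightarrow> real) set" where
  "Dom = {u \<in> W. Lp_mem \<mu> m u}"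

definition E :: "(real^'n \<Rightarrow> real) \<Rightarrow> real" where
  "E u = 1/p * grad_energy u + 1/4 * (LINT x|\<mu>. \<kappa> x * (u x)\<^sup>2)
    + 1/m * (LINT x|\<mu>. \<bar>u x\<bar> powr m) + (LINT x|\<mu>. u x * f x)"

abbreviation "\<phi> \<equiv> energy \<Omega> p m a a0 f"

lemma Dom_W: "u \<in> Dom \<Longrightarrow> u \<in> W" by (simp add: Dom_def)

lemma Dom_integrable: "u \<in> Dom \<Longrightarrow> integrable \<mu> (\<lambda>x. \<bar>u x\<bar> powr m)"
  by (simp add: Dom_def Lp_mem_def)

lemma energy_Dom:
  assumes "u \<in> Dom" shows "\<phi> u = ereal (E u)"
proof -
  have "(\<integral>\<^sup>+x. ennreal (\<bar>u x\<bar> powr m) \<partial>\<mu>) = ennreal (LINT x|\<mu>. \<bar>u x\<bar> powr m)"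
    by (rule nn_integral_eq_integral[OF Dom_integrable[OF assms]]) simp
  then show ?thesis
    using Dom_W[OF assms]
    by (simp add: energy_def E_def grad_energy_def \<kappa>_def enn2ereal_ennreal)
qed

lemma energy_not_Dom:
  assumes "u \<notin> Dom" shows "\<phi> u = \<infinity>"
proof (cases "u \<in> W")
  case True
  then have "\<not> Lp_mem \<mu> m u" using assms by (simp add: Dom_def)
  moreover have um: "u \<in> borel_measurable \<mu>" using W01p_Lp[OF True] by (simp add: Lp_mem_def)
  ultimately have ni: "\<not> integrable \<mu> (\<lambda>x. \<bar>u x\<bar> powr m)" by (simp add: Lp_mem_def)
  have "(\<integral>\<^sup>+x. ennreal (\<bar>u x\<bar> powr m) \<partial>\<mu>) = \<infinity>"
  proof (rule ccontr)
    assume "(\<integral>\<^sup>+x. ennreal (\<bar>u x\<bar> powr m) \<partial>\<mu>) \<noteq> \<infinity>"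
    then have "integrable \<mu> (\<lambda>x. \<bar>u x\<bar> powr m)"
      using um by (intro integrableI_nonneg) (auto simp: less_top)
    then show False using ni by simp
  qed
  then show ?thesis using True m_gt_1 by (simp add: energy_def)
qed (simp add: energy_def)

lemma E_cong_AE:
  assumes "u \<in> Dom" "AE x in \<mu>. u x = v x"
  shows "v \<in> Dom" "E v = E u"
proof -
  have u: "u \<in> W" and um: "Lp_mem \<mu> m u" using assms(1) by (auto simp: Dom_def)
  note v = W01p_cong_AE[OF u assms(2)]
  have m': "u \<in> borel_measurable \<mu>" "v \<in> borel_measurable \<mu>" "wgrad \<Omega> u \<in> borel_measurable \<mu>" "wgrad \<Omega> v \<in> borel_measurable \<mu>"
      "f \<in> borel_measurable \<mu>"
    using W01p_Lp[OF u] W01p_Lp[OF v(1)] f_mem by (auto simp: Lp_mem_def)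
  show "v \<in> Dom" using v(1) Lp_mem_cong_AE[OF um m'(2) assms(2)] by (simp add: Dom_def)
  have "grad_energy v = grad_energy u"
    unfolding grad_energy_def by (rule integral_cong_AE) (use m' v(2) in auto)
  moreover have "(LINT x|\<mu>. \<kappa> x * (v x)\<^sup>2) = (LINT x|\<mu>. \<kappa> x * (u x)\<^sup>2)"
    by (rule integral_cong_AE) (use m' assms(2) in auto)
  moreover have "(LINT x|\<mu>. \<bar>v x\<bar> powr m) = (LINT x|\<mu>. \<bar>u x\<bar> powr m)"
    by (rule integral_cong_AE) (use m' assms(2) in auto)
  moreover have "(LINT x|\<mu>. v x * f x) = (LINT x|\<mu>. u x * f x)"
    by (rule integral_cong_AE) (use m' assms(2) in auto)
  ultimately show "E v = E u" by (simp add: E_def)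
qed

lemma Dom_lincomb: "u \<in> Dom \<Longrightarrow> v \<in> Dom \<Longrightarrow> (\<lambda>x. c * u x + d * v x) \<in> Dom"
  using m_gt_1 by (auto simp: Dom_def intro!: W01p_lincomb Lp_mem_add Lp_mem_cmult)

lemma Dom_test: "\<psi> \<in> test_functions \<Omega> \<Longrightarrow> \<psi> \<in> Dom"
  using m_gt_1 by (auto simp: Dom_def intro: W01p_test test_Lp')

lemma Dom_zero: "(\<lambda>x. 0) \<in> Dom" by (rule Dom_test[OF test_zero])

lemma E_zero: "E (\<lambda>x. 0) = 0"
proof -
  have "grad_energy (\<lambda>x. 0) = (LINT x|\<mu>. 0)"
    unfolding grad_energy_def
    by (rule integral_cong_AE) (use W01p_zero(2) W01p_Lp(2)[OF W01p_zero(1)] in \<open>auto simp: Lp_mem_def\<close>)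
  then show ?thesis by (simp add: E_def)
qed

lemma E_convex:
  assumes u: "u \<in> Dom" and v: "v \<in> Dom" and t: "0 \<le> t" "t \<le> 1"
  shows "E (\<lambda>x. (1 - t) * u x + t * v x) \<le> (1 - t) * E u + t * E v"
proof -
  let ?w = "\<lambda>x. (1 - t) * u x + t * v x"
  have w: "?w \<in> Dom" using u v by (rule Dom_lincomb)
  note W = Dom_W[OF u] Dom_W[OF v] Dom_W[OF w]
  have G: "grad_energy ?w \<le> (1 - t) * grad_energy u + t * grad_energy v"
  proof -
    have "grad_energy ?w \<le> (LINT x|\<mu>. (1 - t) * norm (wgrad \<Omega> u x) powr p + t * norm (wgrad \<Omega> v x) powr p)"
      unfolding grad_energy_def
    proof (rule integral_mono_AE)
      show "AE x in \<mu>. norm (wgrad \<Omega> ?w x) powr p \<le> (1 - t) * norm (wgrad \<Omega> u x) powr p + t * norm (wgrad \<Omega> v x) powr p"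
        using W01p_lincomb(2)[OF W(1,2), of "1 - t" t]
        by eventually_elim (simp only: norm_powr_convex[OF p_gt_1 t])
    qed (use W01p_Lp(2)[OF W(1)] W01p_Lp(2)[OF W(2)] W01p_Lp(2)[OF W(3)] in \<open>auto simp: Lp_mem_def\<close>)
    then show ?thesis
      using W01p_Lp(2)[OF W(1)] W01p_Lp(2)[OF W(2)] by (simp add: grad_energy_def Lp_mem_def)
  qed
  have K: "(LINT x|\<mu>. \<kappa> x * (?w x)\<^sup>2) \<le> (1 - t) * (LINT x|\<mu>. \<kappa> x * (u x)\<^sup>2) + t * (LINT x|\<mu>. \<kappa> x * (v x)\<^sup>2)"
  proof -
    note ki = kappa_sq_integrable[OF W01p_Lp(3)]
    have "(LINT x|\<mu>. \<kappa> x * (?w x)\<^sup>2) \<le> (LINT x|\<mu>. (1 - t) * (\<kappa> x * (u x)\<^sup>2) + t * (\<kappa> x * (v x)\<^sup>2))"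
    proof (rule integral_mono_AE)
      show "AE x in \<mu>. \<kappa> x * (?w x)\<^sup>2 \<le> (1 - t) * (\<kappa> x * (u x)\<^sup>2) + t * (\<kappa> x * (v x)\<^sup>2)"
        using kappa_nonneg
      proof eventually_elim
        case (elim x)
        have "(?w x)\<^sup>2 \<le> (1 - t) * (u x)\<^sup>2 + t * (v x)\<^sup>2"
          using norm_powr_convex[of 2 t "u x" "v x"] t by simp
        then have "\<kappa> x * (?w x)\<^sup>2 \<le> \<kappa> x * ((1 - t) * (u x)\<^sup>2 + t * (v x)\<^sup>2)"
          using elim by (rule mult_left_mono)
        then show ?case by (simp add: algebra_simps)
      qed
    qed (use ki[OF W(1)] ki[OF W(2)] ki[OF W(3)] in auto)
    then show ?thesis using ki[OF W(1)] ki[OF W(2)] by simp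
  qed
  have P: "(LINT x|\<mu>. \<bar>?w x\<bar> powr m) \<le> (1 - t) * (LINT x|\<mu>. \<bar>u x\<bar> powr m) + t * (LINT x|\<mu>. \<bar>v x\<bar> powr m)"
  proof -
    have "(LINT x|\<mu>. \<bar>?w x\<bar> powr m) \<le> (LINT x|\<mu>. (1 - t) * \<bar>u x\<bar> powr m + t * \<bar>v x\<bar> powr m)"
    proof (rule integral_mono)
      show "\<bar>?w x\<bar> powr m \<le> (1 - t) * \<bar>u x\<bar> powr m + t * \<bar>v x\<bar> powr m" for x
        using norm_powr_convex[OF m_gt_1 t, of "u x" "v x"] by simp
    qed (use Dom_integrable[OF u] Dom_integrable[OF v] Dom_integrable[OF w] in auto)
    then show ?thesis using Dom_integrable[OF u] Dom_integrable[OF v] by simp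
  qed
  have F: "(LINT x|\<mu>. ?w x * f x) = (1 - t) * (LINT x|\<mu>. u x * f x) + t * (LINT x|\<mu>. v x * f x)"
    using L2_mult_integrable[OF W01p_Lp(3)[OF W(1)] f_mem] L2_mult_integrable[OF W01p_Lp(3)[OF W(2)] f_mem]
    by (simp add: distrib_right mult.assoc)
  have "1/p * grad_energy ?w \<le> 1/p * ((1 - t) * grad_energy u + t * grad_energy v)"
    using G p_pos by (intro mult_left_mono) auto
  moreover have "1/m * (LINT x|\<mu>. \<bar>?w x\<bar> powr m) \<le> 1/m * ((1 - t) * (LINT x|\<mu>. \<bar>u x\<bar> powr m) + t * (LINT x|\<mu>. \<bar>v x\<bar> powr m))"
    using P m_gt_1 by (intro mult_left_mono) auto
  ultimately have "E ?w \<le> 1/p * ((1 - t) * grad_energy u + t * grad_energy v)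
     + 1/4 * ((1 - t) * (LINT x|\<mu>. \<kappa> x * (u x)\<^sup>2) + t * (LINT x|\<mu>. \<kappa> x * (v x)\<^sup>2))
     + 1/m * ((1 - t) * (LINT x|\<mu>. \<bar>u x\<bar> powr m) + t * (LINT x|\<mu>. \<bar>v x\<bar> powr m))
     + ((1 - t) * (LINT x|\<mu>. u x * f x) + t * (LINT x|\<mu>. v x * f x))"
    unfolding E_def[of ?w] F by (intro add_mono order_refl mult_left_mono[OF K]) auto
  also have "\<dots> = (1 - t) * E u + t * E v"
    by (simp add: E_def algebra_simps add_divide_distrib diff_divide_distrib)
  finally show ?thesis .
qed

lemma E_coercive: "\<exists>B. \<forall>u\<in>Dom. grad_energy u \<le> 2 * p * E u + B"
proof -
  obtain C where C: "C > 0" "\<And>u. u \<in> W \<Longrightarrow> (LINT x|\<mu>. \<bar>u x\<bar> powr p) \<le> C * grad_energy u"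
    using W01p_poincare by blast
  \<comment> \<open>With this value \<open>\<delta> * C\<close> is \<open>1 / (2 * p)\<close>, so
    the linear term consumes half of the gradient term \<open>1/p * grad_energy u\<close>.\<close>
  define \<delta> where "\<delta> = 1 / (2 * p * C)"
  have d: "\<delta> > 0" using C p_pos by (simp add: \<delta>_def)
  define V where "V = \<delta> * measure \<mu> (space \<mu>) + (LINT x|\<mu>. (f x)\<^sup>2) / \<delta>"
  have "grad_energy u \<le> 2 * p * E u + 2 * p * V" if u: "u \<in> Dom" for u
  proof -
    note W = Dom_W[OF u]
    have i: "integrable \<mu> (\<lambda>x. \<bar>u x\<bar> powr p)" "integrable \<mu> (\<lambda>x. (f x)\<^sup>2)"
      using W01p_Lp[OF W] f_mem by (auto simp: Lp_mem_def)
    have "- (LINT x|\<mu>. u x * f x) = (LINT x|\<mu>. - (u x * f x))" by simp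
    also have "\<dots> \<le> (LINT x|\<mu>. \<delta> * (1 + \<bar>u x\<bar> powr p) + (f x)\<^sup>2 / \<delta>)"
    proof (rule integral_mono)
      show "integrable \<mu> (\<lambda>x. - (u x * f x))"
        using L2_mult_integrable[OF W01p_Lp(3)[OF W] f_mem] by simp
      show "integrable \<mu> (\<lambda>x. \<delta> * (1 + \<bar>u x\<bar> powr p) + (f x)\<^sup>2 / \<delta>)" using i by simp
      show "- (u x * f x) \<le> \<delta> * (1 + \<bar>u x\<bar> powr p) + (f x)\<^sup>2 / \<delta>" for x
      proof -
        \<comment> \<open>Expanding the square bounds the linear term by \<open>u\<^sup>2\<close>
          with a small coefficient; \<open>p \<ge> 2\<close> then passes from
          \<open>u\<^sup>2\<close> to the power \<open>p\<close>.\<close>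
        have "0 \<le> (\<delta> * u x + f x)\<^sup>2" by simp
        then have "- (2 * \<delta> * (u x * f x)) \<le> (\<delta> * u x)\<^sup>2 + (f x)\<^sup>2"
          by (simp add: power2_eq_square algebra_simps)
        also have "\<dots> \<le> 2 * ((\<delta> * u x)\<^sup>2 + (f x)\<^sup>2)" by simp
        finally have "\<delta> * (- (u x * f x)) \<le> \<delta> * (\<delta> * (u x)\<^sup>2 + (f x)\<^sup>2 / \<delta>)"
          using d by (simp add: power2_eq_square algebra_simps)
        then have "- (u x * f x) \<le> \<delta> * (u x)\<^sup>2 + (f x)\<^sup>2 / \<delta>" using d by (simp only: mult_le_cancel_left_pos)
        moreover have "(u x)\<^sup>2 \<le> 1 + \<bar>u x\<bar> powr p"
          using powr_le_one_add[of 2 p "\<bar>u x\<bar>"] p_ge_2 by simp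
        then have "\<delta> * (u x)\<^sup>2 \<le> \<delta> * (1 + \<bar>u x\<bar> powr p)" using d by (intro mult_left_mono) auto
        ultimately show ?thesis by linarith
      qed
    qed
    also have "\<dots> = \<delta> * (measure \<mu> (space \<mu>) + (LINT x|\<mu>. \<bar>u x\<bar> powr p)) + (LINT x|\<mu>. (f x)\<^sup>2) / \<delta>"
      using i by simp
    also have "\<dots> \<le> \<delta> * (measure \<mu> (space \<mu>) + C * grad_energy u) + (LINT x|\<mu>. (f x)\<^sup>2) / \<delta>"
      using C(2)[OF W] d by (intro add_mono mult_left_mono) auto
    also have "\<dots> = V + grad_energy u / (2 * p)"
      using C(1) p_pos by (simp add: V_def \<delta>_def field_simps)
    finally have 1: "- (LINT x|\<mu>. u x * f x) \<le> V + grad_energy u / (2 * p)" .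
    have "0 \<le> (LINT x|\<mu>. \<kappa> x * (u x)\<^sup>2)"
      by (rule integral_nonneg_AE) (use kappa_nonneg in \<open>auto elim: eventually_mono\<close>)
    moreover have "0 \<le> 1/m * (LINT x|\<mu>. \<bar>u x\<bar> powr m)" using m_gt_1 by simp
    ultimately have "1/p * grad_energy u \<le> E u + (V + grad_energy u / (2 * p))"
      using 1 unfolding E_def by linarith
    then show ?thesis using p_pos by (simp add: field_simps)
  qed
  then show ?thesis by blast
qed

text \<open>Fatou's lemma along an almost everywhere convergent subsequence handles the nonnegative
  terms; the linear one converges as a pairing. The bounds \<open>c n\<close> may vary because the
  existence proof puts the transport pairing, which depends on \<open>w n\<close>, on the right-hand
  side.\<close>

lemma E_closed:
  assumes w: "\<And>n::nat. w n \<in> Dom" and u: "u \<in> W"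
    and c: "c \<longlonglongrightarrow> c'" "\<And>n. E (w n) \<le> c n"
    and lim: "Lp_tendsto \<mu> p w u" "Lp_tendsto \<mu> p (\<lambda>n. wgrad \<Omega> (w n)) (wgrad \<Omega> u)"
  shows "u \<in> Dom" "E u \<le> c'"
proof -
  \<comment> \<open>All terms of the energy density except \<open>u x * f x\<close>. They are
    nonnegative almost everywhere, so finiteness of the limit also yields \<open>L^m\<close>
    integrability and hence \<open>u \<in> Dom\<close>.\<close>
  define F where "F u x = 1/p * norm (wgrad \<Omega> u x) powr p + 1/4 * (\<kappa> x * (u x)\<^sup>2) + 1/m * \<bar>u x\<bar> powr m" for u x
  have W: "\<And>n. w n \<in> W" using Dom_W[OF w] .
  have [measurable]: "u \<in> borel_measurable \<mu>" "wgrad \<Omega> u \<in> borel_measurable \<mu>"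
    "\<And>n. w n \<in> borel_measurable \<mu>" "\<And>n. wgrad \<Omega> (w n) \<in> borel_measurable \<mu>"
    using W01p_Lp[OF u] W01p_Lp[OF W] by (auto simp: Lp_mem_def)
  have Fm [measurable]: "F u \<in> borel_measurable \<mu>" "\<And>n. F (w n) \<in> borel_measurable \<mu>"
    unfolding F_def by measurable
  have Fnn: "AE x in \<mu>. 0 \<le> F v x" for v
    using kappa_nonneg by eventually_elim (use p_pos m_gt_1 in \<open>simp add: F_def\<close>)
  have FI: "integrable \<mu> (F v)" "(LINT x|\<mu>. F v x) = E v - (LINT x|\<mu>. v x * f x)" if "v \<in> Dom" for v
    using W01p_Lp(2)[OF Dom_W[OF that]] kappa_sq_integrable[OF W01p_Lp(3)[OF Dom_W[OF that]]] Dom_integrable[OF that]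
    by (auto simp: F_def[abs_def] E_def grad_energy_def Lp_mem_def)
  obtain r1 where r1: "strict_mono r1" "AE x in \<mu>. (\<lambda>n. w (r1 n) x) \<longlonglongrightarrow> u x"
    using Lp_gap_AE_subseq[OF W01p_Lp(1)[OF W] W01p_Lp(1)[OF u] p_pos lim(1)] by auto
  have lim2: "Lp_tendsto \<mu> p (\<lambda>n. wgrad \<Omega> (w (r1 n))) (wgrad \<Omega> u)"
    using LIMSEQ_subseq_LIMSEQ[OF lim(2) r1(1)] by (simp add: o_def)
  obtain r2 where r2: "strict_mono r2" "AE x in \<mu>. (\<lambda>n. wgrad \<Omega> (w (r1 (r2 n))) x) \<longlonglongrightarrow> wgrad \<Omega> u x"
    using Lp_gap_AE_subseq[OF W01p_Lp(2)[OF W] W01p_Lp(2)[OF u] p_pos lim2] by auto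
  define r where "r = (\<lambda>n. r1 (r2 n))"
  have r: "strict_mono r" using strict_mono_o[OF r1(1) r2(1)] by (simp add: r_def o_def)
  have ae: "AE x in \<mu>. (\<lambda>n. F (w (r n)) x) \<longlonglongrightarrow> F u x"
    using r1(2) r2(2)
  proof eventually_elim
    case (elim x)
    have 1: "(\<lambda>n. w (r n) x) \<longlonglongrightarrow> u x"
      using LIMSEQ_subseq_LIMSEQ[OF elim(1) r2(1)] by (simp add: o_def r_def)
    have 2: "(\<lambda>n. wgrad \<Omega> (w (r n)) x) \<longlonglongrightarrow> wgrad \<Omega> u x" using elim(2) by (simp add: r_def)
    show ?case unfolding F_def
      by (intro tendsto_add tendsto_mult tendsto_const tendsto_powr' tendsto_norm tendsto_rabs tendsto_power 1 2)
        (use p_pos m_gt_1 in auto)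
  qed
  have uf: "(\<lambda>n. LINT x|\<mu>. w (r n) x * f x) \<longlonglongrightarrow> (LINT x|\<mu>. u x * f x)"
    using LIMSEQ_subseq_LIMSEQ[OF pairing_tendsto[OF W01p_Lp(1)[OF W] W01p_Lp(1)[OF u] f_mem lim(1)] r]
    by (simp add: o_def)
  define d where "d n = c (r n) - (LINT x|\<mu>. w (r n) x * f x)" for n
  define d' where "d' = c' - (LINT x|\<mu>. u x * f x)"
  have dlim: "d \<longlonglongrightarrow> d'"
    unfolding d_def[abs_def] d'_def
    using LIMSEQ_subseq_LIMSEQ[OF c(1) r] by (intro tendsto_diff uf) (simp add: o_def)
  have Fle: "(LINT x|\<mu>. F (w (r n)) x) \<le> d n" for n
    using FI(2)[OF w] c(2)[of "r n"] by (simp add: d_def)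
  have "0 \<le> (LINT x|\<mu>. F (w (r n)) x)" for n by (rule integral_nonneg_AE[OF Fnn])
  then have "0 \<le> d n" for n using Fle order_trans by blast
  \<comment> \<open>Needed to read the final inequality between \<open>ennreal\<close> values as one
    between reals.\<close>
  then have d'0: "0 \<le> d'" by (intro LIMSEQ_le_const[OF dlim]) auto
  have "(\<integral>\<^sup>+x. ennreal (F u x) \<partial>\<mu>) = (\<integral>\<^sup>+x. liminf (\<lambda>n. ennreal (F (w (r n)) x)) \<partial>\<mu>)"
  proof (rule nn_integral_cong_AE)
    show "AE x in \<mu>. ennreal (F u x) = liminf (\<lambda>n. ennreal (F (w (r n)) x))"
      using ae
    proof eventually_elim
      case (elim x)
      then have "(\<lambda>n. ennreal (F (w (r n)) x)) \<longlonglongrightarrow> ennreal (F u x)" by (rule tendsto_ennrealI)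
      then show ?case by (rule lim_imp_Liminf[OF trivial_limit_sequentially, symmetric])
    qed
  qed
  also have "\<dots> \<le> liminf (\<lambda>n. \<integral>\<^sup>+x. ennreal (F (w (r n)) x) \<partial>\<mu>)"
    by (rule nn_integral_liminf) simp
  also have "\<dots> \<le> liminf (\<lambda>n. ennreal (d n))"
  proof (rule Liminf_mono, rule always_eventually, rule allI)
    fix n
    have "(\<integral>\<^sup>+x. ennreal (F (w (r n)) x) \<partial>\<mu>) = ennreal (LINT x|\<mu>. F (w (r n)) x)"
      by (rule nn_integral_eq_integral[OF FI(1)[OF w] Fnn])
    then show "(\<integral>\<^sup>+x. ennreal (F (w (r n)) x) \<partial>\<mu>) \<le> ennreal (d n)"
      using Fle[of n] by (simp add: ennreal_leI)
  qed
  also have "liminf (\<lambda>n. ennreal (d n)) = ennreal d'"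
    by (rule lim_imp_Liminf[OF trivial_limit_sequentially tendsto_ennrealI[OF dlim]])
  finally have Fu: "(\<integral>\<^sup>+x. ennreal (F u x) \<partial>\<mu>) \<le> ennreal d'" .
  have Fui: "integrable \<mu> (F u)"
    by (rule integrableI_nonneg[OF Fm(1) Fnn]) (use Fu in \<open>auto intro: order_le_less_trans\<close>)
  have "integrable \<mu> (\<lambda>x. \<bar>u x\<bar> powr m)"
  proof (rule Bochner_Integration.integrable_bound)
    show "integrable \<mu> (\<lambda>x. m * F u x)" using Fui by simp
    show "AE x in \<mu>. norm (\<bar>u x\<bar> powr m) \<le> norm (m * F u x)"
      using kappa_nonneg
    proof eventually_elim
      case (elim x)
      have "1/m * \<bar>u x\<bar> powr m \<le> F u x" using elim p_pos by (simp add: F_def)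
      then have "\<bar>u x\<bar> powr m \<le> m * F u x" using m_gt_1 by (simp add: field_simps)
      then show ?case by simp
    qed
  qed measurable
  then show uD: "u \<in> Dom" using u by (simp add: Dom_def Lp_mem_def)
  have "ennreal (LINT x|\<mu>. F u x) \<le> ennreal d'"
    using Fu nn_integral_eq_integral[OF Fui Fnn] by simp
  then have "(LINT x|\<mu>. F u x) \<le> d'" using d'0 by (simp add: ennreal_le_iff)
  then show "E u \<le> c'" using FI(2)[OF uD] by (simp add: d'_def)
qed

section \<open>Convexity and semicontinuity in the square-integrable functions\<close>

lemma energy_convex: "convex_functional \<Omega> \<phi>"
  unfolding convex_functional_def
proof (intro ballI allI impI)
  fix u v :: "real^'n \<Rightarrow> real" and t :: real
  assume t: "0 < t \<and> t < 1"
  show "\<phi> (\<lambda>x. (1 - t) * u x + t * v x) \<le> ereal (1 - t) * \<phi> u + ereal t * \<phi> v"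
  proof (cases "u \<in> Dom \<and> v \<in> Dom")
    case True
    then show ?thesis
      using E_convex[of u v t] t by (simp add: energy_Dom Dom_lincomb)
  next
    case False
    \<comment> \<open>With \<open>-\<infinity>\<close> excluded and both weights positive, one
      infinite summand makes the right-hand side \<open>\<infinity>\<close>.\<close>
    have nm: "\<phi> w \<noteq> -\<infinity>" for w using energy_Dom[of w] energy_not_Dom[of w] by (cases "w \<in> Dom") auto
    have eq: "ereal (1 - t) * \<phi> u + ereal t * \<phi> v = \<infinity>"
      using False t nm[of u] nm[of v]
      by (cases "\<phi> u"; cases "\<phi> v") (auto simp: energy_not_Dom energy_Dom)
    show ?thesis unfolding eq by simp
  qed
qed

lemma energy_lsc: "lsc_functional \<Omega> \<phi>"
  unfolding lsc_functional_def
proof (intro ballI allI impI)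
  fix u :: "real^'n \<Rightarrow> real" and v :: "nat \<Rightarrow> real^'n \<Rightarrow> real"
  assume uL: "u \<in> L2 \<Omega>" and vL: "(\<forall>k. v k \<in> L2 \<Omega>) \<and> (\<lambda>k. LINT x|\<mu>. \<bar>v k x - u x\<bar> powr 2) \<longlonglongrightarrow> 0"
  have u2: "Lp_mem \<mu> 2 u" using uL by (simp add: Lp_eq)
  have vu: "Lp_tendsto \<mu> 2 v u" using vL by (simp add: Lp_gap_def)
  show "\<phi> u \<le> liminf (\<lambda>k. \<phi> (v k))"
  proof (rule ccontr)
    assume "\<not> ?thesis"
    then have "liminf (\<lambda>k. \<phi> (v k)) < \<phi> u" by simp
    then obtain c where c: "liminf (\<lambda>k. \<phi> (v k)) < ereal c" "ereal c < \<phi> u"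
      using ereal_dense2 by blast
    \<comment> \<open>The lower limit gives infinitely many good indices, not all late ones; a
      single one will do for each finite set of constraints.\<close>
    have freq: "\<exists>k\<ge>N. \<phi> (v k) < ereal c" for N
    proof (rule ccontr)
      assume "\<not> ?thesis"
      then have "\<forall>\<^sub>F k in sequentially. ereal c \<le> \<phi> (v k)"
        by (auto simp: eventually_sequentially not_less)
      then have "ereal c \<le> liminf (\<lambda>k. \<phi> (v k))" by (rule Liminf_bounded)
      then show False using c(1) by simp
    qed
    obtain B where B: "\<And>u. u \<in> Dom \<Longrightarrow> grad_energy u \<le> 2 * p * E u + B" using E_coercive by blast
    \<comment> \<open>A function common to all \<open>C j\<close> has gap 0 to \<open>u\<close>, so
      \<open>u\<close>, not known to lie in \<open>W\<close> beforehand, inherits its domain and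
      energy bound.\<close>
    define C where "C j = {w \<in> Dom. E w \<le> c \<and> Lp_gap \<mu> 2 w u \<le> 1 / real (Suc j)}" for j :: nat
    have "\<exists>w\<in>W. \<forall>j\<in>UNIV. w \<in> C j"
    proof (rule W01p_intersection[where B = "2 * p * c + B"])
      fix G :: "nat set" assume "finite G" "G \<subseteq> UNIV"
      \<comment> \<open>The balls shrink with \<open>j\<close>, so one \<open>v k\<close> in the
        ball of index \<open>J\<close> meets all constraints in \<open>G\<close>.\<close>
      then obtain J where J: "\<And>j. j \<in> G \<Longrightarrow> j \<le> J" using finite_nat_set_iff_bounded_le by auto
      have "\<forall>\<^sub>F k in sequentially. Lp_gap \<mu> 2 (v k) u < 1 / real (Suc J)"
        by (rule order_tendstoD(2)[OF vu]) simp
      then obtain N where N: "\<And>k. k \<ge> N \<Longrightarrow> Lp_gap \<mu> 2 (v k) u < 1 / real (Suc J)"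
        by (auto simp: eventually_sequentially)
      obtain k where k: "k \<ge> N" "\<phi> (v k) < ereal c" using freq by blast
      have vD: "v k \<in> Dom" using k(2) energy_not_Dom[of "v k"] by (cases "v k \<in> Dom") auto
      then have Ec: "E (v k) \<le> c" using k(2) by (simp add: energy_Dom)
      have "v k \<in> C j" if "j \<in> G" for j
      proof -
        have "1 / real (Suc J) \<le> 1 / real (Suc j)" using J[OF that] by (simp add: frac_le)
        then show ?thesis using vD Ec N[OF k(1)] by (simp add: C_def)
      qed
      moreover have "2 * p * E (v k) \<le> 2 * p * c"
        using Ec p_pos by (intro mult_left_mono) auto
      then have "grad_energy (v k) \<le> 2 * p * c + B" using B[OF vD] by linarith
      ultimately show "\<exists>w\<in>W. (\<forall>j\<in>G. w \<in> C j) \<and> grad_energy w \<le> 2 * p * c + B"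
        using Dom_W[OF vD] by blast
    next
      fix w z j assume wz: "w \<in> C j" "z \<in> C j"
      let ?m = "\<lambda>x. 1/2 * w x + 1/2 * z x"
      have D: "w \<in> Dom" "z \<in> Dom" using wz by (auto simp: C_def)
      have L: "Lp_mem \<mu> 2 (\<lambda>x. w x - u x)" "Lp_mem \<mu> 2 (\<lambda>x. z x - u x)" "Lp_mem \<mu> 2 (\<lambda>x. ?m x - u x)"
        using W01p_Lp(3)[OF Dom_W[OF D(1)]] W01p_Lp(3)[OF Dom_W[OF D(2)]]
          W01p_Lp(3)[OF Dom_W[OF Dom_lincomb[OF D, of "1/2" "1/2"]]] u2 by (auto intro: Lp_mem_diff)
      have "E ?m \<le> c" using E_convex[OF D, of "1/2"] wz by (simp add: C_def)
      moreover have "Lp_gap \<mu> 2 ?m u \<le> (LINT x|\<mu>. 1/2 * (w x - u x)\<^sup>2 + 1/2 * (z x - u x)\<^sup>2)"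
        unfolding Lp_gap_2
      proof (rule integral_mono)
        show "(?m x - u x)\<^sup>2 \<le> 1/2 * (w x - u x)\<^sup>2 + 1/2 * (z x - u x)\<^sup>2" for x
        proof -
          have "?m x - u x = (1/2) * (w x - u x) + (1/2) * (z x - u x)" by (simp add: field_simps)
          then show ?thesis using norm_powr_convex[of 2 "1/2" "w x - u x" "z x - u x"] by simp
        qed
      qed (use L in \<open>auto simp: Lp_mem_def\<close>)
      moreover have "(LINT x|\<mu>. 1/2 * (w x - u x)\<^sup>2 + 1/2 * (z x - u x)\<^sup>2) = 1/2 * Lp_gap \<mu> 2 w u + 1/2 * Lp_gap \<mu> 2 z u"
        using L by (simp add: Lp_mem_def Lp_gap_2)
      moreover have "Lp_gap \<mu> 2 w u \<le> 1 / real (Suc j)" "Lp_gap \<mu> 2 z u \<le> 1 / real (Suc j)"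
        using wz by (auto simp: C_def)
      ultimately have "E ?m \<le> c \<and> Lp_gap \<mu> 2 ?m u \<le> 1 / real (Suc j)" by linarith
      then show "?m \<in> C j" using Dom_lincomb[OF D, of "1/2" "1/2"] by (simp add: C_def)
    next
      fix j and w :: "nat \<Rightarrow> real^'n \<Rightarrow> real" and z
      assume w: "\<And>n. w n \<in> W \<and> w n \<in> C j" and z: "z \<in> W"
        and lim: "Lp_tendsto \<mu> p w z" "Lp_tendsto \<mu> p (\<lambda>n. wgrad \<Omega> (w n)) (wgrad \<Omega> z)"
      have D: "\<And>n. w n \<in> Dom" "\<And>n. E (w n) \<le> c" "\<And>n. Lp_gap \<mu> 2 (w n) u \<le> 1 / real (Suc j)"
        using w by (auto simp: C_def)
      have l2: "Lp_tendsto \<mu> 2 w z"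
        by (rule Lp_gap_lower[OF _ W01p_Lp(1)[OF z] _ p_ge_2 lim(1)]) (use W01p_Lp(1) w in auto)
      have "Lp_gap \<mu> 2 z u \<le> 1 / real (Suc j)"
        by (rule L2_dist_closed[OF _ W01p_Lp(3)[OF z] u2 l2 D(3)]) (use W01p_Lp(3) w in auto)
      then show "z \<in> C j" using E_closed[OF D(1) z tendsto_const D(2) lim] by (simp add: C_def)
    qed auto
    then obtain w where w: "\<And>j. w \<in> C j" by blast
    then have wD: "w \<in> Dom" and Ew: "E w \<le> c" and g: "\<And>j. Lp_gap \<mu> 2 w u \<le> 1 / real (Suc j)"
      by (auto simp: C_def)
    have "Lp_tendsto \<mu> 2 (\<lambda>j. w) u"
      by (rule tendsto_0_bound[OF Lp_gap_nonneg g])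
        (use LIMSEQ_inverse_real_of_nat in \<open>simp add: inverse_eq_divide del: of_nat_Suc\<close>)
    then have "Lp_gap \<mu> 2 w u = 0" by (simp add: LIMSEQ_const_iff)
    then have "AE x in \<mu>. w x = u x"
      by (intro Lp_gap_0_AE[OF W01p_Lp(3)[OF Dom_W[OF wD]] u2]) auto
    from E_cong_AE[OF wD this] have "\<phi> u \<le> ereal c" using Ew by (simp add: energy_Dom)
    then show False using c(2) by simp
  qed
qed

end

context dirichlet_setting
begin

section \<open>Existence\<close>

abbreviation "I \<equiv> selfdual_functional \<Omega> p m a a0 f"
abbreviation "dual u \<equiv> fenchel_conjugate \<Omega> \<phi> (transport \<Omega> a u)"

lemma W_L2: "u \<in> W \<Longrightarrow> u \<in> L2 \<Omega>"
  using W01p_Lp(3) by (simp add: Lp_eq)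

lemma conj_ge:
  assumes "u \<in> W" "v \<in> Dom"
  shows "ereal ((LINT x|\<mu>. v x * A u x) - E v) \<le> dual u"
proof -
  have "ereal (LINT x|\<mu>. v x * transport \<Omega> a u x) - \<phi> v \<le> dual u"
    unfolding fenchel_conjugate_def using W_L2[OF Dom_W[OF assms(2)]] by (rule SUP_upper)
  then show ?thesis
    using transport_pairing[OF assms(1) W_L2[OF Dom_W[OF assms(2)]]] by (simp add: energy_Dom[OF assms(2)])
qed

text \<open>Outside \<open>Dom\<close> the term under the supremum is \<open>-\<infinity>\<close>,
  so only real-valued competitors have to be bounded.\<close>

lemma conj_le:
  assumes "u \<in> W" "\<And>v. v \<in> Dom \<Longrightarrow> (LINT x|\<mu>. v x * A u x) - E v \<le> c"
  shows "dual u \<le> ereal c"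
  unfolding fenchel_conjugate_def
proof (rule SUP_least)
  fix v assume v: "v \<in> L2 \<Omega>"
  show "ereal (LINT x|\<mu>. v x * transport \<Omega> a u x) - \<phi> v \<le> ereal c"
  proof (cases "v \<in> Dom")
    case True
    then show ?thesis using assms(2)[OF True] transport_pairing[OF assms(1) v] by (simp add: energy_Dom)
  qed (simp add: energy_not_Dom)
qed

lemma I_not_Dom:
  assumes "u \<in> W" "u \<notin> Dom" shows "I u = \<infinity>"
  by (simp add: selfdual_functional_def energy_not_Dom[OF assms(2)])

text \<open>The competitor \<open>v = u\<close> contributes \<open>- E u\<close> to the conjugate,
  since its pairing vanishes by \<open>A_self\<close>.\<close>

lemma I_nonneg:
  assumes u: "u \<in> W" shows "0 \<le> I u"
proof (cases "u \<in> Dom")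
  case True
  have "ereal (- E u) \<le> dual u" using conj_ge[OF u True] A_self[OF u] by simp
  then have "ereal (E u) + ereal (- E u) \<le> ereal (E u) + dual u" by (rule add_left_mono)
  then show ?thesis by (simp add: selfdual_functional_def energy_Dom[OF True] zero_ereal_def)
qed (simp add: I_not_Dom[OF u])

text \<open>This turns the extended real equation into real inequalities: existence establishes
  them, and the Euler-Lagrange argument starts from them.\<close>

lemma I_zero_iff:
  assumes u: "u \<in> W"
  shows "I u = 0 \<longleftrightarrow> u \<in> Dom \<and> (\<forall>v\<in>Dom. (LINT x|\<mu>. v x * A u x) - E v \<le> - E u)"
proof
  assume I0: "I u = 0"
  then have D: "u \<in> Dom" using I_not_Dom[OF u] by auto
  have "ereal (E u) + dual u = 0" using I0 by (simp add: selfdual_functional_def energy_Dom[OF D])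
  then have c: "dual u = ereal (- E u)" by (cases "dual u") (auto simp: zero_ereal_def)
  have "(LINT x|\<mu>. v x * A u x) - E v \<le> - E u" if "v \<in> Dom" for v
    using conj_ge[OF u that] by (simp add: c)
  then show "u \<in> Dom \<and> (\<forall>v\<in>Dom. (LINT x|\<mu>. v x * A u x) - E v \<le> - E u)" using D by blast
next
  assume r: "u \<in> Dom \<and> (\<forall>v\<in>Dom. (LINT x|\<mu>. v x * A u x) - E v \<le> - E u)"
  then have "dual u \<le> ereal (- E u)" by (intro conj_le[OF u]) auto
  then have "ereal (E u) + dual u \<le> ereal (E u) + ereal (- E u)" by (rule add_left_mono)
  then have "I u \<le> 0" using r by (simp add: selfdual_functional_def energy_Dom zero_ereal_def)
  then show "I u = 0" using I_nonneg[OF u] by (rule antisym)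
qed

lemma zero_exists: "\<exists>u\<in>W. I u = 0"
proof -
  \<comment> \<open>The varying function occupies the linear slot against the fixed
    \<open>A v\<close>. By antisymmetry the payoff of \<open>u\<close> against \<open>v\<close> is
    \<open>E u - E v - P u v\<close>.\<close>
  define P where "P u v = (LINT x|\<mu>. u x * A v x)" for u v
  \<comment> \<open>Each index pairs an opponent with a tolerance, as finite games are won only up
    to a positive error.\<close>
  define J where "J = Dom \<times> {0::real<..}"
  define C where "C j = {u \<in> Dom. E u - P u (fst j) \<le> E (fst j) + snd j}" for j :: "(real^'n \<Rightarrow> real) \<times> real"
  have Plin: "P (\<lambda>x. c * u x + d * w x) v = c * P u v + d * P w v"
    if "u \<in> Dom" "w \<in> Dom" "v \<in> Dom" for u w v c d
    using L2_mult_integrable[OF W01p_Lp(3)[OF Dom_W[OF that(1)]] A_L2[OF Dom_W[OF that(3)]]]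
      L2_mult_integrable[OF W01p_Lp(3)[OF Dom_W[OF that(2)]] A_L2[OF Dom_W[OF that(3)]]]
    by (simp add: P_def distrib_right mult.assoc)
  have Panti: "P u v = - P v u" if "u \<in> Dom" "v \<in> Dom" for u v
    unfolding P_def using A_antisym[OF Dom_W[OF that(2)] Dom_W[OF that(1)]] .
  have conv: "(\<lambda>x. (1 - t) * u x + t * w x) \<in> Dom \<and>
      E (\<lambda>x. (1 - t) * u x + t * w x) - P (\<lambda>x. (1 - t) * u x + t * w x) v
        \<le> (1 - t) * (E u - P u v) + t * (E w - P w v)"
    if "v \<in> Dom" "u \<in> Dom" "w \<in> Dom" "0 \<le> t" "t \<le> 1" for u w v t
    using E_convex[OF that(2-5)] Dom_lincomb[OF that(2,3), of "1 - t" t] Plin[OF that(2,3,1), of "1 - t" t]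
    by (simp add: algebra_simps)
  obtain B where B: "\<And>u. u \<in> Dom \<Longrightarrow> grad_energy u \<le> 2 * p * E u + B" using E_coercive by blast
  have "\<exists>u\<in>W. \<forall>j\<in>J. u \<in> C j"
  proof (rule W01p_intersection[where B = "2 * p + B"])
    show "J \<noteq> {}" using Dom_zero by (auto simp: J_def intro: exI[of _ 1])
  next
    fix G assume G: "finite G" "G \<subseteq> J"
    \<comment> \<open>Against the opponent 0 the payoff is \<open>E u\<close>, so
      \<open>E u \<le> \<epsilon>\<close>. Capping \<epsilon> at 1 then makes the bound
      \<open>2 * p + B\<close> from coercivity independent of \<open>G\<close>.\<close>
    define V where "V = insert (\<lambda>x. 0) (fst ` G)"
    define \<epsilon> where "\<epsilon> = Min (insert 1 (snd ` G))"
    have V: "finite V" "V \<noteq> {}" "V \<subseteq> Dom" using G Dom_zero by (auto simp: V_def J_def)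
    have eps: "\<epsilon> > 0" "\<epsilon> \<le> 1" "\<And>j. j \<in> G \<Longrightarrow> \<epsilon> \<le> snd j"
      using G by (auto simp: \<epsilon>_def J_def)
    define b where "b v w = E v - E w - P v w" for v w
    have "\<exists>l. (\<forall>i\<in>V. l i \<ge> 0) \<and> sum l V = 1 \<and> (\<forall>j\<in>V. (\<Sum>i\<in>V. l i * b i j) \<le> \<epsilon>)"
    proof (rule antisymmetric_game[OF V(1,2) _ eps(1)])
      show "b i j = - b j i" if "i \<in> V" "j \<in> V" for i j
        using Panti[OF subsetD[OF V(3) that(1)] subsetD[OF V(3) that(2)]] by (simp add: b_def)
    qed
    then obtain l where l: "\<And>i. i \<in> V \<Longrightarrow> l i \<ge> 0" "sum l V = 1" "\<And>j. j \<in> V \<Longrightarrow> (\<Sum>i\<in>V. l i * b i j) \<le> \<epsilon>"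
      by blast
    define u where "u x = (\<Sum>i\<in>V. l i * i x)" for x
    \<comment> \<open>The game yields a mixture of payoffs; convexity in the first argument lets the
      corresponding combination of functions take the place of the mixture.\<close>
    have u: "u \<in> Dom \<and> E u - P u v \<le> (\<Sum>i\<in>V. l i * (E i - P i v))" if v: "v \<in> Dom" for v
      unfolding u_def
      by (rule Jensen_pointwise[where \<Phi> = "\<lambda>u. E u - P u v" and D = Dom, OF conv[OF v]])
        (use V l in auto)
    have le: "E u - P u v \<le> E v + \<epsilon>" if v: "v \<in> V" for v
    proof -
      have "(\<Sum>i\<in>V. l i * (E i - P i v)) = (\<Sum>i\<in>V. l i * b i v + l i * E v)"
        by (intro sum.cong refl) (simp add: b_def algebra_simps)
      also have "\<dots> = (\<Sum>i\<in>V. l i * b i v) + sum l V * E v"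
        by (simp add: sum.distrib sum_distrib_right)
      also have "\<dots> \<le> \<epsilon> + E v" using l(2) l(3)[OF v] by simp
      finally show ?thesis using u[of v] v V(3) by fastforce
    qed
    have uD: "u \<in> Dom" using u[OF Dom_zero] by blast
    have "P u (\<lambda>x. 0) = 0" using Panti[OF uD Dom_zero] by (simp add: P_def)
    then have "E u \<le> 1" using le[of "\<lambda>x. 0"] eps(2) by (simp add: V_def E_zero)
    then have "2 * p * E u \<le> 2 * p * 1"
      using p_pos by (intro mult_left_mono) auto
    then have "grad_energy u \<le> 2 * p + B" using B[OF uD] by linarith
    moreover have "u \<in> C j" if j: "j \<in> G" for j
    proof -
      have "fst j \<in> V" using j by (simp add: V_def)
      then show ?thesis using le[of "fst j"] eps(3)[OF j] uD by (simp add: C_def)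
    qed
    ultimately show "\<exists>u\<in>W. (\<forall>j\<in>G. u \<in> C j) \<and> grad_energy u \<le> 2 * p + B"
      using Dom_W[OF uD] by blast
  next
    fix u v j assume "j \<in> J" and uv: "u \<in> C j" "v \<in> C j"
    then have "fst j \<in> Dom" by (auto simp: J_def)
    let ?m = "\<lambda>x. 1/2 * u x + 1/2 * v x"
    have "E u - P u (fst j) \<le> E (fst j) + snd j" "E v - P v (fst j) \<le> E (fst j) + snd j"
      using uv by (auto simp: C_def)
    moreover have m: "?m \<in> Dom" "E ?m - P ?m (fst j) \<le> 1/2 * (E u - P u (fst j)) + 1/2 * (E v - P v (fst j))"
      using conv[of "fst j" u v "1/2"] \<open>fst j \<in> Dom\<close> uv by (simp_all add: C_def)
    moreover have "x \<le> r \<Longrightarrow> y \<le> r \<Longrightarrow> z \<le> 1/2 * x + 1/2 * y \<Longrightarrow> z \<le> r" for x y z r :: real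
      by linarith
    ultimately have "E ?m - P ?m (fst j) \<le> E (fst j) + snd j" by blast
    then show "?m \<in> C j" using m(1) by (simp add: C_def)
  next
    fix j and w :: "nat \<Rightarrow> real^'n \<Rightarrow> real" and u
    assume j: "j \<in> J" and w: "\<And>n. w n \<in> W \<and> w n \<in> C j" and u: "u \<in> W"
      and lim: "Lp_tendsto \<mu> p w u" "Lp_tendsto \<mu> p (\<lambda>n. wgrad \<Omega> (w n)) (wgrad \<Omega> u)"
    have v: "fst j \<in> Dom" using j by (auto simp: J_def)
    have wD: "\<And>n. w n \<in> Dom" and le: "\<And>n. E (w n) \<le> E (fst j) + snd j + P (w n) (fst j)"
      using w by (auto simp: C_def algebra_simps)
    have "(\<lambda>n. P (w n) (fst j)) \<longlonglongrightarrow> P u (fst j)"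
      unfolding P_def using W01p_Lp(1) w u A_L2[OF Dom_W[OF v]] lim(1) by (intro pairing_tendsto) auto
    then have "(\<lambda>n. E (fst j) + snd j + P (w n) (fst j)) \<longlonglongrightarrow> E (fst j) + snd j + P u (fst j)"
      by (intro tendsto_intros)
    from E_closed[OF wD u this le lim] show "u \<in> C j" by (simp add: C_def)
  qed
  then obtain u where u: "u \<in> W" "\<And>j. j \<in> J \<Longrightarrow> u \<in> C j" by blast
  have D: "u \<in> Dom" using u(2)[of "(\<lambda>x. 0, 1)"] Dom_zero by (simp add: J_def C_def)
  \<comment> \<open>Membership for every tolerance removes the error, and antisymmetry returns the
    pairing to the form used in the conjugate.\<close>
  have "P v u - E v \<le> - E u" if v: "v \<in> Dom" for v
  proof -
    have "E u - P u v \<le> E v + e" if "e > 0" for e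
      using u(2)[of "(v, e)"] v that by (simp add: J_def C_def)
    then have "E u - P u v \<le> E v" by (rule field_le_epsilon)
    then show ?thesis using Panti[OF D v] by simp
  qed
  then have "I u = 0" using I_zero_iff[OF u(1)] D by (simp add: P_def)
  then show ?thesis using u(1) by blast
qed

lemma I_inf: "(INF v\<in>W. I v) = 0"
proof (rule antisym)
  obtain u where "u \<in> W" "I u = 0" using zero_exists by blast
  then show "(INF v\<in>W. I v) \<le> 0" by (metis INF_lower)
  show "0 \<le> (INF v\<in>W. I v)" by (intro INF_greatest I_nonneg)
qed

section \<open>The Euler--Lagrange equation\<close>

text \<open>The integrand has norm \<open>norm (b x) powr (q - 1)\<close>, at most
  \<open>1 + norm (b x) powr q\<close> on a finite measure. With \<open>q = p\<close> it is the
  flux, with \<open>q = m\<close> the power term of the equation.\<close>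

lemma powr_bound_integrable:
  fixes b :: "real^'n \<Rightarrow> 'b::euclidean_space"
  assumes "Lp_mem \<mu> q b" "q > 1"
  shows "integrable \<mu> (\<lambda>x. norm (b x) powr (q - 2) *\<^sub>R b x)"
proof (rule Bochner_Integration.integrable_bound)
  show "integrable \<mu> (\<lambda>x. 1 + norm (b x) powr q)" using assms by (simp add: Lp_mem_def)
  show "(\<lambda>x. norm (b x) powr (q - 2) *\<^sub>R b x) \<in> borel_measurable \<mu>"
    using Lp_memD(1)[OF assms(1)] by measurable
  have "norm (norm (b x) powr (q - 2) *\<^sub>R b x) = norm (b x) powr (q - 1)" for x
    using powr_add[of "norm (b x)" "q - 2" 1] by (cases "b x = 0") (auto simp: powr_one)
  then show "AE x in \<mu>. norm (norm (b x) powr (q - 2) *\<^sub>R b x) \<le> norm (1 + norm (b x) powr q)"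
    using powr_le_one_add[of "q - 1" q "norm (b _)"] assms(2) by (auto simp: abs_of_nonneg)
qed

lemma powr_directional_integrable:
  fixes b h :: "real^'n \<Rightarrow> 'b::euclidean_space"
  assumes "Lp_mem \<mu> q b" "q > 1" "h \<in> borel_measurable \<mu>" "\<And>x. norm (h x) \<le> C"
  shows "integrable \<mu> (\<lambda>x. norm (b x) powr (q - 2) * (b x \<bullet> h x))"
proof (rule Bochner_Integration.integrable_bound)
  show "integrable \<mu> (\<lambda>x. C * norm (norm (b x) powr (q - 2) *\<^sub>R b x))"
    by (intro integrable_mult_right integrable_norm powr_bound_integrable[OF assms(1,2)])
  show "AE x in \<mu>. norm (norm (b x) powr (q - 2) * (b x \<bullet> h x)) \<le> norm (C * norm (norm (b x) powr (q - 2) *\<^sub>R b x))"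
  proof (rule AE_I2)
    fix x
    have C0: "0 \<le> C" using assms(4)[of x] norm_ge_zero order_trans by blast
    have "\<bar>b x \<bullet> h x\<bar> \<le> norm (b x) * norm (h x)" by (rule Cauchy_Schwarz_ineq2)
    also have "\<dots> \<le> norm (b x) * C" by (intro mult_left_mono assms(4)) simp
    finally have "norm (b x) powr (q - 2) * \<bar>b x \<bullet> h x\<bar> \<le> norm (b x) powr (q - 2) * (norm (b x) * C)"
      by (intro mult_left_mono) auto
    then show "norm (norm (b x) powr (q - 2) * (b x \<bullet> h x)) \<le> norm (C * norm (norm (b x) powr (q - 2) *\<^sub>R b x))"
      using C0 by (simp add: abs_mult mult_ac)
  qed
qed (use assms in \<open>auto simp: Lp_mem_def\<close>)

text \<open>One statement for both nonlinear terms: the gradient with direction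
  \<open>grad \<psi>\<close> and exponent \<open>p\<close>, and the function with direction \<psi>
  and exponent \<open>m\<close>. Directions coming from test functions are bounded, which is what
  domination requires.\<close>

lemma powr_directional_tendsto:
  fixes b h :: "real^'n \<Rightarrow> 'b::euclidean_space"
  assumes b: "Lp_mem \<mu> q b" and q: "q > 1" and h: "h \<in> borel_measurable \<mu>" "\<And>x. norm (h x) \<le> C"
    and s: "s \<longlonglongrightarrow> 0" "\<And>n::nat. \<bar>s n\<bar> \<le> 1"
  shows "(\<lambda>n. LINT x|\<mu>. norm (b x + s n *\<^sub>R h x) powr (q - 2) * ((b x + s n *\<^sub>R h x) \<bullet> h x))
    \<longlonglongrightarrow> (LINT x|\<mu>. norm (b x) powr (q - 2) * (b x \<bullet> h x))"
proof (rule integral_dominated_convergence[where w = "\<lambda>x. C * (1 + 2 powr q * (norm (b x) powr q + C powr q))"])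
  have [measurable]: "b \<in> borel_measurable \<mu>" using b by (simp add: Lp_mem_def)
  note [measurable] = h(1)
  show "(\<lambda>x. norm (b x) powr (q - 2) * (b x \<bullet> h x)) \<in> borel_measurable \<mu>" by measurable
  show "(\<lambda>x. norm (b x + s n *\<^sub>R h x) powr (q - 2) * ((b x + s n *\<^sub>R h x) \<bullet> h x)) \<in> borel_measurable \<mu>" for n
    by measurable
  \<comment> \<open>The majorant bounds the power \<open>q - 1\<close> of the shifted vector by 1
    plus its power \<open>q\<close>, splits the latter with \<open>norm_add_powr_le\<close>, and
    multiplies by the bound \<open>C\<close> on the direction.\<close>
  show "integrable \<mu> (\<lambda>x. C * (1 + 2 powr q * (norm (b x) powr q + C powr q)))"
    using b by (simp add: Lp_mem_def)
  show "AE x in \<mu>. (\<lambda>n. norm (b x + s n *\<^sub>R h x) powr (q - 2) * ((b x + s n *\<^sub>R h x) \<bullet> h x))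
      \<longlonglongrightarrow> norm (b x) powr (q - 2) * (b x \<bullet> h x)"
  proof (rule AE_I2)
    fix x
    have "(\<lambda>n. b x + s n *\<^sub>R h x) \<longlonglongrightarrow> b x + 0 *\<^sub>R h x" by (intro tendsto_intros s)
    then have "(\<lambda>n. norm (b x + s n *\<^sub>R h x) powr (q - 2) *\<^sub>R (b x + s n *\<^sub>R h x)) \<longlonglongrightarrow> norm (b x) powr (q - 2) *\<^sub>R b x"
      using isCont_tendsto_compose[OF continuous_norm_powr_scaleR[OF q, of "b x"]] by simp
    from tendsto_inner[OF this tendsto_const[of "h x"]]
    show "(\<lambda>n. norm (b x + s n *\<^sub>R h x) powr (q - 2) * ((b x + s n *\<^sub>R h x) \<bullet> h x))
      \<longlonglongrightarrow> norm (b x) powr (q - 2) * (b x \<bullet> h x)" by simp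
  qed
  fix n
  show "AE x in \<mu>. norm (norm (b x + s n *\<^sub>R h x) powr (q - 2) * ((b x + s n *\<^sub>R h x) \<bullet> h x))
      \<le> C * (1 + 2 powr q * (norm (b x) powr q + C powr q))"
  proof (rule AE_I2)
    fix x
    let ?y = "b x + s n *\<^sub>R h x"
    have C0: "0 \<le> C" using h(2)[of x] norm_ge_zero order_trans by blast
    have "norm (s n *\<^sub>R h x) \<le> 1 * C" unfolding norm_scaleR
      using s(2)[of n] h(2)[of x] by (intro mult_mono) auto
    then have "norm (s n *\<^sub>R h x) powr q \<le> C powr q" using q by (intro powr_mono2) auto
    then have "2 powr q * (norm (b x) powr q + norm (s n *\<^sub>R h x) powr q)
        \<le> 2 powr q * (norm (b x) powr q + C powr q)"
      by (intro mult_left_mono add_left_mono) auto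
    then have "norm ?y powr q \<le> 2 powr q * (norm (b x) powr q + C powr q)"
      using norm_add_powr_le[of q "b x" "s n *\<^sub>R h x"] q by linarith
    then have 1: "norm ?y powr (q - 1) \<le> 1 + 2 powr q * (norm (b x) powr q + C powr q)"
      using powr_le_one_add[of "q - 1" q "norm ?y"] q by simp
    have "norm (norm ?y powr (q - 2) * (?y \<bullet> h x)) \<le> norm ?y powr (q - 2) * (norm ?y * norm (h x))"
      by (simp add: abs_mult mult_left_mono Cauchy_Schwarz_ineq2)
    also have "\<dots> = norm ?y powr (q - 1) * norm (h x)"
      using powr_add[of "norm ?y" "q - 2" 1] by (cases "?y = 0") (auto simp: powr_one)
    also have "\<dots> \<le> (1 + 2 powr q * (norm (b x) powr q + C powr q)) * C"
      using 1 h(2)[of x] C0 by (intro mult_mono) auto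
    finally show "norm (norm ?y powr (q - 2) * (?y \<bullet> h x)) \<le> C * (1 + 2 powr q * (norm (b x) powr q + C powr q))"
      by (simp add: mult.commute)
  qed
qed

text \<open>The first variation of \<open>E\<close>.  The gradient is a separate argument since \<open>wgrad\<close> is additive
  only almost everywhere.\<close>

definition dE :: "(real^'n \<Rightarrow> real) \<Rightarrow> (real^'n \<Rightarrow> real^'n) \<Rightarrow> (real^'n \<Rightarrow> real) \<Rightarrow> real" where
  "dE u g \<psi> = (LINT x|\<mu>. norm (g x) powr (p - 2) * (g x \<bullet> grad \<psi> x))
    + 1/2 * (LINT x|\<mu>. \<kappa> x * u x * \<psi> x)
    + (LINT x|\<mu>. \<bar>u x\<bar> powr (m - 2) * (u x * \<psi> x)) + (LINT x|\<mu>. \<psi> x * f x)"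

text \<open>The supporting hyperplane inequality is integrated at the shifted function and evaluated
  at \<open>u\<close>, so the increment is bounded above by the derivative at the shifted point. The
  limit in the first variation then only requires continuity of \<open>dE\<close> along the
  ray.\<close>

lemma E_gradient_ineq:
  assumes u: "u \<in> Dom" and psi: "\<psi> \<in> test_functions \<Omega>"
  shows "E (\<lambda>x. u x + t * \<psi> x) - E u \<le> t * dE (\<lambda>x. u x + t * \<psi> x) (\<lambda>x. wgrad \<Omega> u x + t *\<^sub>R grad \<psi> x) \<psi>"
proof -
  let ?w = "\<lambda>x. u x + t * \<psi> x" and ?g = "\<lambda>x. wgrad \<Omega> u x + t *\<^sub>R grad \<psi> x"
  have w: "?w \<in> Dom" using Dom_lincomb[OF u Dom_test[OF psi], of 1 t] by simp
  note W = Dom_W[OF u] Dom_W[OF w]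
  obtain C where C: "\<And>x. \<bar>\<psi> x\<bar> \<le> C" "\<And>x. norm (grad \<psi> x) \<le> C" using test_bounded[OF psi] by metis
  have gm: "grad \<psi> \<in> borel_measurable \<mu>" "\<psi> \<in> borel_measurable \<mu>" "Lp_mem \<mu> 2 \<psi>"
    using test_Lp'[OF psi, of 2] by (auto simp: Lp_mem_def)
  have "AE x in \<mu>. wgrad \<Omega> ?w x = wgrad \<Omega> u x + t *\<^sub>R wgrad \<Omega> \<psi> x"
    using W01p_lincomb(2)[OF W(1) W01p_test(1)[OF psi], of 1 t] by simp
  then have ae: "AE x in \<mu>. wgrad \<Omega> ?w x = ?g x"
    using W01p_test(2)[OF psi] by eventually_elim simp
  have gL: "Lp_mem \<mu> p ?g"
    using W01p_Lp(2)[OF W(1)] test_Lp'(2)[OF psi p_nonneg] p_nonneg by (intro Lp_mem_add Lp_mem_scaleR)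
  have gw: "grad_energy ?w = (LINT x|\<mu>. norm (?g x) powr p)"
    unfolding grad_energy_def
    by (rule integral_cong_AE) (use ae gL W01p_Lp(2)[OF W(2)] in \<open>auto simp: Lp_mem_def elim: eventually_mono\<close>)
  have i1: "integrable \<mu> (\<lambda>x. norm (?g x) powr (p - 2) * (?g x \<bullet> grad \<psi> x))"
    by (rule powr_directional_integrable[OF gL p_gt_1 gm(1) C(2)])
  have wm: "Lp_mem \<mu> m ?w" using w by (simp add: Dom_def)
  have i2: "integrable \<mu> (\<lambda>x. \<bar>?w x\<bar> powr (m - 2) * (?w x * \<psi> x))"
    using powr_directional_integrable[OF wm m_gt_1 gm(2), of C] C(1) by simp
  have i3: "integrable \<mu> (\<lambda>x. \<kappa> x * ?w x * \<psi> x)"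
    by (rule L2_mult_integrable[OF kappa_mult_L2[OF W01p_Lp(3)[OF W(2)]] gm(3)])
  have 1: "grad_energy ?w - grad_energy u \<le> p * t * (LINT x|\<mu>. norm (?g x) powr (p - 2) * (?g x \<bullet> grad \<psi> x))"
  proof -
    have "(LINT x|\<mu>. norm (?g x) powr p - norm (wgrad \<Omega> u x) powr p)
        \<le> (LINT x|\<mu>. p * t * (norm (?g x) powr (p - 2) * (?g x \<bullet> grad \<psi> x)))"
    proof (rule integral_mono)
      show "norm (?g x) powr p - norm (wgrad \<Omega> u x) powr p \<le> p * t * (norm (?g x) powr (p - 2) * (?g x \<bullet> grad \<psi> x))" for x
        using norm_powr_gradient_ineq[OF p_gt_1, of "?g x" "wgrad \<Omega> u x"] by (simp add: algebra_simps)
    qed (use gL W01p_Lp(2)[OF W(1)] i1 in \<open>auto simp: Lp_mem_def\<close>)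
    then show ?thesis using gL W01p_Lp(2)[OF W(1)] unfolding gw by (simp add: Lp_mem_def grad_energy_def)
  qed
  have 2: "(LINT x|\<mu>. \<bar>?w x\<bar> powr m) - (LINT x|\<mu>. \<bar>u x\<bar> powr m) \<le> m * t * (LINT x|\<mu>. \<bar>?w x\<bar> powr (m - 2) * (?w x * \<psi> x))"
  proof -
    have "(LINT x|\<mu>. \<bar>?w x\<bar> powr m - \<bar>u x\<bar> powr m) \<le> (LINT x|\<mu>. m * t * (\<bar>?w x\<bar> powr (m - 2) * (?w x * \<psi> x)))"
    proof (rule integral_mono)
      show "\<bar>?w x\<bar> powr m - \<bar>u x\<bar> powr m \<le> m * t * (\<bar>?w x\<bar> powr (m - 2) * (?w x * \<psi> x))" for x
        using norm_powr_gradient_ineq[OF m_gt_1, of "?w x" "u x"] by (simp add: algebra_simps)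
    qed (use Dom_integrable[OF u] Dom_integrable[OF w] i2 in auto)
    then show ?thesis using Dom_integrable[OF u] Dom_integrable[OF w] by simp
  qed
  have 3: "(LINT x|\<mu>. \<kappa> x * (?w x)\<^sup>2) - (LINT x|\<mu>. \<kappa> x * (u x)\<^sup>2) \<le> 2 * t * (LINT x|\<mu>. \<kappa> x * ?w x * \<psi> x)"
  proof -
    note ki = kappa_sq_integrable[OF W01p_Lp(3)[OF W(1)]] kappa_sq_integrable[OF W01p_Lp(3)[OF W(2)]]
    have "(LINT x|\<mu>. \<kappa> x * (?w x)\<^sup>2 - \<kappa> x * (u x)\<^sup>2) \<le> (LINT x|\<mu>. 2 * t * (\<kappa> x * ?w x * \<psi> x))"
    proof (rule integral_mono_AE)
      show "AE x in \<mu>. \<kappa> x * (?w x)\<^sup>2 - \<kappa> x * (u x)\<^sup>2 \<le> 2 * t * (\<kappa> x * ?w x * \<psi> x)"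
        using kappa_nonneg
      proof eventually_elim
        case (elim x)
        \<comment> \<open>The error of linearising the square is again a square times
          \<open>\<kappa> x\<close>, and the sign of \<kappa> decides.\<close>
        have "2 * t * (\<kappa> x * ?w x * \<psi> x) - (\<kappa> x * (?w x)\<^sup>2 - \<kappa> x * (u x)\<^sup>2) = \<kappa> x * (t * \<psi> x)\<^sup>2"
          by (simp add: power2_eq_square algebra_simps)
        moreover have "\<dots> \<ge> 0" using elim by simp
        ultimately show ?case by linarith
      qed
    qed (use ki i3 in auto)
    then show ?thesis using ki by simp
  qed
  have 4: "(LINT x|\<mu>. ?w x * f x) = (LINT x|\<mu>. u x * f x) + t * (LINT x|\<mu>. \<psi> x * f x)"
    using L2_mult_integrable[OF W01p_Lp(3)[OF W(1)] f_mem] L2_mult_integrable[OF gm(3) f_mem]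
    by (simp add: distrib_right mult.assoc)
  have G: "1/p * grad_energy ?w - 1/p * grad_energy u \<le> t * (LINT x|\<mu>. norm (?g x) powr (p - 2) * (?g x \<bullet> grad \<psi> x))"
    using mult_left_mono[OF 1, of "1/p"] p_pos by (simp add: right_diff_distrib)
  have M: "1/m * (LINT x|\<mu>. \<bar>?w x\<bar> powr m) - 1/m * (LINT x|\<mu>. \<bar>u x\<bar> powr m) \<le> t * (LINT x|\<mu>. \<bar>?w x\<bar> powr (m - 2) * (?w x * \<psi> x))"
    using mult_left_mono[OF 2, of "1/m"] m_gt_1 by (simp add: right_diff_distrib)
  show ?thesis
    using G M 3 4 unfolding E_def dE_def distrib_left by linarith
qed

text \<open>Compare \<open>u\<close> with \<open>u + s n * \<psi>\<close> for positive
  \<open>s n\<close>: by \<open>A_self\<close> only the pairing with \<psi> survives on the left,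
  and dividing by \<open>s n\<close> before letting it tend to 0 gives the one-sided
  inequality.\<close>

lemma Euler_Lagrange_ineq:
  assumes u: "u \<in> Dom" and min: "\<And>v. v \<in> Dom \<Longrightarrow> (LINT x|\<mu>. v x * A u x) - E v \<le> - E u"
    and psi: "\<psi> \<in> test_functions \<Omega>"
  shows "(LINT x|\<mu>. \<psi> x * A u x) \<le> dE u (wgrad \<Omega> u) \<psi>"
proof -
  note W = Dom_W[OF u]
  obtain C where C: "\<And>x. \<bar>\<psi> x\<bar> \<le> C" "\<And>x. norm (grad \<psi> x) \<le> C" using test_bounded[OF psi] by metis
  have gm: "grad \<psi> \<in> borel_measurable \<mu>" "\<psi> \<in> borel_measurable \<mu>" "Lp_mem \<mu> 2 \<psi>"
    using test_Lp'[OF psi, of 2] by (auto simp: Lp_mem_def)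
  define s where "s n = 1 / real (Suc n)" for n
  have s: "s \<longlonglongrightarrow> 0" "\<And>n. \<bar>s n\<bar> \<le> 1" "\<And>n. s n > 0"
    using LIMSEQ_inverse_real_of_nat by (simp_all add: s_def[abs_def] inverse_eq_divide del: of_nat_Suc)
  have le: "(LINT x|\<mu>. \<psi> x * A u x) \<le> dE (\<lambda>x. u x + s n * \<psi> x) (\<lambda>x. wgrad \<Omega> u x + s n *\<^sub>R grad \<psi> x) \<psi>" for n
  proof -
    have w: "(\<lambda>x. u x + s n * \<psi> x) \<in> Dom" using Dom_lincomb[OF u Dom_test[OF psi], of 1 "s n"] by simp
    have "(LINT x|\<mu>. (u x + s n * \<psi> x) * A u x) = (LINT x|\<mu>. u x * A u x) + s n * (LINT x|\<mu>. \<psi> x * A u x)"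
      using L2_mult_integrable[OF W01p_Lp(3)[OF W] A_L2[OF W]] L2_mult_integrable[OF gm(3) A_L2[OF W]]
      by (simp add: distrib_right mult.assoc)
    then have "s n * (LINT x|\<mu>. \<psi> x * A u x) \<le> s n * dE (\<lambda>x. u x + s n * \<psi> x) (\<lambda>x. wgrad \<Omega> u x + s n *\<^sub>R grad \<psi> x) \<psi>"
      using min[OF w] E_gradient_ineq[OF u psi, of "s n"] A_self[OF W] by linarith
    then show ?thesis using s(3)[of n] by (simp only: mult_le_cancel_left_pos)
  qed
  have uk: "(\<lambda>n. LINT x|\<mu>. \<kappa> x * (u x + s n * \<psi> x) * \<psi> x) \<longlonglongrightarrow> (LINT x|\<mu>. \<kappa> x * u x * \<psi> x)"
  proof -
    have i: "integrable \<mu> (\<lambda>x. \<kappa> x * u x * \<psi> x)" "integrable \<mu> (\<lambda>x. \<kappa> x * \<psi> x * \<psi> x)"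
      by (intro L2_mult_integrable kappa_mult_L2 W01p_Lp(3)[OF W] gm(3))+
    have "(\<lambda>n. (LINT x|\<mu>. \<kappa> x * u x * \<psi> x) + s n * (LINT x|\<mu>. \<kappa> x * \<psi> x * \<psi> x))
        \<longlonglongrightarrow> (LINT x|\<mu>. \<kappa> x * u x * \<psi> x) + 0 * (LINT x|\<mu>. \<kappa> x * \<psi> x * \<psi> x)"
      by (intro tendsto_intros s)
    moreover have "(LINT x|\<mu>. \<kappa> x * (u x + s n * \<psi> x) * \<psi> x)
        = (LINT x|\<mu>. \<kappa> x * u x * \<psi> x) + s n * (LINT x|\<mu>. \<kappa> x * \<psi> x * \<psi> x)" for n
    proof -
      have "(LINT x|\<mu>. \<kappa> x * (u x + s n * \<psi> x) * \<psi> x) = (LINT x|\<mu>. \<kappa> x * u x * \<psi> x + s n * (\<kappa> x * \<psi> x * \<psi> x))"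
        by (intro Bochner_Integration.integral_cong refl) (simp add: algebra_simps)
      then show ?thesis using i by simp
    qed
    ultimately show ?thesis by simp
  qed
  have um: "Lp_mem \<mu> m u" using u by (simp add: Dom_def)
  have "(\<lambda>n. LINT x|\<mu>. \<bar>u x + s n * \<psi> x\<bar> powr (m - 2) * ((u x + s n * \<psi> x) * \<psi> x))
      \<longlonglongrightarrow> (LINT x|\<mu>. \<bar>u x\<bar> powr (m - 2) * (u x * \<psi> x))"
    using powr_directional_tendsto[OF um m_gt_1 gm(2) _ s(1,2), of C] C(1) by simp
  then have "(\<lambda>n. dE (\<lambda>x. u x + s n * \<psi> x) (\<lambda>x. wgrad \<Omega> u x + s n *\<^sub>R grad \<psi> x) \<psi>) \<longlonglongrightarrow> dE u (wgrad \<Omega> u) \<psi>"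
    unfolding dE_def
    by (intro tendsto_add tendsto_const tendsto_mult uk
        powr_directional_tendsto[OF W01p_Lp(2)[OF W] p_gt_1 gm(1) C(2) s(1,2)])
  then show ?thesis by (rule LIMSEQ_le_const) (use le in auto)
qed

text \<open>Both sides are odd in \<psi>, so the one-sided inequality for \<open>- \<psi>\<close> is
  the reverse one.\<close>

lemma Euler_Lagrange:
  assumes u: "u \<in> Dom" and min: "\<And>v. v \<in> Dom \<Longrightarrow> (LINT x|\<mu>. v x * A u x) - E v \<le> - E u"
    and psi: "\<psi> \<in> test_functions \<Omega>"
  shows "(LINT x|\<mu>. \<psi> x * A u x) = dE u (wgrad \<Omega> u) \<psi>"
proof (rule antisym)
  show "(LINT x|\<mu>. \<psi> x * A u x) \<le> dE u (wgrad \<Omega> u) \<psi>" by (rule Euler_Lagrange_ineq[OF u min psi])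
  have psi': "(\<lambda>x. - \<psi> x) \<in> test_functions \<Omega>" and g: "grad (\<lambda>x. - \<psi> x) x = - grad \<psi> x" for x
    using test_linear[OF psi psi, of "-1" 0] by auto
  have "dE u (wgrad \<Omega> u) (\<lambda>x. - \<psi> x) = - dE u (wgrad \<Omega> u) \<psi>"
    by (simp add: dE_def g)
  then show "dE u (wgrad \<Omega> u) \<psi> \<le> (LINT x|\<mu>. \<psi> x * A u x)"
    using Euler_Lagrange_ineq[OF u min psi'] by simp
qed

text \<open>The zero-order part of \<open>A u\<close> equals the divergence part of
  \<open>1/2 * \<kappa> x * u x\<close> in the first variation. The two cancel, leaving
  \<open>1/2 * a0 x * u x\<close> on one side and the pure transport term on the other.\<close>

lemma zero_solves:
  assumes u: "u \<in> W" and I0: "I u = 0"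
  shows "solves_dirichlet_problem \<Omega> p m a a0 f u"
proof -
  have D: "u \<in> Dom" and min: "\<And>v. v \<in> Dom \<Longrightarrow> (LINT x|\<mu>. v x * A u x) - E v \<le> - E u"
    using I_zero_iff[OF u] I0 by auto
  have um: "Lp_mem \<mu> m u" using D by (simp add: Dom_def)
  note L = W01p_Lp[OF u]
  have a0m: "a0 \<in> borel_measurable \<mu>" using a0_bounded by (simp add: Linfty_def)
  obtain C0 where "AE x in \<mu>. \<bar>a0 x\<bar> \<le> C0" using a0_bounded by (auto simp: Linfty_def)
  from Lp_mem_bounded_mult[OF L(3) a0m this] have a0u: "Lp_mem \<mu> 2 (\<lambda>x. a0 x * u x)" by simp
  have flux: "integrable \<mu> (p_flux \<Omega> p u)"
    unfolding p_flux_def[abs_def] by (rule powr_bound_integrable[OF L(2) p_gt_1])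
  have um': "integrable \<mu> (\<lambda>x. u x * \<bar>u x\<bar> powr (m - 2))"
    using powr_bound_integrable[OF um m_gt_1] by (simp add: mult.commute)
  have a0i: "integrable \<mu> (\<lambda>x. a0 x * u x)" "integrable \<mu> f"
    using Lp_mem_integrable[OF a0u] Lp_mem_integrable[OF f_mem] by auto
  have rhs: "integrable \<mu> (\<lambda>x. 1/2 * a0 x * u x + u x * \<bar>u x\<bar> powr (m - 2) + f x)"
    using um' a0i by (simp add: mult.assoc)
  have ag: "Lp_mem \<mu> 2 (\<lambda>x. a x \<bullet> wgrad \<Omega> u x)" by (rule T_L2(1)[OF L(3,4)])
  have eq: "- p_laplacian \<Omega> p u \<psi>
      + regular_distribution \<Omega> (\<lambda>x. 1/2 * a0 x * u x + u x * \<bar>u x\<bar> powr (m - 2) + f x) \<psi>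
      = regular_distribution \<Omega> (\<lambda>x. a x \<bullet> wgrad \<Omega> u x) \<psi>" if psi: "\<psi> \<in> test_functions \<Omega>" for \<psi>
  proof -
    obtain C where C: "\<And>x. \<bar>\<psi> x\<bar> \<le> C" "\<And>x. norm (grad \<psi> x) \<le> C" using test_bounded[OF psi] by metis
    have gm: "\<psi> \<in> borel_measurable \<mu>" "Lp_mem \<mu> 2 \<psi>"
      using test_Lp'[OF psi, of 2] by (auto simp: Lp_mem_def)
    have i: "integrable \<mu> (\<lambda>x. \<bar>u x\<bar> powr (m - 2) * (u x * \<psi> x))"
      using powr_directional_integrable[OF um m_gt_1 gm(1), of C] C(1) by simp
    have ia: "integrable \<mu> (\<lambda>x. (a x \<bullet> wgrad \<Omega> u x) * \<psi> x)"
      and id: "integrable \<mu> (\<lambda>x. (1/2 * divergence a x * u x) * \<psi> x)"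
      and i0: "integrable \<mu> (\<lambda>x. (a0 x * u x) * \<psi> x)" and ifn: "integrable \<mu> (\<lambda>x. \<psi> x * f x)"
      by (intro L2_mult_integrable ag gm(2) a_mult_L2 L(3) a0u f_mem)+
    have EL: "(LINT x|\<mu>. \<psi> x * A u x) = dE u (wgrad \<Omega> u) \<psi>" by (rule Euler_Lagrange[OF D min psi])
    have 1: "(LINT x|\<mu>. \<psi> x * A u x) = (LINT x|\<mu>. (a x \<bullet> wgrad \<Omega> u x) * \<psi> x) + (LINT x|\<mu>. (1/2 * divergence a x * u x) * \<psi> x)"
    proof -
      have "(LINT x|\<mu>. \<psi> x * A u x) = (LINT x|\<mu>. (a x \<bullet> wgrad \<Omega> u x) * \<psi> x + (1/2 * divergence a x * u x) * \<psi> x)"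
        by (intro Bochner_Integration.integral_cong refl) (simp add: A_def T_def algebra_simps)
      then show ?thesis using ia id by simp
    qed
    have 2: "1/2 * (LINT x|\<mu>. \<kappa> x * u x * \<psi> x) = (LINT x|\<mu>. (1/2 * divergence a x * u x) * \<psi> x) + 1/2 * (LINT x|\<mu>. (a0 x * u x) * \<psi> x)"
    proof -
      have "1/2 * (LINT x|\<mu>. \<kappa> x * u x * \<psi> x) = (LINT x|\<mu>. 1/2 * (\<kappa> x * u x * \<psi> x))" by simp
      also have "\<dots> = (LINT x|\<mu>. (1/2 * divergence a x * u x) * \<psi> x + 1/2 * ((a0 x * u x) * \<psi> x))"
        by (intro Bochner_Integration.integral_cong refl) (simp add: \<kappa>_def algebra_simps)
      also have "\<dots> = (LINT x|\<mu>. (1/2 * divergence a x * u x) * \<psi> x) + (LINT x|\<mu>. 1/2 * ((a0 x * u x) * \<psi> x))"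
        by (intro Bochner_Integration.integral_add id integrable_mult_right i0)
      finally show ?thesis by simp
    qed
    have 3: "regular_distribution \<Omega> (\<lambda>x. 1/2 * a0 x * u x + u x * \<bar>u x\<bar> powr (m - 2) + f x) \<psi>
      = 1/2 * (LINT x|\<mu>. (a0 x * u x) * \<psi> x) + (LINT x|\<mu>. \<bar>u x\<bar> powr (m - 2) * (u x * \<psi> x)) + (LINT x|\<mu>. \<psi> x * f x)"
    proof -
      have "regular_distribution \<Omega> (\<lambda>x. 1/2 * a0 x * u x + u x * \<bar>u x\<bar> powr (m - 2) + f x) \<psi>
        = (LINT x|\<mu>. 1/2 * ((a0 x * u x) * \<psi> x) + \<bar>u x\<bar> powr (m - 2) * (u x * \<psi> x) + \<psi> x * f x)"
        unfolding regular_distribution_def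
        by (intro Bochner_Integration.integral_cong refl) (simp add: algebra_simps)
      also have "\<dots> = (LINT x|\<mu>. 1/2 * ((a0 x * u x) * \<psi> x)) + (LINT x|\<mu>. \<bar>u x\<bar> powr (m - 2) * (u x * \<psi> x)) + (LINT x|\<mu>. \<psi> x * f x)"
        using i i0 ifn by (simp del: integral_mult_right_zero)
      finally show ?thesis by simp
    qed
    have 4: "- p_laplacian \<Omega> p u \<psi> = (LINT x|\<mu>. norm (wgrad \<Omega> u x) powr (p - 2) * (wgrad \<Omega> u x \<bullet> grad \<psi> x))"
      by (simp add: p_laplacian_def distributional_div_def p_flux_def)
    show ?thesis
      using EL unfolding 3 4 dE_def 1 2 by (simp add: regular_distribution_def)
  qed
  show ?thesis
    unfolding solves_dirichlet_problem_def
    using sob_weak_gradient[OF u[unfolded W01p_iff]] integrable_locally_integrable[OF flux]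
      integrable_locally_integrable[OF rhs] Lp_locally_integrable[OF ag] eq u by auto
qed

end

theorem theorem3p3:
  fixes \<Omega> :: "(real^'n::finite) set"
    and p m :: real
    and a :: "real^'n \<Rightarrow> real^'n"
    and a0 f :: "real^'n \<Rightarrow> real"
  assumes "open \<Omega>" and "bounded \<Omega>" and "smooth_boundary \<Omega>"
    and "p \<ge> 2" and "m > 1"
    and "smooth_vector_field_on_closure \<Omega> a"
    and "f \<in> L2 \<Omega>"
    and "a0 \<in> Linfty \<Omega>"
    and "AE x in lebesgue_on \<Omega>. 1/2 * (divergence a x + a0 x) \<ge> 0"
  defines "\<phi> \<equiv> energy \<Omega> p m a a0 f"
    and "I \<equiv> selfdual_functional \<Omega> p m a a0 f"
  shows "convex_functional \<Omega> \<phi> \<and> lsc_functional \<Omega> \<phi> \<and>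
    (\<exists>u\<in>W01p p \<Omega>. I u = (INF v\<in>W01p p \<Omega>. I v) \<and> (INF v\<in>W01p p \<Omega>. I v) = 0) \<and>
    (\<forall>u\<in>W01p p \<Omega>. I u = (INF v\<in>W01p p \<Omega>. I v) \<longrightarrow> solves_dirichlet_problem \<Omega> p m a a0 f u)"
proof -
  interpret dirichlet_setting \<Omega> p m a a0 f
    using assms by unfold_locales auto
  show ?thesis
    unfolding \<phi>_def I_def
    using energy_convex energy_lsc I_inf zero_exists zero_solves by auto
qed

end
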